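(* Let $w_{\alpha_1},w_{\alpha_2}$ be marked points of $\Sigma_n$, let $\xi^{\alpha_1}:T^*\mathcal M^{(d)}\to T^*\mathcal M^{(d+1)}$ be the map of Hitchin systems given by the upper symplectic Hecke correspondence at $w_{\alpha_1}$, and let $\xi_{\alpha_2}:T^*\mathcal M^{(d)}\to T^*\mathcal M^{(d-1)}$ be the map given by the lower symplectic Hecke correspondence at $w_{\alpha_2}$ (for every degree $d$). Then the composition $$\xi^{\alpha_1}_{\alpha_2}=\xi^{\alpha_1}\cdot\xi_{\alpha_2}$$ is a Bäcklund transformation of the Hitchin system on $T^*\mathcal M^{(d)}$, parameterized by the pair of marked points $(w_{\alpha_1},w_{\alpha_2})$; that is, it is a symplectic transformation of the phase space which maps solutions of the Hitchin hierarchy into solutions.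
   Context: Setting. $\Sigma_n$ is a compact Riemann surface with marked points $w_1,\dots,w_n$; $T^*\mathcal M^{(d)}=T^*\mathcal M^{(d)}(\Sigma_n,G)$, $G=\mathrm{GL}(N,\mathbb C)$, denotes the phase space of the Hitchin system of rank $N$, degree $d$ bundles with quasi-parabolic structure: it is the symplectic quotient, by holomorphic gauge transformations $f=(f_a)$ with values at $w_\alpha$ in parabolic subgroups $P_\alpha\subset G$, of the space of pairs $(\eta_{ab},g_{ab})$ of Higgs fields and holomorphic transition functions on the overlaps $\mathcal U_{ab}$ of a covering by disks ($\eta_{ab}=g_{ab}\eta_{ba}g_{ab}^{-1}$; action $g_{ab}\mapsto f_ag_{ab}f_b^{-1}$, $\eta_{ab}\mapsto f_a\eta_{ab}f_a^{-1}$), with symplectic form induced from $\sum_{\rm edges}\int_{\Gamma_a^b}D\,\mathrm{tr}(\eta_{ab}Dg_{ab}g_{ab}^{-1})$ (here $D$ is the exterior differential on the phase space and $\Gamma_a^b\subset\mathcal U_{ab}$ are the edges of the graph of the covering). The moment is fixed so that the Higgs field has a first order pole $z_\alpha^{-1}p_\alpha^{(0)}dz_\alpha$ at $w_\alpha$ ($z_\alpha=z-w_\alpha$, $p^{(0)}_\alpha$ a diagonal matrix orthogonal to the dual Cartan subalgebra of the maximal semisimple subgroup of $P_\alpha$ and generic among these) and is holomorphic elsewhere. The Hitchin hierarchy is the set of commuting Hamiltonian flows on this space generated by $I_{j,k}=\sum_{\rm edges}\int_{\Gamma_a^b}\nu_{(j,k)}\mathrm{tr}(\eta_{ab}^{j})$,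 $j=1,\dots,N$, where $\nu_{(j,k)}$ are fixed $(1-j,0)$-differentials. Symplectic Hecke correspondence. On the punctured disk around $w_\alpha$, in a frame compatible with the flag at $w_\alpha$ (whose smallest nonzero subspace is assumed one-dimensional), put $$\Xi_\alpha^+=\begin{pmatrix}0&\mathrm{Id}_{N-1}\\ z_\alpha&0\end{pmatrix},\qquad \Xi_\alpha^-=\begin{pmatrix}0&z_\alpha^{-1}\\ \mathrm{Id}_{N-1}&0\end{pmatrix}.$$ The upper (lower) symplectic Hecke correspondence at $w_\alpha$ sends $(g_{\alpha b},\eta_{\alpha b})$ to $(\Xi^{\pm}_\alpha g_{\alpha b},\Xi^{\pm}_\alpha\eta_{\alpha b}(\Xi_\alpha^{\pm})^{-1})$ with sign $+$ (resp. $-$), and changes nothing away from $w_\alpha$; it changes the degree by $+1$ (resp. $-1$). *)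

theory Defs
  imports "HOL-Complex_Analysis.Complex_Analysis"
begin

section \<open>Riemann surface, covering by disks, graph of the covering\<close>

text \<open>
  The type \<open>'s\<close> is the surface itself; its complex structure is the one generated by the atlas
  \<open>coord a : disk a \<rightarrow> \<complex>\<close>. A marked point lies in exactly one disk and carries the label of that
  disk, so \<open>marked\<close> is a subset of \<open>labels\<close> and the number \<open>n\<close> of marked points is \<open>card (marked C)\<close>.
  \<open>edge a b\<close> is the edge \<open>\<Gamma>_a^b\<close>, oriented as part of the boundary of the face contained in
  \<open>disk a\<close>; \<open>nbrs a\<close> lists the \<open>b\<close> in the cyclic order in which these edges bound that face;
  \<open>edges\<close> selects one of the two orientations of each edge.
\<close>

record ('s, 'i) curve =
  labels :: "'i set"
  disk :: "'i \<Rightarrow> 's set"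
  coord :: "'i \<Rightarrow> 's \<Rightarrow> complex"
  marked :: "'i set"
  mpoint :: "'i \<Rightarrow> 's"
  edges :: "('i \<times> 'i) set"
  nbrs :: "'i \<Rightarrow> 'i list"
  edge :: "'i \<Rightarrow> 'i \<Rightarrow> real \<Rightarrow> 's"

definition overlap :: "('s, 'i) curve \<Rightarrow> 'i \<Rightarrow> 'i \<Rightarrow> 's set" where
  "overlap C a b = disk C a \<inter> disk C b"

definition uncoord :: "('s, 'i) curve \<Rightarrow> 'i \<Rightarrow> complex \<Rightarrow> 's" where
  "uncoord C a = inv_into (disk C a) (coord C a)"

fun join_path_list :: "(real \<Rightarrow> 's::topological_space) list \<Rightarrow> real \<Rightarrow> 's" where
  "join_path_list [] = undefined"
| "join_path_list [g] = g"
| "join_path_list (g # h # gs) = g +++ join_path_list (h # gs)"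

definition face_boundary :: "('s::topological_space, 'i) curve \<Rightarrow> 'i \<Rightarrow> real \<Rightarrow> complex" where
  "face_boundary C a = coord C a \<circ> join_path_list (map (edge C a) (nbrs C a))"

definition face :: "('s::topological_space, 'i) curve \<Rightarrow> 'i \<Rightarrow> 's set" where
  "face C a = {p \<in> disk C a. coord C a p \<in> inside (path_image (face_boundary C a))}"

definition disk_covering :: "('s::t2_space, 'i) curve \<Rightarrow> bool" where
  "disk_covering C \<longleftrightarrow>
     compact (UNIV :: 's set) \<and> connected (UNIV :: 's set) \<and>
     finite (labels C) \<and> (\<Union>a\<in>labels C. disk C a) = UNIV \<and>
     (\<forall>a\<in>labels C. open (disk C a) \<and>
        (\<exists>c r. 0 < r \<and> homeomorphism (disk C a) (ball c r) (coord C a) (uncoord C a))) \<and>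
     (\<forall>a\<in>labels C. \<forall>b\<in>labels C.
        (coord C b \<circ> uncoord C a) holomorphic_on coord C a ` overlap C a b)"

definition marked_points :: "('s, 'i) curve \<Rightarrow> bool" where
  "marked_points C \<longleftrightarrow> marked C \<subseteq> labels C \<and>
     (\<forall>a\<in>marked C. mpoint C a \<in> disk C a \<and>
        (\<forall>b\<in>labels C. b \<noteq> a \<longrightarrow> mpoint C a \<notin> disk C b))"

definition covering_graph :: "('s::t2_space, 'i) curve \<Rightarrow> bool" where
  "covering_graph C \<longleftrightarrow>
     edges C \<subseteq> labels C \<times> labels C \<and>
     (\<forall>(a, b)\<in>edges C. a \<noteq> b \<and> (b, a) \<notin> edges C \<and>
        edge C b a = reversepath (edge C a b)) \<and>
     (\<forall>a\<in>labels C.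
        nbrs C a \<noteq> [] \<and> distinct (nbrs C a) \<and>
        set (nbrs C a) = {b. (a, b) \<in> edges C \<or> (b, a) \<in> edges C} \<and>
        (\<forall>b\<in>set (nbrs C a). path_image (edge C a b) \<subseteq> overlap C a b \<and>
           valid_path (coord C a \<circ> edge C a b)) \<and>
        (\<forall>i<length (nbrs C a).
           pathfinish (edge C a (nbrs C a ! i)) =
           pathstart (edge C a (nbrs C a ! (Suc i mod length (nbrs C a))))) \<and>
        simple_path (face_boundary C a) \<and>
        (\<forall>q\<in>inside (path_image (face_boundary C a)). winding_number (face_boundary C a) q = 1)) \<and>
     (\<forall>a\<in>labels C. \<forall>b\<in>labels C. a \<noteq> b \<longrightarrow> face C a \<inter> face C b = {}) \<and>
     (\<Union>a\<in>labels C. face C a) \<union> (\<Union>(a, b)\<in>edges C. path_image (edge C a b)) = UNIV \<and>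
     (\<forall>a\<in>marked C. mpoint C a \<in> face C a)"

definition marked_curve :: "('s::t2_space, 'i) curve \<Rightarrow> bool" where
  "marked_curve C \<longleftrightarrow> disk_covering C \<and> marked_points C \<and> covering_graph C"

definition local_coord :: "('s, 'i) curve \<Rightarrow> 'i \<Rightarrow> 's \<Rightarrow> complex" where
  "local_coord C a p = coord C a p - coord C a (mpoint C a)"

definition transition_deriv :: "('s, 'i) curve \<Rightarrow> 'i \<Rightarrow> 'i \<Rightarrow> 's \<Rightarrow> complex" where
  "transition_deriv C a b p = deriv (coord C b \<circ> uncoord C a) (coord C a p)"

definition holomorphic_fun :: "('s, 'i) curve \<Rightarrow> 'i \<Rightarrow> 's set \<Rightarrow> ('s \<Rightarrow> complex) \<Rightarrow> bool" where
  "holomorphic_fun C a V h \<longleftrightarrow> (h \<circ> uncoord C a) holomorphic_on coord C a ` V"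

definition holomorphic_mat ::
    "('s, 'i) curve \<Rightarrow> 'i \<Rightarrow> 's set \<Rightarrow> ('s \<Rightarrow> complex^'n^'n) \<Rightarrow> bool" where
  "holomorphic_mat C a V F \<longleftrightarrow> (\<forall>i j. holomorphic_fun C a V (\<lambda>p. F p $ i $ j))"

section \<open>Quasi-parabolic structure\<close>

text \<open>
  The rank is \<open>N = CARD('n)\<close>; the order of \<open>'n\<close> orders the frame vectors. In a frame adapted to
  the flag at \<open>w_a\<close> the flag consists of the coordinate subspaces
  \<open>{v. \<forall>i. flag D a i > k \<longrightarrow> v $ i = 0}\<close>, so that \<open>flag D a i\<close> is the number of the diagonal block
  of \<open>P_a\<close> containing \<open>i\<close>. The matrix \<open>p_a^{(0)}\<close> is diagonal with entries \<open>residue_entry D a i\<close>.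
\<close>

record ('i, 'n) parabolic =
  flag :: "'i \<Rightarrow> 'n \<Rightarrow> nat"
  residue_entry :: "'i \<Rightarrow> 'n \<Rightarrow> complex"

definition flag_subspace :: "('i, 'n::finite) parabolic \<Rightarrow> 'i \<Rightarrow> nat \<Rightarrow> (complex^'n) set" where
  "flag_subspace D a k = {v. \<forall>i. k < flag D a i \<longrightarrow> v $ i = 0}"

definition parabolic_subgroup :: "('i, 'n::finite) parabolic \<Rightarrow> 'i \<Rightarrow> (complex^'n^'n) set" where
  "parabolic_subgroup D a =
     {A. invertible A \<and> (\<forall>k. \<forall>v\<in>flag_subspace D a k. A *v v \<in> flag_subspace D a k)}"

text \<open>
  The maximal semisimple subgroup of \<open>P_a\<close> is the product of the special linear groups of the
  diagonal blocks; its Cartan subalgebra consists of the diagonal matrices all of whose blocks are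
  traceless. Diagonal matrices orthogonal to it (for the trace form) are constant on each block,
  and such a matrix is generic when different blocks carry different constants.
\<close>

definition parabolic_data :: "('s, 'i) curve \<Rightarrow> ('i, 'n::{finite,linorder}) parabolic \<Rightarrow> bool" where
  "parabolic_data C D \<longleftrightarrow> (\<forall>a\<in>marked C.
     mono (flag D a) \<and>
     (\<forall>h :: 'n \<Rightarrow> complex. (\<forall>k. (\<Sum>i | flag D a i = k. h i) = 0) \<longrightarrow>
        (\<Sum>i\<in>UNIV. residue_entry D a i * h i) = 0) \<and>
     (\<forall>i j. flag D a i \<noteq> flag D a j \<longrightarrow> residue_entry D a i \<noteq> residue_entry D a j))"

text \<open>The smallest nonzero subspace of the flag is the span of the first diagonal block.\<close>

definition smallest_subspace_is_line :: "('i, 'n::finite) parabolic \<Rightarrow> 'i \<Rightarrow> bool" where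
  "smallest_subspace_is_line D a \<longleftrightarrow> card {i. flag D a i = Min (range (flag D a))} = 1"

section \<open>Pairs of Higgs fields and transition functions, gauge transformations\<close>

text \<open>
  \<open>fst x a b p\<close> is the value at \<open>p\<close> of \<open>\<eta>_{ab}\<close>, expressed as a multiple of \<open>dz_a\<close>, and
  \<open>snd x a b p\<close> is \<open>g_{ab}(p)\<close>. Only the values for distinct labels \<open>a\<close>, \<open>b\<close> and \<open>p\<close> in the
  overlap are meaningful.
\<close>

type_synonym ('s, 'i, 'n) config =
  "('i \<Rightarrow> 'i \<Rightarrow> 's \<Rightarrow> complex^'n^'n) \<times> ('i \<Rightarrow> 'i \<Rightarrow> 's \<Rightarrow> complex^'n^'n)"

definition agree :: "('s, 'i) curve \<Rightarrow> ('s, 'i, 'n) config \<Rightarrow> ('s, 'i, 'n) config \<Rightarrow> bool" where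
  "agree C x y \<longleftrightarrow> (\<forall>a\<in>labels C. \<forall>b\<in>labels C. a \<noteq> b \<longrightarrow> (\<forall>p\<in>overlap C a b.
     fst x a b p = fst y a b p \<and> snd x a b p = snd y a b p))"

definition act ::
    "('i \<Rightarrow> 's \<Rightarrow> complex^'n^'n) \<Rightarrow> ('s, 'i, 'n::finite) config \<Rightarrow> ('s, 'i, 'n) config" where
  "act f x = (\<lambda>a b p. f a p ** fst x a b p ** matrix_inv (f a p),
              \<lambda>a b p. f a p ** snd x a b p ** matrix_inv (f b p))"

definition gauge_on ::
    "('s, 'i) curve \<Rightarrow> ('i, 'n::finite) parabolic \<Rightarrow> 'i set \<Rightarrow> ('i \<Rightarrow> 's \<Rightarrow> complex^'n^'n) set" where
  "gauge_on C D M = {f.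
     (\<forall>a\<in>labels C. holomorphic_mat C a (disk C a) (f a) \<and> (\<forall>p\<in>disk C a. invertible (f a p))) \<and>
     (\<forall>a\<in>M. f a (mpoint C a) \<in> parabolic_subgroup D a)}"

definition is_bundle :: "('s, 'i) curve \<Rightarrow> ('i \<Rightarrow> 'i \<Rightarrow> 's \<Rightarrow> complex^'n::finite^'n) \<Rightarrow> bool" where
  "is_bundle C g \<longleftrightarrow>
     (\<forall>a\<in>labels C. \<forall>b\<in>labels C. a \<noteq> b \<longrightarrow>
        holomorphic_mat C a (overlap C a b) (g a b) \<and>
        (\<forall>p\<in>overlap C a b. invertible (g a b p) \<and> g a b p ** g b a p = mat 1)) \<and>
     (\<forall>a\<in>labels C. \<forall>b\<in>labels C. \<forall>c\<in>labels C. a \<noteq> b \<and> b \<noteq> c \<and> c \<noteq> a \<longrightarrow>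
        (\<forall>p\<in>disk C a \<inter> disk C b \<inter> disk C c. g a b p ** g b c p ** g c a p = mat 1))"

text \<open>
  The degree is the degree of the divisor of a nonzero meromorphic section \<open>s\<close> of the determinant
  line bundle; \<open>Z\<close> is a finite set containing all zeros and poles of \<open>s\<close>.
\<close>

definition has_degree ::
    "('s, 'i) curve \<Rightarrow> ('i \<Rightarrow> 'i \<Rightarrow> 's \<Rightarrow> complex^'n::finite^'n) \<Rightarrow> int \<Rightarrow> bool" where
  "has_degree C g d \<longleftrightarrow> (\<exists>s Z (ord :: 's \<Rightarrow> int).
     finite Z \<and>
     (\<forall>a\<in>labels C. (s a \<circ> uncoord C a) meromorphic_on coord C a ` disk C a \<and>
        holomorphic_fun C a (disk C a - Z) (s a) \<and> (\<forall>p\<in>disk C a - Z. s a p \<noteq> 0) \<and>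
        (\<forall>p\<in>disk C a \<inter> Z. zorder (s a \<circ> uncoord C a) (coord C a p) = ord p)) \<and>
     (\<forall>a\<in>labels C. \<forall>b\<in>labels C. a \<noteq> b \<longrightarrow>
        (\<forall>p\<in>overlap C a b - Z. s a p = det (g a b p) * s b p)) \<and>
     d = (\<Sum>p\<in>Z. ord p))"

definition is_higgs_field :: "('s, 'i) curve \<Rightarrow> ('s, 'i, 'n::finite) config \<Rightarrow> bool" where
  "is_higgs_field C x \<longleftrightarrow> (\<forall>a\<in>labels C. \<forall>b\<in>labels C. a \<noteq> b \<longrightarrow>
     holomorphic_mat C a (overlap C a b) (fst x a b) \<and>
     (\<forall>p\<in>overlap C a b. \<forall>i j. fst x a b p $ i $ j = transition_deriv C a b p *
        (snd x a b p ** fst x b a p ** matrix_inv (snd x a b p)) $ i $ j))"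

definition polar_part ::
    "('s, 'i) curve \<Rightarrow> ('i, 'n::finite) parabolic \<Rightarrow> 'i \<Rightarrow> 's \<Rightarrow> complex^'n^'n" where
  "polar_part C D a p =
     (\<chi> i j. if a \<in> marked C \<and> i = j then residue_entry D a i / local_coord C a p else 0)"

text \<open>
  The moment condition: the forms \<open>\<eta>_{ab}\<close> are the restrictions of a form on \<open>disk a\<close> which has
  the first order pole \<open>z_a^{-1} p_a^{(0)} dz_a\<close> at \<open>w_a\<close> (\<open>a\<close> marked) and is otherwise
  holomorphic.
\<close>

definition moment_condition ::
    "('s, 'i) curve \<Rightarrow> ('i, 'n::finite) parabolic \<Rightarrow> ('s, 'i, 'n) config \<Rightarrow> bool" where
  "moment_condition C D x \<longleftrightarrow> (\<forall>a\<in>labels C. \<exists>h. holomorphic_mat C a (disk C a) h \<and>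
     (\<forall>b\<in>labels C. b \<noteq> a \<longrightarrow> (\<forall>p\<in>overlap C a b. fst x a b p = polar_part C D a p + h p)))"

definition level_set ::
    "('s, 'i) curve \<Rightarrow> ('i, 'n::finite) parabolic \<Rightarrow> int \<Rightarrow> ('s, 'i, 'n) config set" where
  "level_set C D d = {x. is_bundle C (snd x) \<and> has_degree C (snd x) d \<and>
     is_higgs_field C x \<and> moment_condition C D x}"

text \<open>
  Gauge equivalence on the level set. A gauge transformation relating two of its points
  takes its value at \<open>w_a\<close> in the centraliser of \<open>p_a^{(0)}\<close> in \<open>P_a\<close>. The moment of
  a parabolic group only prescribes the residue modulo the nilradical of the Lie algebra of \<open>P_a\<close>;
  as \<open>p_a^{(0)}\<close> is generic, \<open>P_a\<close> conjugates all such residues to \<open>p_a^{(0)}\<close>, so the quotient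
  \<open>T^*M^{(d)}\<close> is the quotient of \<open>level_set\<close> by \<open>gauge_rel\<close>.
\<close>

definition gauge_rel ::
    "('s, 'i) curve \<Rightarrow> ('i, 'n::finite) parabolic \<Rightarrow> int \<Rightarrow>
     (('s, 'i, 'n) config \<times> ('s, 'i, 'n) config) set" where
  "gauge_rel C D d = {(x, y). x \<in> level_set C D d \<and> y \<in> level_set C D d \<and>
     (\<exists>f\<in>gauge_on C D (marked C). agree C y (act f x))}"

definition phase_space ::
    "('s, 'i) curve \<Rightarrow> ('i, 'n::finite) parabolic \<Rightarrow> int \<Rightarrow> ('s, 'i, 'n) config set set" where
  "phase_space C D d = level_set C D d // gauge_rel C D d"

section \<open>Symplectic form and Hitchin Hamiltonians\<close>

definition edge_integral :: "('s, 'i) curve \<Rightarrow> 'i \<Rightarrow> 'i \<Rightarrow> ('s \<Rightarrow> complex) \<Rightarrow> complex" where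
  "edge_integral C a b h =
     contour_integral (coord C a \<circ> edge C a b) (h \<circ> uncoord C a)"

text \<open>
  The exterior derivative of \<open>\<Sum> \<integral> tr(\<eta>_{ab} Dg_{ab} g_{ab}^{-1})\<close> evaluated on two tangent
  vectors \<open>u\<close>, \<open>v\<close> at \<open>x\<close>, using
  \<open>D(Dg g^{-1}) = Dg g^{-1} \<and> Dg g^{-1}\<close>.
\<close>

definition symplectic_form ::
    "('s, 'i) curve \<Rightarrow> ('s, 'i, 'n::finite) config \<Rightarrow> ('s, 'i, 'n) config \<Rightarrow>
     ('s, 'i, 'n) config \<Rightarrow> complex" where
  "symplectic_form C x u v = (\<Sum>(a, b)\<in>edges C. edge_integral C a b (\<lambda>p.
     let k = matrix_inv (snd x a b p);
         U = snd u a b p ** k;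
         V = snd v a b p ** k
     in trace (fst u a b p ** V) - trace (fst v a b p ** U)
        + trace (fst x a b p ** (U ** V - V ** U))))"

text \<open>Matrix powers; the power operator of the type \<open>complex^'n^'n\<close> is componentwise.\<close>

definition mat_power :: "complex^'n::finite^'n \<Rightarrow> nat \<Rightarrow> complex^'n^'n" where
  "mat_power A j = (((**) A) ^^ j) (mat 1)"

text \<open>
  \<open>\<nu> j k a b\<close> is the coefficient, in the coordinate \<open>z_a\<close>, of the restriction to the overlap
  of the \<open>(1-j,0)\<close>-differential \<open>\<nu>_{(j,k)}\<close>: the product with \<open>tr(\<eta>_{ab}^j)\<close> is a one-form.
  For each \<open>j\<close> the index \<open>k\<close> runs through \<open>K j\<close>.
\<close>

type_synonym ('s, 'i) differentials = "nat \<Rightarrow> nat \<Rightarrow> 'i \<Rightarrow> 'i \<Rightarrow> 's \<Rightarrow> complex"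

definition hierarchy_indices :: "'n::finite itself \<Rightarrow> (nat \<Rightarrow> nat set) \<Rightarrow> (nat \<times> nat) set" where
  "hierarchy_indices _ K = {(j, k). 1 \<le> j \<and> j \<le> CARD('n) \<and> k \<in> K j}"

definition holomorphic_differentials ::
    "('s, 'i) curve \<Rightarrow> (nat \<times> nat) set \<Rightarrow> ('s, 'i) differentials \<Rightarrow> bool" where
  "holomorphic_differentials C J \<nu> \<longleftrightarrow> (\<forall>(j, k)\<in>J. \<forall>(a, b)\<in>edges C.
     holomorphic_fun C a (overlap C a b) (\<nu> j k a b))"

definition hitchin_hamiltonian ::
    "('s, 'i) curve \<Rightarrow> ('s, 'i) differentials \<Rightarrow> nat \<Rightarrow> nat \<Rightarrow> ('s, 'i, 'n::finite) config \<Rightarrow> complex" where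
  "hitchin_hamiltonian C \<nu> j k x = (\<Sum>(a, b)\<in>edges C.
     edge_integral C a b (\<lambda>p. \<nu> j k a b p * trace (mat_power (fst x a b p) j)))"

section \<open>Families, symplectic maps, solutions of the hierarchy\<close>

text \<open>
  Families of configurations depending holomorphically on parameters \<open>\<tau> :: 'm \<Rightarrow> complex\<close>:
  jointly continuous, and holomorphic in each parameter separately.
\<close>

definition holomorphic_family ::
    "('s::topological_space, 'i) curve \<Rightarrow> ('m \<Rightarrow> complex) set \<Rightarrow>
     (('m \<Rightarrow> complex) \<Rightarrow> ('s, 'i, 'n::finite) config) \<Rightarrow> bool" where
  "holomorphic_family C T x \<longleftrightarrow> (\<forall>a\<in>labels C. \<forall>b\<in>labels C. a \<noteq> b \<longrightarrow>
     continuous_on (T \<times> overlap C a b) (\<lambda>(\<tau>, p). fst (x \<tau>) a b p) \<and>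
     continuous_on (T \<times> overlap C a b) (\<lambda>(\<tau>, p). snd (x \<tau>) a b p) \<and>
     (\<forall>\<tau>\<in>T. \<forall>m. \<forall>p\<in>overlap C a b. \<forall>i j.
        (\<lambda>t. fst (x (\<tau>(m := t))) a b p $ i $ j) holomorphic_on {t. \<tau>(m := t) \<in> T} \<and>
        (\<lambda>t. snd (x (\<tau>(m := t))) a b p $ i $ j) holomorphic_on {t. \<tau>(m := t) \<in> T}))"

definition family_in_level ::
    "('s::topological_space, 'i) curve \<Rightarrow> ('i, 'n::finite) parabolic \<Rightarrow> int \<Rightarrow> ('m \<Rightarrow> complex) set \<Rightarrow>
     (('m \<Rightarrow> complex) \<Rightarrow> ('s, 'i, 'n) config) \<Rightarrow> bool" where
  "family_in_level C D d T x \<longleftrightarrow>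
     open T \<and> holomorphic_family C T x \<and> (\<forall>\<tau>\<in>T. x \<tau> \<in> level_set C D d)"

definition pderiv_family ::
    "'m \<Rightarrow> (('m \<Rightarrow> complex) \<Rightarrow> ('s, 'i, 'n::finite) config) \<Rightarrow> ('m \<Rightarrow> complex) \<Rightarrow> ('s, 'i, 'n) config" where
  "pderiv_family m x \<tau> =
     (\<lambda>a b p. \<chi> i j. deriv (\<lambda>t. fst (x (\<tau>(m := t))) a b p $ i $ j) (\<tau> m),
      \<lambda>a b p. \<chi> i j. deriv (\<lambda>t. snd (x (\<tau>(m := t))) a b p $ i $ j) (\<tau> m))"

text \<open>
  The quotient is used without assuming that it is a manifold: holomorphic maps into it are those
  which lift locally to holomorphic families in the level set, and the symplectic form is evaluated
  on such lifts (the gauge directions lie in the kernel of \<open>symplectic_form\<close> on the level set).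
  A map \<open>F\<close> of phase spaces is symplectic if it takes two-parameter holomorphic families to
  two-parameter holomorphic families with the same pulled back symplectic form.
\<close>

definition symplectic_map ::
    "('s::topological_space, 'i) curve \<Rightarrow> ('i, 'n::finite) parabolic \<Rightarrow> int \<Rightarrow> int \<Rightarrow>
     (('s, 'i, 'n) config set \<Rightarrow> ('s, 'i, 'n) config set) \<Rightarrow> bool" where
  "symplectic_map C D d d' F \<longleftrightarrow>
     F \<in> phase_space C D d \<rightarrow> phase_space C D d' \<and>
     (\<forall>(T :: (bool \<Rightarrow> complex) set) x. family_in_level C D d T x \<longrightarrow>
        (\<forall>\<tau>\<^sub>0\<in>T. \<exists>T' y. \<tau>\<^sub>0 \<in> T' \<and> T' \<subseteq> T \<and> family_in_level C D d' T' y \<and>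
           (\<forall>\<tau>\<in>T'. gauge_rel C D d' `` {y \<tau>} = F (gauge_rel C D d `` {x \<tau>}) \<and>
              symplectic_form C (y \<tau>) (pderiv_family False y \<tau>) (pderiv_family True y \<tau>) =
              symplectic_form C (x \<tau>) (pderiv_family False x \<tau>) (pderiv_family True x \<tau>))))"

definition symplectic_transformation ::
    "('s::topological_space, 'i) curve \<Rightarrow> ('i, 'n::finite) parabolic \<Rightarrow> int \<Rightarrow>
     (('s, 'i, 'n) config set \<Rightarrow> ('s, 'i, 'n) config set) \<Rightarrow> bool" where
  "symplectic_transformation C D d F \<longleftrightarrow>
     bij_betw F (phase_space C D d) (phase_space C D d) \<and>
     symplectic_map C D d d F \<and>
     symplectic_map C D d d (inv_into (phase_space C D d) F)"

text \<open>
  Hamilton's equation \<open>\<omega>(\<partial>_{j,k} x, v) = dI_{j,k}(v)\<close> at the parameter value \<open>\<tau>\<close>, for all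
  tangent vectors \<open>v\<close> to the level set, i.e. velocities of holomorphic curves \<open>c\<close> in the level set
  through \<open>x \<tau>\<close>.
\<close>

definition hamilton_equation ::
    "('s::topological_space, 'i) curve \<Rightarrow> ('i, 'n::finite) parabolic \<Rightarrow> int \<Rightarrow> ('s, 'i) differentials \<Rightarrow>
     nat \<times> nat \<Rightarrow> ((nat \<times> nat \<Rightarrow> complex) \<Rightarrow> ('s, 'i, 'n) config) \<Rightarrow> (nat \<times> nat \<Rightarrow> complex) \<Rightarrow> bool" where
  "hamilton_equation C D d \<nu> m x \<tau> \<longleftrightarrow>
     (\<forall>(S :: (unit \<Rightarrow> complex) set) c.
        family_in_level C D d S c \<and> (\<lambda>_. 0) \<in> S \<and> agree C (c (\<lambda>_. 0)) (x \<tau>) \<longrightarrow>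
        symplectic_form C (x \<tau>) (pderiv_family m x \<tau>) (pderiv_family () c (\<lambda>_. 0)) =
        deriv (\<lambda>t. hitchin_hamiltonian C \<nu> (fst m) (snd m) (c (\<lambda>_. t))) 0)"

text \<open>
  A solution of the hierarchy is a function of the times \<open>\<tau> (j,k)\<close> with values in the phase space;
  coordinates \<open>\<tau> m\<close> with \<open>m \<notin> J\<close> are not times and \<open>u\<close> does not depend on them.
\<close>

definition hierarchy_solution ::
    "('s::topological_space, 'i) curve \<Rightarrow> ('i, 'n::finite) parabolic \<Rightarrow> int \<Rightarrow> ('s, 'i) differentials \<Rightarrow>
     (nat \<times> nat) set \<Rightarrow> (nat \<times> nat \<Rightarrow> complex) set \<Rightarrow>
     ((nat \<times> nat \<Rightarrow> complex) \<Rightarrow> ('s, 'i, 'n) config set) \<Rightarrow> bool" where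
  "hierarchy_solution C D d \<nu> J T u \<longleftrightarrow>
     open T \<and> u \<in> T \<rightarrow> phase_space C D d \<and>
     (\<forall>\<tau>\<in>T. \<forall>\<sigma>\<in>T. (\<forall>m\<in>J. \<tau> m = \<sigma> m) \<longrightarrow> u \<tau> = u \<sigma>) \<and>
     (\<forall>\<tau>\<^sub>0\<in>T. \<exists>T' x. \<tau>\<^sub>0 \<in> T' \<and> T' \<subseteq> T \<and> family_in_level C D d T' x \<and>
        (\<forall>\<tau>\<in>T'. u \<tau> = gauge_rel C D d `` {x \<tau>} \<and>
           (\<forall>m\<in>J. hamilton_equation C D d \<nu> m x \<tau>)))"

definition baecklund_transformation ::
    "('s::topological_space, 'i) curve \<Rightarrow> ('i, 'n::finite) parabolic \<Rightarrow> int \<Rightarrow> ('s, 'i) differentials \<Rightarrow>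
     (nat \<times> nat) set \<Rightarrow> (('s, 'i, 'n) config set \<Rightarrow> ('s, 'i, 'n) config set) \<Rightarrow> bool" where
  "baecklund_transformation C D d \<nu> J F \<longleftrightarrow>
     symplectic_transformation C D d F \<and>
     (\<forall>T u. hierarchy_solution C D d \<nu> J T u \<longrightarrow> hierarchy_solution C D d \<nu> J T (F \<circ> u))"

section \<open>Symplectic Hecke correspondence\<close>

text \<open>Position of \<open>i\<close> in the order of \<open>'n\<close>, counted from \<open>0\<close>.\<close>

definition position :: "'n::{finite,linorder} \<Rightarrow> nat" where
  "position i = card {j. j < i}"

definition Xi_plus :: "complex \<Rightarrow> complex^'n::{finite,linorder}^'n::{finite,linorder}" where
  "Xi_plus z = (\<chi> i j. if position j = Suc (position i) then 1
                       else if Suc (position i) = CARD('n) \<and> position j = 0 then z else 0)"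

definition Xi_minus :: "complex \<Rightarrow> complex^'n::{finite,linorder}^'n::{finite,linorder}" where
  "Xi_minus z = (\<chi> i j. if position i = Suc (position j) then 1
                        else if position i = 0 \<and> Suc (position j) = CARD('n) then inverse z else 0)"

text \<open>Change to the frame whose \<open>i\<close>-th vector is the old \<open>s i\<close>-th frame vector.\<close>

definition reorder_frame :: "('n \<Rightarrow> 'n) \<Rightarrow> complex^'n::finite^'n" where
  "reorder_frame s = (\<chi> i j. if j = s i then 1 else 0)"

definition at_label :: "'i \<Rightarrow> ('s \<Rightarrow> complex^'n::finite^'n) \<Rightarrow> 'i \<Rightarrow> 's \<Rightarrow> complex^'n^'n" where
  "at_label \<alpha> \<phi> = (\<lambda>a p. if a = \<alpha> then \<phi> p else mat 1)"

text \<open>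
  The map of quotients induced by \<open>g_{\<alpha>b} \<mapsto> \<Xi> g_{\<alpha>b}\<close>, \<open>\<eta>_{\<alpha>b} \<mapsto> \<Xi> \<eta>_{\<alpha>b} \<Xi>^{-1}\<close>. In the
  frame obtained in this way the polar part at \<open>w_\<alpha>\<close> is no longer \<open>z_\<alpha>^{-1} p_\<alpha>^{(0)}\<close>: the
  diagonal entries of the residue are permuted cyclically and the residue acquires off-diagonal
  entries. The holomorphic change of frame \<open>f\<close>, unrestricted at \<open>w_\<alpha>\<close>, passes to a frame in which
  the polar part is \<open>z_\<alpha>^{-1} p_\<alpha>^{(0)}\<close> again, as the definition of \<open>T^*M^{(d')}\<close> requires; since
  different blocks of \<open>p_\<alpha>^{(0)}\<close> have different eigenvalues, such a frame is unique up to gauge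
  transformations.
\<close>

definition hecke ::
    "('s, 'i) curve \<Rightarrow> ('i, 'n::finite) parabolic \<Rightarrow> int \<Rightarrow> 'i \<Rightarrow> (complex \<Rightarrow> complex^'n^'n) \<Rightarrow>
     ('s, 'i, 'n) config set \<Rightarrow> ('s, 'i, 'n) config set" where
  "hecke C D d' \<alpha> \<Xi> X = {y \<in> level_set C D d'. \<exists>x\<in>X. \<exists>f\<in>gauge_on C D (marked C - {\<alpha>}).
     agree C y (act f (act (at_label \<alpha> (\<lambda>p. \<Xi> (local_coord C \<alpha> p))) x))}"

text \<open>
  The upper correspondence is performed in the given adapted frame, whose first vector spans the
  smallest nonzero subspace of the flag. The matrix \<open>Xi_minus\<close> divides the component along the
  \<^emph>\<open>last\<close> frame vector by \<open>z_\<alpha>\<close>, which preserves the first order pole if that vector spans a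
  one-dimensional graded piece of the flag. A frame compatible with the flag in this sense is a
  reordering \<open>s\<close> of the adapted frame: for instance the frame \<open>(e_2, \<dots>, e_N, e_1)\<close>, whose last
  vector spans the smallest subspace (then the lower correspondence is inverse to the upper one), or
  the adapted frame itself, if the largest proper subspace of the flag has codimension one.
\<close>

definition lower_frame :: "('i, 'n::{finite,linorder}) parabolic \<Rightarrow> 'i \<Rightarrow> ('n \<Rightarrow> 'n) \<Rightarrow> bool" where
  "lower_frame D \<alpha> s \<longleftrightarrow> bij s \<and> card {i. flag D \<alpha> i = flag D \<alpha> (s (Max UNIV))} = 1"

definition hecke_upper ::
    "('s, 'i) curve \<Rightarrow> ('i, 'n::{finite,linorder}) parabolic \<Rightarrow> 'i \<Rightarrow> int \<Rightarrow>
     ('s, 'i, 'n) config set \<Rightarrow> ('s, 'i, 'n) config set" where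
  "hecke_upper C D \<alpha> d = hecke C D (d + 1) \<alpha> Xi_plus"

definition hecke_lower ::
    "('s, 'i) curve \<Rightarrow> ('i, 'n::{finite,linorder}) parabolic \<Rightarrow> 'i \<Rightarrow> ('n \<Rightarrow> 'n) \<Rightarrow> int \<Rightarrow>
     ('s, 'i, 'n) config set \<Rightarrow> ('s, 'i, 'n) config set" where
  "hecke_lower C D \<alpha> s d = hecke C D (d - 1) \<alpha> (\<lambda>z. Xi_minus z ** reorder_frame s)"

end

theory Submission
  imports Defs
begin

text \<open>
  After a constant change of frame both correspondences are given by the diagonal matrix
  \<open>\<Xi> = diag(1, \<dots>, z\<^sup>\<plusminus>\<^sup>1, \<dots>, 1)\<close>, where the nontrivial entry sits at a one-dimensional block \<open>k\<close> of the
  flag at \<open>w\<close>. If \<open>\<eta> = p/z + h\<close>, the residue of \<open>\<Xi> \<eta> \<Xi>\<^sup>-\<^sup>1\<close> is \<open>p + c\<close>, where \<open>c\<close> consists of the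
  off-diagonal entries of \<open>h(w)\<close> in the column (or row) \<open>k\<close>. As \<open>p\<^sub>k\<close> differs from the other entries
  of \<open>p\<close>, conjugation by \<open>1 + N\<close> with \<open>N\<^sub>i\<^sub>j = c\<^sub>i\<^sub>j / (p\<^sub>i - p\<^sub>j)\<close> restores the residue \<open>p\<close>. So
  \<open>x \<mapsto> (1 + N(x)) \<Xi> x\<close> is an explicit lift to the level set; by Cauchy's formula \<open>h(w)\<close> is an integral
  of \<open>\<eta>/z\<close> over the edges around \<open>w\<close>, whence \<open>N\<close> depends holomorphically on \<open>x\<close>. The lifts for the two
  signs are mutually inverse up to gauge transformations.

  The logarithmic derivative of \<open>(1 + N) \<Xi>\<close> is \<open>\<theta> = z DN\<close>. The change of the symplectic form is the
  integral over the boundary of the face of \<open>w\<close> of an expression in \<open>tr (D\<eta> \<theta>)\<close> and \<open>tr (\<eta> [\<theta>, \<theta>])\<close>;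
  the factor \<open>z\<close> makes it holomorphic there, so it vanishes. The Hamiltonians are conjugation
  invariant. To transport Hamilton's equation, a curve through the lifted point is moved back by the
  inverse lift, followed by a constant gauge transformation.
\<close>

section \<open>Matrices\<close>

text \<open>The quotient carries no manifold structure here: symplecticity and Hamilton's equations
  are tested on holomorphic families in the level set. The frame restoring the residue must
  therefore depend holomorphically on the configuration; its mere existence at each point would not
  do. Since the block \<open>k\<close> is one-dimensional, the matrices N have products zero, so (1
  + N)^{-1} = 1 - N and no matrix inverse has to be differentiated. Configurations are meaningful
  only on overlaps, and a marked point lies in none of them. Singular frames thus act like regular
  ones, whereas every statement at w_\<alpha> itself comes from the identity theorem or from
  integrals over the face boundary. In Hamilton's equation the test curve is given on the target
  side. Moved back, it meets the given point only up to a gauge transformation V, and its frame has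
  a logarithmic derivative without evident factor z. The invariance of the form is therefore proved
  for two curves with different frames that coincide at the common point, where only one logarithmic
  derivative is assumed to have the factor z.\<close>

lemma matrix_add_rdistrib: "(B + C) ** A = B ** A + C ** (A :: 'a::semiring_1^'n^'m)"
  by (vector matrix_matrix_mult_def sum.distrib distrib_right)

lemma matrix_diff_ldistrib: "A ** (B - C) = A ** B - A ** (C :: 'a::ring_1^'n^'m)"
  by (vector matrix_matrix_mult_def sum_subtractf right_diff_distrib)

lemma matrix_diff_rdistrib: "(B - C) ** A = B ** A - C ** (A :: 'a::ring_1^'n^'m)"
  by (vector matrix_matrix_mult_def sum_subtractf left_diff_distrib)

lemma matrix_minus_left: "(- A) ** B = - (A ** (B :: 'a::ring_1^'n^'m))"
  by (vector matrix_matrix_mult_def sum_negf)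

lemma matrix_minus_right: "A ** (- B) = - (A ** (B :: 'a::ring_1^'n^'m))"
  by (vector matrix_matrix_mult_def sum_negf)

lemma matrix_zero_left: "0 ** A = (0 :: 'a::ring_1^'n^'m)"
  by (vector matrix_matrix_mult_def)

lemma matrix_zero_right: "A ** 0 = (0 :: 'a::ring_1^'n^'m)"
  by (vector matrix_matrix_mult_def)

lemmas matrix_algebra =
  matrix_mul_assoc matrix_add_ldistrib matrix_add_rdistrib matrix_diff_ldistrib
  matrix_diff_rdistrib matrix_minus_left matrix_minus_right matrix_zero_left matrix_zero_right

lemma matrix_mul_nth: "(A ** B) $ i $ j = (\<Sum>l\<in>UNIV. A $ i $ l * B $ l $ j)"
  by (simp add: matrix_matrix_mult_def)

lemma mat_nth: "mat c $ i $ j = (if i = j then c else 0)"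
  by (simp add: mat_def)

text \<open>\<open>matrix_inv\<close> is chosen among two-sided inverses; for square matrices over a
  field a right inverse is already two-sided, and inverses are unique.\<close>

lemma matrix_inv_eqI:
  fixes A B :: "'a::field^'n^'n"
  assumes "A ** B = mat 1"
  shows "matrix_inv A = B"
proof -
  have "\<exists>X. A ** X = mat 1 \<and> X ** A = mat 1"
    using assms matrix_left_right_inverse1 by blast
  then have "A ** matrix_inv A = mat 1 \<and> matrix_inv A ** A = mat 1"
    unfolding matrix_inv_def by (rule someI_ex)
  then show ?thesis
    by (metis assms matrix_mul_assoc matrix_mul_lid matrix_mul_rid)
qed

lemma matrix_inv_right: "invertible A \<Longrightarrow> A ** matrix_inv A = mat (1::'a::field)"
  and matrix_inv_left: "invertible A \<Longrightarrow> matrix_inv A ** A = mat (1::'a::field)"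
  for A :: "'a::field^'n^'n"
  by (metis invertible_def matrix_inv_eqI)+

lemma invertible_matrix_inv: "invertible A \<Longrightarrow> invertible (matrix_inv A)" for A :: "'a::field^'n^'n"
  by (metis invertible_left_inverse matrix_inv_right)

lemma matrix_inv_inv: "invertible A \<Longrightarrow> matrix_inv (matrix_inv A) = A" for A :: "'a::field^'n^'n"
  by (simp add: matrix_inv_eqI matrix_inv_left)

lemma matrix_inv_mult:
  fixes A B :: "'a::field^'n^'n"
  assumes "invertible A" "invertible B"
  shows "matrix_inv (A ** B) = matrix_inv B ** matrix_inv A"
proof (rule matrix_inv_eqI)
  have "A ** B ** (matrix_inv B ** matrix_inv A) = A ** (B ** matrix_inv B) ** matrix_inv A"
    by (simp add: matrix_mul_assoc)
  then show "A ** B ** (matrix_inv B ** matrix_inv A) = mat 1"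
    using assms by (simp add: matrix_inv_right)
qed

lemma invertible_mat_1: "invertible (mat 1 :: 'a::field^'n^'n)"
  by (metis invertible_def matrix_mul_lid)

lemma matrix_inv_mat_1: "matrix_inv (mat 1 :: 'a::field^'n^'n) = mat 1"
  by (simp add: matrix_inv_eqI)

lemma invertibleI: "A ** B = mat 1 \<Longrightarrow> invertible A" for A :: "'a::field^'n^'n"
  using invertible_right_inverse by blast

text \<open>Cramer's rule. It exhibits the entries of the inverse as quotients of determinants,
  which is how holomorphy passes from a matrix function to its inverse.\<close>

lemma matrix_inv_nth:
  fixes A :: "'a::field^'n^'n"
  assumes "invertible A"
  shows "matrix_inv A $ k $ l =
    det (\<chi> i j. if j = k then mat 1 $ i $ l else A $ i $ j) / det A"
proof -
  have "A *v column l (matrix_inv A) = column l (mat 1)"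
    unfolding matrix_inv_right[OF assms, symmetric]
    by (simp add: vec_eq_iff matrix_vector_mult_def matrix_matrix_mult_def column_def)
  moreover have "det A \<noteq> 0"
    using assms invertible_det_nz by blast
  ultimately have "column l (matrix_inv A) =
      (\<chi> k. det (\<chi> i j. if j = k then column l (mat 1) $ i else A $ i $ j) / det A)"
    using cramer by blast
  then show ?thesis
    by (simp add: column_def vec_eq_iff cong: if_cong)
qed

lemma trace_mult_nth: "trace (A ** B) = (\<Sum>i\<in>UNIV. \<Sum>j\<in>UNIV. A $ i $ j * B $ j $ i)"
  by (simp add: trace_def matrix_mul_nth)

lemma trace_cyclic: "trace (A ** B ** C) = trace (C ** A ** (B :: complex^'n^'n))"
  by (metis matrix_mul_assoc trace_mul_sym)

lemma trace_conj:
  fixes \<phi> \<psi> X :: "complex^'n^'n"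
  assumes "\<psi> ** \<phi> = mat 1"
  shows "trace (\<phi> ** X ** \<psi>) = trace X"
  by (metis assms matrix_mul_lid trace_cyclic)

lemma conj_mult:
  fixes \<phi> \<psi> X Y :: "complex^'n^'n"
  assumes "\<psi> ** \<phi> = mat 1"
  shows "\<phi> ** X ** \<psi> ** (\<phi> ** Y ** \<psi>) = \<phi> ** (X ** Y) ** \<psi>"
  by (metis assms matrix_mul_assoc matrix_mul_rid)

lemma trace_mat_power_conj:
  fixes \<phi> X :: "complex^'n^'n"
  assumes "invertible \<phi>"
  shows "trace (mat_power (\<phi> ** X ** matrix_inv \<phi>) j) = trace (mat_power X j)"
proof -
  have "mat_power (\<phi> ** X ** matrix_inv \<phi>) j = \<phi> ** mat_power X j ** matrix_inv \<phi>"
  proof (induction j)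
    case 0
    then show ?case using assms by (simp add: mat_power_def matrix_inv_right)
  next
    case (Suc j)
    then show ?case
      using conj_mult[OF matrix_inv_left[OF assms], of X] by (simp add: mat_power_def)
  qed
  then show ?thesis
    by (simp add: trace_conj matrix_inv_left assms)
qed

section \<open>The integrand of the symplectic form under a change of frame\<close>

text \<open>
  The integrand of the symplectic form; \<open>U\<close> and \<open>V\<close> stand for the values of \<open>Dg g\<^sup>-\<^sup>1\<close> on the two
  tangent vectors.
\<close>

definition symp_density ::
    "complex^'n^'n \<Rightarrow> complex^'n^'n \<Rightarrow> complex^'n^'n \<Rightarrow> complex^'n^'n \<Rightarrow> complex^'n^'n \<Rightarrow> complex" where
  "symp_density \<eta> u v U V = trace (u ** V) - trace (v ** U) + trace (\<eta> ** (U ** V - V ** U))"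

text \<open>
  The change of the integrand when the frame is changed by \<open>\<phi>\<close> with logarithmic derivatives
  \<open>\<theta> = \<phi>\<^sup>-\<^sup>1 D\<phi>\<close>.
\<close>

definition symp_defect ::
    "complex^'n^'n \<Rightarrow> complex^'n^'n \<Rightarrow> complex^'n^'n \<Rightarrow> complex^'n^'n \<Rightarrow> complex^'n^'n \<Rightarrow> complex" where
  "symp_defect \<eta> u v \<theta>\<^sub>1 \<theta>\<^sub>2 =
     trace (u ** \<theta>\<^sub>2) - trace (v ** \<theta>\<^sub>1) - trace (\<eta> ** (\<theta>\<^sub>1 ** \<theta>\<^sub>2 - \<theta>\<^sub>2 ** \<theta>\<^sub>1))"

lemma symp_density_conj:
  fixes \<phi> \<psi> :: "complex^'n^'n"
  assumes "\<psi> ** \<phi> = mat 1"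
  shows "symp_density (\<phi> ** \<eta> ** \<psi>) (\<phi> ** u ** \<psi>) (\<phi> ** v ** \<psi>) (\<phi> ** U ** \<psi>) (\<phi> ** V ** \<psi>)
    = symp_density \<eta> u v U V"
proof -
  have "\<phi> ** U ** \<psi> ** (\<phi> ** V ** \<psi>) - \<phi> ** V ** \<psi> ** (\<phi> ** U ** \<psi>) = \<phi> ** (U ** V - V ** U) ** \<psi>"
    by (simp add: conj_mult[OF assms] matrix_diff_ldistrib matrix_diff_rdistrib)
  then show ?thesis
    by (simp only: symp_density_def conj_mult[OF assms] trace_conj[OF assms])
qed

text \<open>In the new frame Dg g^{-1} = U becomes \<phi> (U + \<theta>) \<phi>^{-1}, and D\<eta>
  becomes \<phi> (D\<eta> + [\<theta>, \<eta>]) \<phi>^{-1}. By cyclicity of the trace the terms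
  mixing \<theta> with U or V cancel, while tr (\<eta> [\<open>\<theta>\<^sub>1\<close>,
  \<open>\<theta>\<^sub>2\<close>]) occurs with the signs -, -, +, which leaves the single minus
  sign of \<open>symp_defect\<close>.\<close>

lemma symp_density_left:
  fixes \<phi> \<psi> :: "complex^'n^'n"
  assumes "\<psi> ** \<phi> = mat 1"
  shows "symp_density (\<phi> ** \<eta> ** \<psi>) (\<phi> ** (u + \<theta>\<^sub>1 ** \<eta> - \<eta> ** \<theta>\<^sub>1) ** \<psi>)
      (\<phi> ** (v + \<theta>\<^sub>2 ** \<eta> - \<eta> ** \<theta>\<^sub>2) ** \<psi>) (\<phi> ** (U + \<theta>\<^sub>1) ** \<psi>) (\<phi> ** (V + \<theta>\<^sub>2) ** \<psi>)
    = symp_density \<eta> u v U V + symp_defect \<eta> u v \<theta>\<^sub>1 \<theta>\<^sub>2"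
  unfolding symp_density_conj[OF assms]
  unfolding symp_density_def symp_defect_def
  using trace_cyclic[of \<theta>\<^sub>1 \<eta> V] trace_cyclic[of \<eta> V \<theta>\<^sub>1] trace_cyclic[of \<theta>\<^sub>2 \<eta> U] trace_cyclic[of \<eta> U \<theta>\<^sub>2]
    trace_cyclic[of \<theta>\<^sub>1 \<eta> \<theta>\<^sub>2] trace_cyclic[of \<eta> \<theta>\<^sub>2 \<theta>\<^sub>1] trace_cyclic[of \<theta>\<^sub>2 \<eta> \<theta>\<^sub>1] trace_cyclic[of \<eta> \<theta>\<^sub>1 \<theta>\<^sub>2]
  by (simp add: matrix_algebra trace_add trace_sub algebra_simps)

text \<open>
  The same change seen from the other end of the edge, where the Higgs field is
  \<open>g \<eta> g\<^sup>-\<^sup>1\<close> and the frame of \<open>\<eta>\<close> is the one which is changed.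
\<close>

lemma symp_density_right:
  fixes g \<eta> \<theta>\<^sub>1 \<theta>\<^sub>2 u v U V :: "complex^'n^'n"
  assumes "k ** g = mat 1"
  defines "E \<equiv> g ** \<eta> ** k" and "T\<^sub>1 \<equiv> g ** \<theta>\<^sub>1 ** k" and "T\<^sub>2 \<equiv> g ** \<theta>\<^sub>2 ** k"
  defines "u' \<equiv> g ** u ** k + U ** E - E ** U" and "v' \<equiv> g ** v ** k + V ** E - E ** V"
  shows "symp_density E u' v' (U - T\<^sub>1) (V - T\<^sub>2)
    = symp_density E u' v' U V - symp_defect \<eta> u v \<theta>\<^sub>1 \<theta>\<^sub>2"
proof -
  \<comment> \<open>Conjugation by \<open>g\<close> leaves the defect unchanged, so both sides can
    be compared in the frame of \<open>E\<close>.\<close>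
  have "symp_defect \<eta> u v \<theta>\<^sub>1 \<theta>\<^sub>2 = symp_defect E (g ** u ** k) (g ** v ** k) T\<^sub>1 T\<^sub>2"
    unfolding symp_defect_def E_def T\<^sub>1_def T\<^sub>2_def conj_mult[OF assms(1)]
    by (simp only: trace_conj[OF assms(1)] conj_mult[OF assms(1)] matrix_diff_ldistrib matrix_diff_rdistrib trace_sub)
  then show ?thesis
    unfolding symp_density_def symp_defect_def u'_def v'_def
    using trace_cyclic[of U E T\<^sub>2] trace_cyclic[of E T\<^sub>2 U] trace_cyclic[of V E T\<^sub>1] trace_cyclic[of E T\<^sub>1 V]
    by (simp add: matrix_algebra trace_add trace_sub algebra_simps)
qed

section \<open>Functions holomorphic in each of two variables\<close>

lemma circlepath_subset:
  assumes "cball t r \<subseteq> S" "0 \<le> r"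
  shows "circlepath t r \<theta> \<in> S"
proof -
  have "dist t (circlepath t r \<theta>) = r"
    using assms(2) by (simp add: circlepath dist_norm norm_mult norm_exp_eq_Re)
  then show ?thesis using assms(1) by (auto simp: subset_eq)
qed

text \<open>Cauchy's formula in a form where \<open>t\<close> and any further parameter enter only
  through an integrand over a fixed interval; regularity of derivatives is thereby reduced to that
  of parameter integrals.\<close>

lemma deriv_eq_circle_integral:
  assumes "f holomorphic_on S" "cball t\<^sub>0 r \<subseteq> S" "0 < r" "t \<in> ball t\<^sub>0 r"
  shows "deriv f t = 1 / (2 * of_real pi * \<i>) * integral (cbox 0 1) (\<lambda>\<theta>. f (circlepath t\<^sub>0 r \<theta>)
    / (circlepath t\<^sub>0 r \<theta> - t)\<^sup>2 * vector_derivative (circlepath t\<^sub>0 r) (at \<theta>))"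
proof -
  have "f holomorphic_on cball t\<^sub>0 r" "f holomorphic_on ball t\<^sub>0 r"
    using assms ball_subset_cball by (blast intro: holomorphic_on_subset)+
  then show ?thesis
    using Cauchy_derivative_integral_circlepath(2)[of t\<^sub>0 r f t] assms(4)
    by (simp add: DERIV_imp_deriv holomorphic_on_imp_continuous_on contour_integral_integral cbox_interval)
qed

lemma continuous_on_locally:
  assumes "\<And>x. x \<in> S \<Longrightarrow> \<exists>A. open A \<and> x \<in> A \<and> continuous_on (S \<inter> A) f"
  shows "continuous_on S f"
  unfolding continuous_on_def
proof (intro ballI)
  fix x assume "x \<in> S"
  then obtain A where A: "open A" "x \<in> A" "continuous_on (S \<inter> A) f"
    using assms by blast
  then have "(f \<longlongrightarrow> f x) (at x within S \<inter> A)"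
    using \<open>x \<in> S\<close> by (simp add: continuous_on_def)
  moreover have "at x within S \<inter> A = at x within S"
    using A(1,2) by (intro at_within_nhd[of x A]) auto
  ultimately show "(f \<longlongrightarrow> f x) (at x within S)" by simp
qed

lemma continuous_on_uncurry:
  assumes "continuous_on (S \<times> V) (\<lambda>(t, p). F t p)" "continuous_on X f" "continuous_on X h"
    and "\<And>x. x \<in> X \<Longrightarrow> f x \<in> S" "\<And>x. x \<in> X \<Longrightarrow> h x \<in> V"
  shows "continuous_on X (\<lambda>x. F (f x) (h x))"
  using continuous_on_compose2[OF assms(1), of X "\<lambda>x. (f x, h x)"] assms(2-5)
  by (force intro: continuous_on_Pair)

text \<open>Near \<open>t\<^sub>0\<close> one fixed circle serves all \<open>t\<close> in the disk
  that it bounds, and the integrand of Cauchy's formula is jointly continuous there.\<close>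

lemma continuous_on_deriv_param:
  fixes F :: "complex \<Rightarrow> 'a::topological_space \<Rightarrow> complex"
  assumes "open S" and cont: "continuous_on (S \<times> V) (\<lambda>(t, p). F t p)"
    and hol: "\<And>p. p \<in> V \<Longrightarrow> (\<lambda>t. F t p) holomorphic_on S"
  shows "continuous_on (S \<times> V) (\<lambda>(t, p). deriv (\<lambda>t. F t p) t)"
proof (rule continuous_on_locally)
  fix x assume "x \<in> S \<times> V"
  then obtain t\<^sub>0 p\<^sub>0 where x: "x = (t\<^sub>0, p\<^sub>0)" "t\<^sub>0 \<in> S" "p\<^sub>0 \<in> V" by auto
  then obtain r where r: "0 < r" "cball t\<^sub>0 r \<subseteq> S"
    using \<open>open S\<close> open_contains_cball by blast
  let ?c = "circlepath t\<^sub>0 r"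
  have c: "?c \<theta> \<in> S" for \<theta> using r circlepath_subset by simp
  have ne: "?c \<theta> \<noteq> t" if "t \<in> ball t\<^sub>0 r" for \<theta> t
  proof
    assume "?c \<theta> = t"
    moreover have "dist t\<^sub>0 (?c \<theta>) = r"
      using r(1) by (simp add: circlepath dist_norm norm_mult norm_exp_eq_Re)
    ultimately show False using that by simp
  qed
  have cc: "continuous_on X ?c" for X
    unfolding circlepath by (intro continuous_intros)
  have "continuous_on ((ball t\<^sub>0 r \<times> V) \<times> cbox 0 1) (\<lambda>(u, \<theta>). F (?c \<theta>) (snd u) / (?c \<theta> - fst u)\<^sup>2 *
      vector_derivative ?c (at \<theta>))"
    unfolding vector_derivative_circlepath split_beta
    by (intro continuous_on_mult continuous_on_divide continuous_on_uncurry[OF cont] continuous_on_compose2[OF cc[of UNIV]] continuous_intros)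
      (use c ne in auto)
  then have C: "continuous_on (ball t\<^sub>0 r \<times> V) (\<lambda>u. 1 / (2 * of_real pi * \<i>) * integral (cbox 0 1)
      (\<lambda>\<theta>. F (?c \<theta>) (snd u) / (?c \<theta> - fst u)\<^sup>2 * vector_derivative ?c (at \<theta>)))"
    by (intro continuous_intros integral_continuous_on_param)
  have B: "S \<times> V \<inter> ball t\<^sub>0 r \<times> UNIV = ball t\<^sub>0 r \<times> V"
    using r ball_subset_cball by blast
  have D: "(case u of (t, p) \<Rightarrow> deriv (\<lambda>t. F t p) t) = 1 / (2 * of_real pi * \<i>) * integral (cbox 0 1)
      (\<lambda>\<theta>. F (?c \<theta>) (snd u) / (?c \<theta> - fst u)\<^sup>2 * vector_derivative ?c (at \<theta>))"
    if "u \<in> ball t\<^sub>0 r \<times> V" for u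
    using that deriv_eq_circle_integral[OF hol[of "snd u"] r(2,1), of "fst u"]
    by (simp only: mem_Times_iff split_beta)
  have "continuous_on (S \<times> V \<inter> ball t\<^sub>0 r \<times> UNIV) (\<lambda>(t, p). deriv (\<lambda>t. F t p) t)"
    unfolding B by (rule continuous_on_eq[OF C]) (rule D[symmetric])
  moreover have "open (ball t\<^sub>0 r \<times> (UNIV :: 'a set))" by (simp add: open_Times)
  ultimately show "\<exists>A. open A \<and> x \<in> A \<and> continuous_on (S \<times> V \<inter> A) (\<lambda>(t, p). deriv (\<lambda>t. F t p) t)"
    using x r by (intro exI[of _ "ball t\<^sub>0 r \<times> UNIV"]) auto
qed

text \<open>The \<open>t\<close>-derivative is a circle integral of functions holomorphic in
  \<open>p\<close>, hence holomorphic by differentiation under the integral. The joint continuity of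
  the \<open>p\<close>-derivatives that this requires is the preceding lemma with the two variables
  exchanged.\<close>

lemma holomorphic_on_deriv_param:
  fixes F :: "complex \<Rightarrow> complex \<Rightarrow> complex"
  assumes "open S" "open V" and cont: "continuous_on (S \<times> V) (\<lambda>(t, p). F t p)"
    and hol1: "\<And>p. p \<in> V \<Longrightarrow> (\<lambda>t. F t p) holomorphic_on S"
    and hol2: "\<And>t. t \<in> S \<Longrightarrow> F t holomorphic_on V"
    and "t\<^sub>0 \<in> S"
  shows "(\<lambda>p. deriv (\<lambda>t. F t p) t\<^sub>0) holomorphic_on V"
proof -
  obtain r where r: "0 < r" "cball t\<^sub>0 r \<subseteq> S"
    using \<open>open S\<close> \<open>t\<^sub>0 \<in> S\<close> open_contains_cball by blast
  let ?c = "circlepath t\<^sub>0 r"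
  have c: "?c \<theta> \<in> S" for \<theta> using r circlepath_subset by simp
  have ne: "?c \<theta> \<noteq> t\<^sub>0" for \<theta> using r(1) by (simp add: circlepath)
  have cc: "continuous_on X ?c" for X
    unfolding circlepath by (intro continuous_intros)
  have cont': "continuous_on (V \<times> S) (\<lambda>(p, t). F t p)"
    using continuous_on_compose2[OF cont, of "V \<times> S" prod.swap] continuous_on_swap
    by (force simp: split_beta)
  have D: "continuous_on (V \<times> S) (\<lambda>(p, t). deriv (F t) p)"
    using continuous_on_deriv_param[OF \<open>open V\<close> cont'] hol2 by (simp add: eta_contract_eq)
  \<comment> \<open>The Leibniz rule is applied on convex sets; balls suffice for analyticity on
    \<open>V\<close>.\<close>
  have "(\<lambda>p. deriv (\<lambda>t. F t p) t\<^sub>0) holomorphic_on B" if B: "B \<subseteq> V" "open B" "convex B" for B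
  proof -
    let ?f = "\<lambda>p \<theta>. F (?c \<theta>) p / (?c \<theta> - t\<^sub>0)\<^sup>2 * vector_derivative ?c (at \<theta>)"
    let ?f' = "\<lambda>p \<theta>. deriv (F (?c \<theta>)) p / (?c \<theta> - t\<^sub>0)\<^sup>2 * vector_derivative ?c (at \<theta>)"
    have "(\<lambda>p. integral (cbox 0 1) (?f p)) holomorphic_on B"
    proof (rule leibniz_rule_holomorphic[where fx = ?f'])
      fix p \<theta> assume "p \<in> B" "\<theta> \<in> cbox (0::real) 1"
      then have "(F (?c \<theta>) has_field_derivative deriv (F (?c \<theta>)) p) (at p)"
        using hol2[OF c] B holomorphic_derivI[OF _ \<open>open V\<close>] by blast
      then show "((\<lambda>p. ?f p \<theta>) has_field_derivative ?f' p \<theta>) (at p within B)"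
        by (intro DERIV_cmult_right DERIV_cdivide) (rule has_field_derivative_at_within)
    next
      fix p assume "p \<in> B"
      then have "continuous_on (cbox 0 1) (?f p)"
        unfolding vector_derivative_circlepath
        by (intro continuous_on_mult continuous_on_divide continuous_on_uncurry[OF cont] cc continuous_intros)
          (use c ne B \<open>p \<in> B\<close> in auto)
      then show "?f p integrable_on cbox 0 1" by (rule integrable_continuous)
    next
      show "continuous_on (B \<times> cbox 0 1) (\<lambda>(p, \<theta>). ?f' p \<theta>)"
        unfolding vector_derivative_circlepath split_beta
        by (intro continuous_on_mult continuous_on_divide continuous_on_uncurry[OF D] continuous_on_compose2[OF cc[of UNIV]] continuous_intros)
          (use c ne B in auto)
    qed (fact B)
    then have "(\<lambda>p. 1 / (2 * of_real pi * \<i>) * integral (cbox 0 1) (?f p)) holomorphic_on B"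
      by (intro holomorphic_intros)
    then show ?thesis
      using deriv_eq_circle_integral[OF hol1 r(2,1), of _ t\<^sub>0] r(1) B
      by (elim holomorphic_transform) (auto simp: subset_eq)
  qed
  then have "(\<lambda>p. deriv (\<lambda>t. F t p) t\<^sub>0) analytic_on V"
    unfolding analytic_on_def using \<open>open V\<close> by (metis open_contains_ball open_ball convex_ball)
  then show ?thesis by (rule analytic_imp_holomorphic)
qed

text \<open>
  Valid paths may have unbounded derivatives; for integrals of holomorphic functions they can be
  replaced by nearby polynomial paths, uniformly in the integrand.
\<close>

lemma smooth_contour_representation:
  assumes "open V" "valid_path \<gamma>" "path_image \<gamma> \<subseteq> V"
  shows "\<exists>g g' :: real \<Rightarrow> complex. continuous_on (cbox 0 1) g \<and> continuous_on (cbox 0 1) g' \<and> g ` cbox 0 1 \<subseteq> V \<and>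
    (\<forall>f. f holomorphic_on V \<longrightarrow> contour_integral \<gamma> f = integral (cbox 0 1) (\<lambda>x. f (g x) * g' x))"
proof -
  obtain d where d: "0 < d" and near: "\<And>g h. valid_path g \<and> valid_path h \<and>
      (\<forall>t\<in>{0..1}. norm (g t - \<gamma> t) < d \<and> norm (h t - \<gamma> t) < d) \<and>
      pathstart h = pathstart g \<and> pathfinish h = pathfinish g \<Longrightarrow> path_image g \<subseteq> V \<and> path_image h \<subseteq> V \<and>
      (\<forall>f. f holomorphic_on V \<longrightarrow> contour_integral h f = contour_integral g f)"
    using contour_integral_nearby_ends[OF assms(1) valid_path_imp_path[OF assms(2)] assms(3)] by metis
  obtain g where g: "polynomial_function g" "pathstart g = pathstart \<gamma>" "pathfinish g = pathfinish \<gamma>"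
      "\<And>t. t \<in> {0..1} \<Longrightarrow> norm (g t - \<gamma> t) < d"
    using path_approx_polynomial_function[OF valid_path_imp_path[OF assms(2)] d] by metis
  have vg: "valid_path g" using g(1) by (rule valid_path_polynomial_function)
  \<comment> \<open>The two nearby paths are taken to be \<gamma> itself and its polynomial
    approximation.\<close>
  have n: "path_image g \<subseteq> V \<and> (\<forall>f. f holomorphic_on V \<longrightarrow> contour_integral g f = contour_integral \<gamma> f)"
    using near[of \<gamma> g] g vg assms(2) d by auto
  obtain g' where g': "polynomial_function g'" "\<And>x. (g has_vector_derivative g' x) (at x)"
    using has_vector_derivative_polynomial_function[OF g(1)] by blast
  show ?thesis
  proof (rule exI[of _ g], rule exI[of _ g'], intro conjI allI impI)
    show "continuous_on (cbox 0 1) g" "continuous_on (cbox 0 1) g'"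
      using g(1) g'(1) by (simp_all add: continuous_on_polymonial_function)
    show "g ` cbox 0 1 \<subseteq> V" using n by (simp add: path_image_def cbox_interval)
    fix f assume "f holomorphic_on V"
    then have "contour_integral \<gamma> f = contour_integral g f" using n by simp
    then show "contour_integral \<gamma> f = integral (cbox 0 1) (\<lambda>x. f (g x) * g' x)"
      by (simp add: contour_integral_integral cbox_interval vector_derivative_at[OF g'(2)])
  qed
qed

lemma continuous_on_contour_integral_param:
  fixes F :: "'a::topological_space \<Rightarrow> complex \<Rightarrow> complex"
  assumes "open V" "valid_path \<gamma>" "path_image \<gamma> \<subseteq> V"
    and cont: "continuous_on (T \<times> V) (\<lambda>(t, z). F t z)"
    and hol: "\<And>t. t \<in> T \<Longrightarrow> F t holomorphic_on V"
  shows "continuous_on T (\<lambda>t. contour_integral \<gamma> (F t))"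
proof -
  obtain g g' :: "real \<Rightarrow> complex" where g: "continuous_on (cbox 0 1) g" "continuous_on (cbox 0 1) g'" "g ` cbox 0 1 \<subseteq> V"
      and "\<forall>f. f holomorphic_on V \<longrightarrow> contour_integral \<gamma> f = integral (cbox 0 1) (\<lambda>x. f (g x) * g' x)"
    using smooth_contour_representation[OF assms(1-3)] by (elim exE conjE) (rule that)
  then have int: "\<And>f. f holomorphic_on V \<Longrightarrow> contour_integral \<gamma> f = integral (cbox 0 1) (\<lambda>x. f (g x) * g' x)"
    by blast
  have "continuous_on (T \<times> cbox 0 1) (\<lambda>(t, x). F t (g x) * g' x)"
    unfolding split_beta
    by (intro continuous_on_mult continuous_on_uncurry[OF cont] continuous_on_compose2[OF g(1)]
        continuous_on_compose2[OF g(2)] continuous_intros)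
      (use g(3) in auto)
  then have "continuous_on T (\<lambda>t. integral (cbox 0 1) (\<lambda>x. F t (g x) * g' x))"
    by (rule integral_continuous_on_param)
  then show ?thesis
    using int[OF hol] by (elim continuous_on_eq) auto
qed

text \<open>Differentiation under the integral over the smooth substitute path. The result is read
  as an integral over \<gamma> again because the \<open>t\<close>-derivative is holomorphic on
  \<open>V\<close>.\<close>

lemma has_field_derivative_contour_integral_param:
  fixes F :: "complex \<Rightarrow> complex \<Rightarrow> complex"
  assumes "open V" "valid_path \<gamma>" "path_image \<gamma> \<subseteq> V" "open S"
    and cont: "continuous_on (S \<times> V) (\<lambda>(t, z). F t z)"
    and hol1: "\<And>p. p \<in> V \<Longrightarrow> (\<lambda>t. F t p) holomorphic_on S"
    and hol2: "\<And>t. t \<in> S \<Longrightarrow> F t holomorphic_on V"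
    and "t\<^sub>0 \<in> S"
  shows "((\<lambda>t. contour_integral \<gamma> (F t)) has_field_derivative
    contour_integral \<gamma> (\<lambda>p. deriv (\<lambda>t. F t p) t\<^sub>0)) (at t\<^sub>0)"
proof -
  obtain g g' :: "real \<Rightarrow> complex" where g: "continuous_on (cbox 0 1) g" "continuous_on (cbox 0 1) g'" "g ` cbox 0 1 \<subseteq> V"
      and "\<forall>f. f holomorphic_on V \<longrightarrow> contour_integral \<gamma> f = integral (cbox 0 1) (\<lambda>x. f (g x) * g' x)"
    using smooth_contour_representation[OF assms(1-3)] by (elim exE conjE) (rule that)
  then have int: "\<And>f. f holomorphic_on V \<Longrightarrow> contour_integral \<gamma> f = integral (cbox 0 1) (\<lambda>x. f (g x) * g' x)"
    by blast
  obtain r where r: "0 < r" "ball t\<^sub>0 r \<subseteq> S"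
    using \<open>open S\<close> \<open>t\<^sub>0 \<in> S\<close> open_contains_ball by blast
  have D: "continuous_on (S \<times> V) (\<lambda>(t, p). deriv (\<lambda>t. F t p) t)"
    by (rule continuous_on_deriv_param[OF \<open>open S\<close> cont hol1])
  have "((\<lambda>t. integral (cbox 0 1) (\<lambda>x. F t (g x) * g' x)) has_field_derivative
      integral (cbox 0 1) (\<lambda>x. deriv (\<lambda>t. F t (g x)) t\<^sub>0 * g' x)) (at t\<^sub>0 within ball t\<^sub>0 r)"
  proof (rule leibniz_rule_field_derivative[where fx = "\<lambda>t x. deriv (\<lambda>t. F t (g x)) t * g' x"])
    fix t x assume "t \<in> ball t\<^sub>0 r" "x \<in> cbox (0::real) 1"
    then have "((\<lambda>t. F t (g x)) has_field_derivative deriv (\<lambda>t. F t (g x)) t) (at t)"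
      using hol1 g(3) r(2) holomorphic_derivI[OF _ \<open>open S\<close>] by (auto simp: image_subset_iff subset_eq)
    then show "((\<lambda>t. F t (g x) * g' x) has_field_derivative deriv (\<lambda>t. F t (g x)) t * g' x) (at t within ball t\<^sub>0 r)"
      by (intro DERIV_cmult_right) (rule has_field_derivative_at_within)
  next
    fix t assume "t \<in> ball t\<^sub>0 r"
    then have "continuous_on (cbox 0 1) (\<lambda>x. F t (g x) * g' x)"
      by (intro continuous_on_mult continuous_on_uncurry[OF cont] continuous_intros)
        (use g r \<open>t \<in> ball t\<^sub>0 r\<close> in auto)
    then show "(\<lambda>x. F t (g x) * g' x) integrable_on cbox 0 1" by (rule integrable_continuous)
  next
    show "continuous_on (ball t\<^sub>0 r \<times> cbox 0 1) (\<lambda>(t, x). deriv (\<lambda>t. F t (g x)) t * g' x)"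
      unfolding split_beta
      by (intro continuous_on_mult continuous_on_uncurry[OF D] continuous_on_compose2[OF g(1)]
          continuous_on_compose2[OF g(2)] continuous_intros)
        (use g(3) r in auto)
  qed (use r in auto)
  then have "((\<lambda>t. integral (cbox 0 1) (\<lambda>x. F t (g x) * g' x)) has_field_derivative
      integral (cbox 0 1) (\<lambda>x. deriv (\<lambda>t. F t (g x)) t\<^sub>0 * g' x)) (at t\<^sub>0)"
    by (simp only: at_within_open[OF centre_in_ball[THEN iffD2, OF r(1)] open_ball])
  moreover have "contour_integral \<gamma> (\<lambda>p. deriv (\<lambda>t. F t p) t\<^sub>0) =
      integral (cbox 0 1) (\<lambda>x. deriv (\<lambda>t. F t (g x)) t\<^sub>0 * g' x)"
    by (rule int) (rule holomorphic_on_deriv_param[OF \<open>open S\<close> \<open>open V\<close> cont hol1 hol2 \<open>t\<^sub>0 \<in> S\<close>])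
  moreover have "\<forall>\<^sub>F t in nhds t\<^sub>0. contour_integral \<gamma> (F t) = integral (cbox 0 1) (\<lambda>x. F t (g x) * g' x)"
    using eventually_nhds_in_open[OF \<open>open S\<close> \<open>t\<^sub>0 \<in> S\<close>] by (rule eventually_mono) (rule int[OF hol2])
  ultimately show ?thesis
    using DERIV_cong_ev[of t\<^sub>0 t\<^sub>0 "\<lambda>t. contour_integral \<gamma> (F t)"] by simp
qed

section \<open>Paths composed of edges\<close>

lemma join_path_list_compose:
  "gs \<noteq> [] \<Longrightarrow> f \<circ> join_path_list gs = join_path_list (map ((\<circ>) f) gs)"
  by (induction gs rule: join_path_list.induct) (simp_all add: path_compose_join)

text \<open>All conclusions go through the induction together: prepending a path needs the starting
  point of the remaining join, and additivity of integrals needs its validity.\<close>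

lemma join_path_list_valid:
  fixes gs :: "(real \<Rightarrow> complex) list"
  assumes "gs \<noteq> []" "\<And>g. g \<in> set gs \<Longrightarrow> valid_path g"
    and "\<And>i. Suc i < length gs \<Longrightarrow> pathfinish (gs ! i) = pathstart (gs ! Suc i)"
  shows "valid_path (join_path_list gs) \<and> pathstart (join_path_list gs) = pathstart (hd gs) \<and>
    pathfinish (join_path_list gs) = pathfinish (last gs) \<and>
    path_image (join_path_list gs) = (\<Union>g\<in>set gs. path_image g) \<and>
    (\<forall>f. (\<forall>g\<in>set gs. f contour_integrable_on g) \<longrightarrow> f contour_integrable_on join_path_list gs \<and>
      contour_integral (join_path_list gs) f = (\<Sum>g\<leftarrow>gs. contour_integral g f))"
  using assms
proof (induction gs rule: join_path_list.induct)
  case (3 g h gs)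
  have IH: "valid_path (join_path_list (h # gs)) \<and> pathstart (join_path_list (h # gs)) = pathstart h \<and>
    pathfinish (join_path_list (h # gs)) = pathfinish (last (h # gs)) \<and>
    path_image (join_path_list (h # gs)) = (\<Union>g\<in>set (h # gs). path_image g) \<and>
    (\<forall>f. (\<forall>g\<in>set (h # gs). f contour_integrable_on g) \<longrightarrow> f contour_integrable_on join_path_list (h # gs) \<and>
      contour_integral (join_path_list (h # gs)) f = (\<Sum>g\<leftarrow>h # gs. contour_integral g f))"
    using "3.IH" "3.prems"(2) "3.prems"(3)[of "Suc i" for i] by simp
  have "valid_path g" "pathfinish g = pathstart h"
    using "3.prems"(2)[of g] "3.prems"(3)[of 0] by simp_all
  then show ?case
    using IH by (auto simp: path_image_join)
qed auto

section \<open>Holomorphic functions on the curve\<close>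

lemma holomorphic_fun_iff: "holomorphic_fun C a V h \<longleftrightarrow> (\<lambda>z. h (uncoord C a z)) holomorphic_on coord C a ` V"
  by (simp add: holomorphic_fun_def o_def)

lemma holomorphic_fun_subset: "holomorphic_fun C a V h \<Longrightarrow> W \<subseteq> V \<Longrightarrow> holomorphic_fun C a W h"
  unfolding holomorphic_fun_def by (erule holomorphic_on_subset) blast

lemma holomorphic_fun_const: "holomorphic_fun C a V (\<lambda>_. c)"
  and holomorphic_fun_add: "holomorphic_fun C a V f \<Longrightarrow> holomorphic_fun C a V g \<Longrightarrow> holomorphic_fun C a V (\<lambda>p. f p + g p)"
  and holomorphic_fun_diff: "holomorphic_fun C a V f \<Longrightarrow> holomorphic_fun C a V g \<Longrightarrow> holomorphic_fun C a V (\<lambda>p. f p - g p)"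
  and holomorphic_fun_uminus: "holomorphic_fun C a V f \<Longrightarrow> holomorphic_fun C a V (\<lambda>p. - f p)"
  and holomorphic_fun_mult: "holomorphic_fun C a V f \<Longrightarrow> holomorphic_fun C a V g \<Longrightarrow> holomorphic_fun C a V (\<lambda>p. f p * g p)"
  and holomorphic_fun_sum: "(\<And>i. i \<in> I \<Longrightarrow> holomorphic_fun C a V (F i)) \<Longrightarrow> holomorphic_fun C a V (\<lambda>p. \<Sum>i\<in>I. F i p)"
  and holomorphic_fun_prod: "(\<And>i. i \<in> I \<Longrightarrow> holomorphic_fun C a V (F i)) \<Longrightarrow> holomorphic_fun C a V (\<lambda>p. \<Prod>i\<in>I. F i p)"
  by (auto simp: holomorphic_fun_iff intro!: holomorphic_intros)

lemmas holomorphic_fun_intros = holomorphic_fun_const holomorphic_fun_add holomorphic_fun_diff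
  holomorphic_fun_uminus holomorphic_fun_mult holomorphic_fun_sum holomorphic_fun_prod

lemma holomorphic_matD: "holomorphic_mat C a V F \<Longrightarrow> holomorphic_fun C a V (\<lambda>p. F p $ i $ j)"
  by (simp add: holomorphic_mat_def)

lemma holomorphic_mat_subset: "holomorphic_mat C a V F \<Longrightarrow> W \<subseteq> V \<Longrightarrow> holomorphic_mat C a W F"
  by (auto simp: holomorphic_mat_def intro: holomorphic_fun_subset)

lemma holomorphic_mat_const: "holomorphic_mat C a V (\<lambda>_. A)"
  and holomorphic_mat_add: "holomorphic_mat C a V F \<Longrightarrow> holomorphic_mat C a V G \<Longrightarrow> holomorphic_mat C a V (\<lambda>p. F p + G p)"
  and holomorphic_mat_diff: "holomorphic_mat C a V F \<Longrightarrow> holomorphic_mat C a V G \<Longrightarrow> holomorphic_mat C a V (\<lambda>p. F p - G p)"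
  by (auto simp: holomorphic_mat_def intro: holomorphic_fun_intros)

lemma holomorphic_mat_mult:
  "holomorphic_mat C a V F \<Longrightarrow> holomorphic_mat C a V G \<Longrightarrow> holomorphic_mat C a V (\<lambda>p. F p ** G p)"
  by (auto simp: holomorphic_mat_def matrix_mul_nth intro!: holomorphic_fun_intros)

lemma holomorphic_fun_det: "holomorphic_mat C a V F \<Longrightarrow> holomorphic_fun C a V (\<lambda>p. det (F p))"
  unfolding det_def holomorphic_mat_def by (intro holomorphic_fun_intros) auto

lemma holomorphic_fun_trace: "holomorphic_mat C a V F \<Longrightarrow> holomorphic_fun C a V (\<lambda>p. trace (F p))"
  unfolding trace_def holomorphic_mat_def by (intro holomorphic_fun_intros) auto

locale riemann_surface =
  fixes C :: "('s::t2_space, 'i) curve"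
  assumes marked_curve: "marked_curve C"
begin

lemma covering: "disk_covering C" "marked_points C" "covering_graph C"
  using marked_curve by (simp_all add: marked_curve_def)

lemma finite_labels: "finite (labels C)"
  using covering(1) by (simp add: disk_covering_def)

lemma finite_edges: "finite (edges C)"
proof -
  have "edges C \<subseteq> labels C \<times> labels C"
    using covering(3) by (simp add: covering_graph_def)
  then show ?thesis using finite_labels finite_SigmaI finite_subset by blast
qed

lemma marked_label: "a \<in> marked C \<Longrightarrow> a \<in> labels C"
  and mpoint_disk: "a \<in> marked C \<Longrightarrow> mpoint C a \<in> disk C a"
  and mpoint_not_disk: "a \<in> marked C \<Longrightarrow> b \<in> labels C \<Longrightarrow> b \<noteq> a \<Longrightarrow> mpoint C a \<notin> disk C b"
  using covering(2) by (auto simp: marked_points_def)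

lemma mpoint_overlap: "a \<in> marked C \<Longrightarrow> b \<in> labels C \<Longrightarrow> b \<noteq> a \<Longrightarrow> p \<in> overlap C a b \<Longrightarrow> p \<noteq> mpoint C a"
  using mpoint_not_disk by (auto simp: overlap_def)

lemma open_disk: "a \<in> labels C \<Longrightarrow> open (disk C a)"
  using covering(1) by (simp add: disk_covering_def)

lemma open_overlap: "a \<in> labels C \<Longrightarrow> b \<in> labels C \<Longrightarrow> open (overlap C a b)"
  by (simp add: overlap_def open_disk open_Int)

lemma overlap_commute: "overlap C a b = overlap C b a"
  by (auto simp: overlap_def)

lemma overlap_disk: "overlap C a b \<subseteq> disk C a" "overlap C a b \<subseteq> disk C b"
  by (auto simp: overlap_def)

lemma coord_ball:
  assumes "a \<in> labels C"
  obtains c r where "0 < r" "homeomorphism (disk C a) (ball c r) (coord C a) (uncoord C a)"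
  using assms covering(1) by (auto simp: disk_covering_def)

lemma uncoord_coord: "a \<in> labels C \<Longrightarrow> p \<in> disk C a \<Longrightarrow> uncoord C a (coord C a p) = p"
  using coord_ball by (metis homeomorphism_apply1)

lemma inj_coord: "a \<in> labels C \<Longrightarrow> inj_on (coord C a) (disk C a)"
  by (metis inj_on_inverseI uncoord_coord)

lemma coord_disk:
  assumes "a \<in> labels C"
  shows "open (coord C a ` disk C a)" "convex (coord C a ` disk C a)" "connected (coord C a ` disk C a)"
  using coord_ball[OF assms] by (metis homeomorphism_image1 open_ball convex_ball convex_connected)+

lemma continuous_coord: "a \<in> labels C \<Longrightarrow> continuous_on (disk C a) (coord C a)"
  and continuous_uncoord: "a \<in> labels C \<Longrightarrow> continuous_on (coord C a ` disk C a) (uncoord C a)"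
  using coord_ball by (metis homeomorphism_def)+

lemma uncoord_image: "a \<in> labels C \<Longrightarrow> V \<subseteq> disk C a \<Longrightarrow> z \<in> coord C a ` V \<Longrightarrow> uncoord C a z \<in> V"
  using uncoord_coord by auto

lemma coord_uncoord: "a \<in> labels C \<Longrightarrow> V \<subseteq> disk C a \<Longrightarrow> z \<in> coord C a ` V \<Longrightarrow> coord C a (uncoord C a z) = z"
  using uncoord_coord by auto

lemma open_coord_image:
  assumes "a \<in> labels C" "open V" "V \<subseteq> disk C a"
  shows "open (coord C a ` V)"
proof -
  obtain c r where h: "homeomorphism (disk C a) (ball c r) (coord C a) (uncoord C a)"
    using coord_ball[OF assms(1)] by metis
  have "openin (top_of_set (disk C a)) V"
    using assms by (metis inf.absorb_iff2 openin_open)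
  then have "openin (top_of_set (ball c r)) (coord C a ` V)"
    using h homeomorphism_imp_open_map by blast
  then show ?thesis by (simp add: openin_open_eq)
qed

lemma open_coord_overlap: "a \<in> labels C \<Longrightarrow> b \<in> labels C \<Longrightarrow> open (coord C a ` overlap C a b)"
  by (rule open_coord_image) (simp_all add: open_overlap overlap_disk)

lemma holomorphic_fun_cong:
  assumes "a \<in> labels C" "V \<subseteq> disk C a" "\<And>p. p \<in> V \<Longrightarrow> h p = h' p" "holomorphic_fun C a V h"
  shows "holomorphic_fun C a V h'"
  using assms(4) unfolding holomorphic_fun_iff
  by (rule holomorphic_transform) (use assms uncoord_image in blast)

lemma holomorphic_fun_continuous:
  assumes "a \<in> labels C" "V \<subseteq> disk C a" "holomorphic_fun C a V q"
  shows "continuous_on V q"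
proof -
  have "continuous_on V (\<lambda>p. (q \<circ> uncoord C a) (coord C a p))"
    by (rule continuous_on_compose2[OF holomorphic_on_imp_continuous_on[OF assms(3)[unfolded holomorphic_fun_def]]
          continuous_on_subset[OF continuous_coord[OF assms(1)] assms(2)] order_refl])
  then show ?thesis
    by (rule continuous_on_eq) (use assms(1,2) in \<open>auto simp: uncoord_coord\<close>)
qed

lemma holomorphic_fun_coord: "a \<in> labels C \<Longrightarrow> V \<subseteq> disk C a \<Longrightarrow> holomorphic_fun C a V (coord C a)"
  unfolding holomorphic_fun_iff
  by (rule holomorphic_transform[OF holomorphic_on_ident]) (metis coord_uncoord)

lemma holomorphic_fun_local_coord: "a \<in> labels C \<Longrightarrow> V \<subseteq> disk C a \<Longrightarrow> holomorphic_fun C a V (local_coord C a)"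
  unfolding local_coord_def by (intro holomorphic_fun_diff holomorphic_fun_const holomorphic_fun_coord)

lemma local_coord_nz:
  assumes "a \<in> marked C" "p \<in> disk C a" "p \<noteq> mpoint C a"
  shows "local_coord C a p \<noteq> 0"
  using assms inj_coord[OF marked_label] mpoint_disk by (auto simp: local_coord_def inj_on_def)

lemma local_coord_mpoint: "local_coord C a (mpoint C a) = 0"
  by (simp add: local_coord_def)

lemma local_coord_overlap_nz:
  "a \<in> marked C \<Longrightarrow> b \<in> labels C \<Longrightarrow> b \<noteq> a \<Longrightarrow> p \<in> overlap C a b \<Longrightarrow> local_coord C a p \<noteq> 0"
  using local_coord_nz mpoint_overlap overlap_disk by blast

lemma holomorphic_fun_inverse:
  "\<lbrakk>a \<in> labels C; V \<subseteq> disk C a; holomorphic_fun C a V f; \<And>p. p \<in> V \<Longrightarrow> f p \<noteq> 0\<rbrakk> \<Longrightarrow>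
    holomorphic_fun C a V (\<lambda>p. inverse (f p))"
  unfolding holomorphic_fun_iff using uncoord_image by (intro holomorphic_intros) blast+

lemma holomorphic_fun_divide:
  "\<lbrakk>a \<in> labels C; V \<subseteq> disk C a; holomorphic_fun C a V g; holomorphic_fun C a V f; \<And>p. p \<in> V \<Longrightarrow> f p \<noteq> 0\<rbrakk> \<Longrightarrow>
    holomorphic_fun C a V (\<lambda>p. g p / f p)"
  unfolding divide_inverse by (intro holomorphic_fun_mult holomorphic_fun_inverse)

lemma holomorphic_mat_inv:
  assumes "a \<in> labels C" "V \<subseteq> disk C a" "holomorphic_mat C a V F" "\<And>p. p \<in> V \<Longrightarrow> invertible (F p)"
  shows "holomorphic_mat C a V (\<lambda>p. matrix_inv (F p))"
  unfolding holomorphic_mat_def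
proof (intro allI)
  fix k l
  have "holomorphic_fun C a V (\<lambda>p. if j = k then mat 1 $ i $ l else F p $ i $ j)" for i j
    using holomorphic_matD[OF assms(3)] by (cases "j = k") (simp_all add: holomorphic_fun_const)
  then have "holomorphic_mat C a V (\<lambda>p. \<chi> i j. if j = k then mat 1 $ i $ l else F p $ i $ j)"
    by (simp add: holomorphic_mat_def)
  then have "holomorphic_fun C a V (\<lambda>p. det (\<chi> i j. if j = k then mat 1 $ i $ l else F p $ i $ j) / det (F p))"
    using assms by (intro holomorphic_fun_divide holomorphic_fun_det) (auto simp: invertible_det_nz)
  then show "holomorphic_fun C a V (\<lambda>p. matrix_inv (F p) $ k $ l)"
    by (rule holomorphic_fun_cong[OF assms(1,2), rotated]) (use assms(4) in \<open>simp add: matrix_inv_nth\<close>)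
qed

lemma holomorphic_fun_change_chart:
  assumes "a \<in> labels C" "b \<in> labels C" "V \<subseteq> overlap C a b" "holomorphic_fun C b V h"
  shows "holomorphic_fun C a V h"
proof -
  have t: "(coord C b \<circ> uncoord C a) holomorphic_on coord C a ` V"
    using covering(1) assms(1-3) unfolding disk_covering_def
    by (meson holomorphic_on_subset image_mono)
  have va: "uncoord C a (coord C a p) = p" "uncoord C b (coord C b p) = p" if "p \<in> V" for p
    using that assms(1-3) by (auto simp: overlap_def intro!: uncoord_coord)
  have im: "(coord C b \<circ> uncoord C a) ` coord C a ` V \<subseteq> coord C b ` V"
    using va by auto
  have "(h \<circ> uncoord C b) \<circ> (coord C b \<circ> uncoord C a) holomorphic_on coord C a ` V"
    using holomorphic_on_compose_gen[OF t _ im] assms(4) by (simp add: holomorphic_fun_def)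
  then show ?thesis
    unfolding holomorphic_fun_def
    by (rule holomorphic_transform) (use va in auto)
qed

lemma holomorphic_mat_change_chart:
  assumes "a \<in> labels C" "b \<in> labels C" "V \<subseteq> overlap C a b" "holomorphic_mat C b V F"
  shows "holomorphic_mat C a V F"
  using assms holomorphic_fun_change_chart[OF assms(1-3)] by (simp add: holomorphic_mat_def)

lemma nbrsD:
  assumes "a \<in> labels C" "b \<in> set (nbrs C a)"
  shows "b \<in> labels C" "b \<noteq> a" "(a, b) \<in> edges C \<or> (b, a) \<in> edges C"
    "path_image (edge C a b) \<subseteq> overlap C a b" "valid_path (coord C a \<circ> edge C a b)"
    "edge C b a = reversepath (edge C a b)"
proof -
  have g: "edges C \<subseteq> labels C \<times> labels C" "\<forall>(a, b)\<in>edges C. a \<noteq> b \<and> (b, a) \<notin> edges C \<and> edge C b a = reversepath (edge C a b)"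
    using covering(3) by (simp_all add: covering_graph_def)
  show 1: "(a, b) \<in> edges C \<or> (b, a) \<in> edges C"
    and "path_image (edge C a b) \<subseteq> overlap C a b" "valid_path (coord C a \<circ> edge C a b)"
    using covering(3) assms by (auto simp: covering_graph_def)
  show "b \<in> labels C" "b \<noteq> a" "edge C b a = reversepath (edge C a b)"
    using 1 g by auto
qed

lemma edge_nbrs: "(a, b) \<in> edges C \<Longrightarrow> a \<in> labels C \<and> b \<in> labels C \<and> a \<noteq> b \<and> b \<in> set (nbrs C a) \<and> a \<in> set (nbrs C b) \<and> (b, a) \<notin> edges C"
  using covering(3) by (auto simp: covering_graph_def)

lemma set_nbrs: "a \<in> labels C \<Longrightarrow> set (nbrs C a) = {b. (a, b) \<in> edges C \<or> (b, a) \<in> edges C}"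
  using covering(3) by (simp add: covering_graph_def)

lemma overlap_nonempty:
  assumes "a \<in> labels C"
  obtains b where "b \<in> labels C" "b \<noteq> a" "overlap C a b \<noteq> {}"
proof -
  obtain b where b: "b \<in> set (nbrs C a)"
    using covering(3) assms by (fastforce simp: covering_graph_def neq_Nil_conv)
  then show thesis
    using that[of b] nbrsD[OF assms b] path_image_nonempty by blast
qed

text \<open>The identity theorem on the chart image, which is a ball and so connected. Some overlap
  is nonempty because the list of edges around a face is not empty. Hence relations known on
  overlaps only extend to the disk, in particular to its marked point.\<close>

lemma holomorphic_fun_eq_on_disk:
  assumes a: "a \<in> labels C" and f: "holomorphic_fun C a (disk C a) f" and g: "holomorphic_fun C a (disk C a) g"
    and eq: "\<And>b p. b \<in> labels C \<Longrightarrow> b \<noteq> a \<Longrightarrow> p \<in> overlap C a b \<Longrightarrow> f p = g p"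
    and "p \<in> disk C a"
  shows "f p = g p"
proof -
  obtain b where b: "b \<in> labels C" "b \<noteq> a" "overlap C a b \<noteq> {}"
    using overlap_nonempty[OF a] .
  have "f (uncoord C a (coord C a p)) = g (uncoord C a (coord C a p))"
  proof (rule analytic_continuation_open[where s = "coord C a ` overlap C a b" and s' = "coord C a ` disk C a"
        and f = "\<lambda>z. f (uncoord C a z)" and g = "\<lambda>z. g (uncoord C a z)"])
    show "open (coord C a ` overlap C a b)" using a b open_coord_overlap by blast
    show "(\<lambda>z. f (uncoord C a z)) holomorphic_on coord C a ` disk C a"
      "(\<lambda>z. g (uncoord C a z)) holomorphic_on coord C a ` disk C a"
      using f g by (simp_all add: holomorphic_fun_iff)
    show "f (uncoord C a z) = g (uncoord C a z)" if "z \<in> coord C a ` overlap C a b" for z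
      using eq[OF b(1,2)] uncoord_image[OF a overlap_disk(1) that] .
    show "coord C a ` overlap C a b \<subseteq> coord C a ` disk C a"
      using overlap_disk(1) by (rule image_mono)
  qed (use b coord_disk[OF a] \<open>p \<in> disk C a\<close> in auto)
  then show ?thesis by (simp add: uncoord_coord a \<open>p \<in> disk C a\<close>)
qed

text \<open>The difference quotient has a removable singularity at the marked point; its value there
  is the derivative in the coordinate.\<close>

lemma holomorphic_fun_quotient:
  assumes a: "a \<in> marked C" and f: "holomorphic_fun C a (disk C a) f" and "f (mpoint C a) = 0"
  obtains g where "holomorphic_fun C a (disk C a) g" "\<And>p. p \<in> disk C a \<Longrightarrow> f p = local_coord C a p * g p"
proof -
  let ?w = "coord C a (mpoint C a)" and ?f = "\<lambda>z. f (uncoord C a z)"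
  let ?g = "\<lambda>z. if z = ?w then deriv ?f ?w else (?f z - ?f ?w) / (z - ?w)"
  note lab = marked_label[OF a]
  have fw: "?f ?w = 0"
    using assms(3) by (simp add: uncoord_coord lab mpoint_disk a)
  have "?g holomorphic_on coord C a ` disk C a"
    using f coord_disk[OF lab] by (intro pole_lemma_open) (simp_all add: holomorphic_fun_iff)
  then have 1: "holomorphic_fun C a (disk C a) (\<lambda>p. ?g (coord C a p))"
    unfolding holomorphic_fun_iff
    by (rule holomorphic_transform) (simp add: coord_uncoord[OF lab order_refl])
  have 2: "f p = local_coord C a p * ?g (coord C a p)" if "p \<in> disk C a" for p
    using that fw assms(3) local_coord_nz[OF a that]
    by (cases "p = mpoint C a") (auto simp: local_coord_def uncoord_coord lab)
  show thesis by (rule that[OF 1 2])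
qed

section \<open>Integrals over the edges\<close>

lemma edge_integral_cong:
  assumes "a \<in> labels C" "b \<in> set (nbrs C a)" "\<And>p. p \<in> overlap C a b \<Longrightarrow> f p = g p"
  shows "edge_integral C a b f = edge_integral C a b g"
  unfolding edge_integral_def
proof (rule contour_integral_eq)
  fix z assume "z \<in> path_image (coord C a \<circ> edge C a b)"
  then have "z \<in> coord C a ` overlap C a b"
    using nbrsD(4)[OF assms(1,2)] by (auto simp: path_image_compose)
  then show "(f \<circ> uncoord C a) z = (g \<circ> uncoord C a) z"
    using assms(3) uncoord_image[OF assms(1) overlap_disk(1)] by simp
qed

lemma edge_path_image:
  assumes "a \<in> labels C" "b \<in> set (nbrs C a)"
  shows "path_image (coord C a \<circ> edge C a b) \<subseteq> coord C a ` overlap C a b"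
  using nbrsD(4)[OF assms] by (auto simp: path_image_compose)

lemma edge_integrable:
  assumes "a \<in> labels C" "b \<in> set (nbrs C a)" "holomorphic_fun C a (overlap C a b) f"
  shows "(f \<circ> uncoord C a) contour_integrable_on (coord C a \<circ> edge C a b)"
  using assms nbrsD[OF assms(1,2)] open_coord_overlap edge_path_image
  by (intro contour_integrable_holomorphic_simple[of _ "coord C a ` overlap C a b"])
    (auto simp: holomorphic_fun_def)

lemma edge_integral_add:
  assumes "a \<in> labels C" "b \<in> set (nbrs C a)" "holomorphic_fun C a (overlap C a b) f" "holomorphic_fun C a (overlap C a b) g"
  shows "edge_integral C a b (\<lambda>p. f p + g p) = edge_integral C a b f + edge_integral C a b g"
  using contour_integral_add[OF edge_integrable[OF assms(1-3)] edge_integrable[OF assms(1,2,4)]]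
  by (simp add: edge_integral_def o_def)

lemma edge_integral_diff:
  assumes "a \<in> labels C" "b \<in> set (nbrs C a)" "holomorphic_fun C a (overlap C a b) f" "holomorphic_fun C a (overlap C a b) g"
  shows "edge_integral C a b (\<lambda>p. f p - g p) = edge_integral C a b f - edge_integral C a b g"
  using contour_integral_diff[OF edge_integrable[OF assms(1-3)] edge_integrable[OF assms(1,2,4)]]
  by (simp add: edge_integral_def o_def)

lemma edge_integral_sum:
  assumes "a \<in> labels C" "b \<in> set (nbrs C a)" "finite I" "\<And>i. i \<in> I \<Longrightarrow> holomorphic_fun C a (overlap C a b) (F i)"
  shows "edge_integral C a b (\<lambda>p. \<Sum>i\<in>I. F i p) = (\<Sum>i\<in>I. edge_integral C a b (F i))"
  using contour_integral_sum[OF assms(3) edge_integrable[OF assms(1,2,4)]]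
  by (simp add: edge_integral_def o_def)

text \<open>\<open>transition_deriv\<close> is dz_b/dz_a, so this is a change of variables in the
  integral; the sign comes from the opposite orientation of the edge as seen from
  \<open>b\<close>.\<close>

lemma edge_integral_reverse:
  assumes a: "a \<in> labels C" and b: "b \<in> set (nbrs C a)"
  shows "edge_integral C a b (\<lambda>p. transition_deriv C a b p * f p) = - edge_integral C b a f"
proof -
  note n = nbrsD[OF a b]
  let ?\<psi> = "coord C b \<circ> uncoord C a" and ?\<gamma> = "coord C a \<circ> edge C a b" and ?V = "coord C a ` overlap C a b"
  have "?\<psi> holomorphic_on ?V"
    using covering(1) a n(1) by (simp add: disk_covering_def)
  then have an: "?\<psi> analytic_on ?V"
    using open_coord_overlap[OF a n(1)] by (simp add: analytic_on_open)
  have "edge_integral C a b (\<lambda>p. transition_deriv C a b p * f p) =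
      contour_integral ?\<gamma> (\<lambda>z. deriv ?\<psi> z * (f \<circ> uncoord C b) (?\<psi> z))"
    unfolding edge_integral_def
  proof (rule contour_integral_eq)
    fix z assume "z \<in> path_image ?\<gamma>"
    then have z: "z \<in> ?V" using edge_path_image[OF a b] by blast
    then show "((\<lambda>p. transition_deriv C a b p * f p) \<circ> uncoord C a) z = deriv ?\<psi> z * (f \<circ> uncoord C b) (?\<psi> z)"
      using uncoord_image[OF a overlap_disk(1) z] overlap_disk(2)[of a b] coord_uncoord[OF a overlap_disk(1) z]
      by (auto simp: transition_deriv_def uncoord_coord n(1))
  qed
  also have "\<dots> = contour_integral (?\<psi> \<circ> ?\<gamma>) (f \<circ> uncoord C b)"
    by (rule contour_integral_comp_analyticW[OF an n(5) edge_path_image[OF a b], symmetric])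
  also have "\<dots> = contour_integral (coord C b \<circ> edge C a b) (f \<circ> uncoord C b)"
  proof -
    \<comment> \<open>The two paths are known to coincide only for parameters in [0,1], since
      elsewhere \<open>edge\<close> is arbitrary. Their derivatives are therefore compared within
      that interval.\<close>
    have eq: "(?\<psi> \<circ> ?\<gamma>) t = (coord C b \<circ> edge C a b) t" if "t \<in> {0..1}" for t
    proof -
      have "edge C a b t \<in> disk C a"
        using that n(4) overlap_disk(1)[of a b] unfolding path_image_def by blast
      then show ?thesis by (simp add: uncoord_coord a)
    qed
    have "vector_derivative (?\<psi> \<circ> ?\<gamma>) (at t within {0..1}) = vector_derivative (coord C b \<circ> edge C a b) (at t within {0..1})"
      if "t \<in> {0..1}" for t
      using that eq by (intro vector_derivative_cong_eq) (auto intro!: always_eventually)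
    then have "(h has_contour_integral i) (?\<psi> \<circ> ?\<gamma>) \<longleftrightarrow> (h has_contour_integral i) (coord C b \<circ> edge C a b)" for h i
      unfolding has_contour_integral_def using eq by (intro has_integral_cong) simp
    then show ?thesis
      by (simp add: contour_integral_def contour_integrable_on_def)
  qed
  also have "\<dots> = - edge_integral C b a f"
  proof -
    have "a \<in> set (nbrs C b)" using n(3) edge_nbrs by blast
    then have "valid_path (coord C b \<circ> edge C b a)" using nbrsD(5) n(1) by blast
    then have "valid_path (coord C b \<circ> edge C a b)"
      unfolding n(6) path_compose_reversepath by simp
    then show ?thesis
      unfolding edge_integral_def n(6) path_compose_reversepath by (simp add: contour_integral_reversepath)
  qed
  finally show ?thesis .
qed

lemma face_boundary:
  assumes a: "a \<in> labels C"
  shows "valid_path (face_boundary C a)" "pathfinish (face_boundary C a) = pathstart (face_boundary C a)"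
    "path_image (face_boundary C a) \<subseteq> (\<Union>b\<in>set (nbrs C a). coord C a ` overlap C a b)"
    "(\<And>b. b \<in> set (nbrs C a) \<Longrightarrow> f contour_integrable_on (coord C a \<circ> edge C a b)) \<Longrightarrow>
      contour_integral (face_boundary C a) f = (\<Sum>b\<in>set (nbrs C a). contour_integral (coord C a \<circ> edge C a b) f)"
proof -
  let ?L = "nbrs C a"
  let ?gs = "map (\<lambda>b. coord C a \<circ> edge C a b) ?L"
  have L: "?L \<noteq> []" "distinct ?L"
    and link: "\<And>i. i < length ?L \<Longrightarrow> pathfinish (edge C a (?L ! i)) = pathstart (edge C a (?L ! (Suc i mod length ?L)))"
    using covering(3) a by (simp_all add: covering_graph_def)
  have fb: "face_boundary C a = join_path_list ?gs"
    using L(1) by (simp add: face_boundary_def join_path_list_compose comp_def[of "(\<circ>) _"])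
  have link': "pathfinish (?gs ! i) = pathstart (?gs ! (Suc i mod length ?L))" if "i < length ?L" for i
  proof -
    have "Suc i mod length ?L < length ?L" using L(1) by simp
    then show ?thesis
      using link[OF that] that by (simp add: pathfinish_compose pathstart_compose)
  qed
  have J: "valid_path (join_path_list ?gs) \<and> pathstart (join_path_list ?gs) = pathstart (hd ?gs) \<and>
    pathfinish (join_path_list ?gs) = pathfinish (last ?gs) \<and>
    path_image (join_path_list ?gs) = (\<Union>g\<in>set ?gs. path_image g) \<and>
    (\<forall>f. (\<forall>g\<in>set ?gs. f contour_integrable_on g) \<longrightarrow> f contour_integrable_on join_path_list ?gs \<and>
      contour_integral (join_path_list ?gs) f = (\<Sum>g\<leftarrow>?gs. contour_integral g f))"
  proof (rule join_path_list_valid)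
    fix i assume "Suc i < length ?gs"
    then show "pathfinish (?gs ! i) = pathstart (?gs ! Suc i)" using link'[of i] by simp
  qed (use L nbrsD(5)[OF a] in auto)
  then show "valid_path (face_boundary C a)" by (simp add: fb)
  \<comment> \<open>For the last index the successor modulo the length is 0, which closes the
    path.\<close>
  have "pathfinish (last ?gs) = pathstart (hd ?gs)"
    using link'[of "length ?L - 1"] L by (simp add: last_conv_nth hd_conv_nth)
  then show "pathfinish (face_boundary C a) = pathstart (face_boundary C a)"
    using J by (simp add: fb)
  show "path_image (face_boundary C a) \<subseteq> (\<Union>b\<in>set (nbrs C a). coord C a ` overlap C a b)"
    using J edge_path_image[OF a] by (force simp: fb)
  assume "\<And>b. b \<in> set (nbrs C a) \<Longrightarrow> f contour_integrable_on (coord C a \<circ> edge C a b)"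
  then show "contour_integral (face_boundary C a) f = (\<Sum>b\<in>set (nbrs C a). contour_integral (coord C a \<circ> edge C a b) f)"
    using J L(2) by (simp add: fb sum_list_distinct_conv_sum_set o_def)
qed

lemma face_boundary_disk: "a \<in> labels C \<Longrightarrow> path_image (face_boundary C a) \<subseteq> coord C a ` disk C a"
  using face_boundary(3) overlap_disk by blast

text \<open>Cauchy's theorem in the convex chart image, for the closed path formed by the edges
  around the face.\<close>

lemma sum_edge_integral_holomorphic:
  assumes a: "a \<in> labels C" and f: "holomorphic_fun C a (disk C a) f"
  shows "(\<Sum>b\<in>set (nbrs C a). edge_integral C a b f) = 0"
proof -
  have "((f \<circ> uncoord C a) has_contour_integral 0) (face_boundary C a)"
    using f face_boundary[OF a] face_boundary_disk[OF a] coord_disk[OF a]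
    by (intro Cauchy_theorem_convex_simple[of _ "coord C a ` disk C a"]) (simp_all add: holomorphic_fun_def)
  then have "contour_integral (face_boundary C a) (f \<circ> uncoord C a) = 0"
    by (rule contour_integral_unique)
  moreover have "(f \<circ> uncoord C a) contour_integrable_on (coord C a \<circ> edge C a b)" if "b \<in> set (nbrs C a)" for b
    using edge_integrable[OF a that holomorphic_fun_subset[OF f overlap_disk(1)]] .
  ultimately show ?thesis
    using face_boundary(4)[OF a] by (simp add: edge_integral_def)
qed

text \<open>Cauchy's integral formula: the marked point lies in its face, and the face boundary
  winds once around each point inside.\<close>

lemma sum_edge_integral_pole:
  assumes am: "a \<in> marked C" and f: "holomorphic_fun C a (disk C a) f"
  shows "(\<Sum>b\<in>set (nbrs C a). edge_integral C a b (\<lambda>p. f p / local_coord C a p)) = 2 * of_real pi * \<i> * f (mpoint C a)"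
proof -
  note a = marked_label[OF am]
  let ?w = "coord C a (mpoint C a)"
  let ?h = "\<lambda>p. f p / local_coord C a p"
  have "mpoint C a \<in> face C a" and wn: "\<forall>q\<in>inside (path_image (face_boundary C a)). winding_number (face_boundary C a) q = 1"
    using covering(3) am a by (simp_all add: covering_graph_def)
  then have ins: "?w \<in> inside (path_image (face_boundary C a))" by (simp add: face_def)
  then have w: "?w \<notin> path_image (face_boundary C a)" using inside_no_overlap by blast
  have 1: "((\<lambda>z. (f \<circ> uncoord C a) z / (z - ?w)) has_contour_integral
      (2 * pi * \<i> * winding_number (face_boundary C a) ?w * (f \<circ> uncoord C a) ?w)) (face_boundary C a)"
    using f face_boundary[OF a] face_boundary_disk[OF a] coord_disk[OF a] w mpoint_disk[OF am]
    by (intro Cauchy_integral_formula_convex_simple[of "coord C a ` disk C a"])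
      (auto simp: holomorphic_fun_iff o_def interior_open)
  have 2: "(\<lambda>z. (f \<circ> uncoord C a) z / (z - ?w)) contour_integrable_on (coord C a \<circ> edge C a b) \<and>
      contour_integral (coord C a \<circ> edge C a b) (\<lambda>z. (f \<circ> uncoord C a) z / (z - ?w)) = edge_integral C a b ?h"
    if b: "b \<in> set (nbrs C a)" for b
  proof -
    have "holomorphic_fun C a (overlap C a b) ?h"
      by (intro holomorphic_fun_divide a holomorphic_fun_local_coord overlap_disk(1) holomorphic_fun_subset[OF f]
          local_coord_overlap_nz[OF am nbrsD(1,2)[OF a b]])
    then have i: "(?h \<circ> uncoord C a) contour_integrable_on (coord C a \<circ> edge C a b)"
      using edge_integrable a b by blast
    have eq: "(?h \<circ> uncoord C a) z = (f \<circ> uncoord C a) z / (z - ?w)" if "z \<in> path_image (coord C a \<circ> edge C a b)" for z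
    proof -
      have "z \<in> coord C a ` overlap C a b" using edge_path_image[OF a b] that by blast
      then show ?thesis using coord_uncoord[OF a overlap_disk(1)] by (simp add: local_coord_def)
    qed
    show ?thesis
    proof
      show "(\<lambda>z. (f \<circ> uncoord C a) z / (z - ?w)) contour_integrable_on (coord C a \<circ> edge C a b)"
        by (rule contour_integrable_eq[OF i eq])
      show "contour_integral (coord C a \<circ> edge C a b) (\<lambda>z. (f \<circ> uncoord C a) z / (z - ?w)) = edge_integral C a b ?h"
        unfolding edge_integral_def by (rule contour_integral_eq[OF eq[symmetric]])
    qed
  qed
  have "contour_integral (face_boundary C a) (\<lambda>z. (f \<circ> uncoord C a) z / (z - ?w)) = (\<Sum>b\<in>set (nbrs C a). edge_integral C a b ?h)"
    using face_boundary(4)[OF a] 2 by simp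
  then show ?thesis
    using contour_integral_unique[OF 1] wn ins by (simp add: uncoord_coord a mpoint_disk am)
qed

section \<open>Edge integrals depending on a parameter\<close>

lemma continuous_on_uncoord_param:
  assumes "a \<in> labels C" "continuous_on (T \<times> overlap C a b) (\<lambda>(t, p). F t p)"
  shows "continuous_on (T \<times> coord C a ` overlap C a b) (\<lambda>(t, z). F t (uncoord C a z))"
proof -
  have "continuous_on (coord C a ` overlap C a b) (uncoord C a)"
    using continuous_uncoord[OF assms(1)] by (rule continuous_on_subset) (use overlap_disk(1) in blast)
  then have "continuous_on (T \<times> coord C a ` overlap C a b) (\<lambda>x. uncoord C a (snd x))"
    by (rule continuous_on_compose2) (auto intro: continuous_intros)
  then show ?thesis
    unfolding split_beta
    by (intro continuous_on_uncurry[OF assms(2)] continuous_on_fst continuous_on_id)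
      (use uncoord_image[OF assms(1) overlap_disk(1)] in auto)
qed

lemma continuous_on_edge_integral:
  fixes F :: "'x::topological_space \<Rightarrow> 's \<Rightarrow> complex"
  assumes "a \<in> labels C" "b \<in> set (nbrs C a)" "continuous_on (T \<times> overlap C a b) (\<lambda>(t, p). F t p)"
    and "\<And>t. t \<in> T \<Longrightarrow> holomorphic_fun C a (overlap C a b) (F t)"
  shows "continuous_on T (\<lambda>t. edge_integral C a b (F t))"
  unfolding edge_integral_def
  using continuous_on_contour_integral_param[OF open_coord_overlap[OF assms(1) nbrsD(1)[OF assms(1,2)]]
      nbrsD(5)[OF assms(1,2)] edge_path_image[OF assms(1,2)] continuous_on_uncoord_param[OF assms(1,3)]]
  using assms(4) by (simp add: o_def holomorphic_fun_iff)

lemma has_field_derivative_edge_integral: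
  assumes "a \<in> labels C" "b \<in> set (nbrs C a)" "open S" "continuous_on (S \<times> overlap C a b) (\<lambda>(t, p). F t p)"
    and "\<And>p. p \<in> overlap C a b \<Longrightarrow> (\<lambda>t. F t p) holomorphic_on S"
    and "\<And>t. t \<in> S \<Longrightarrow> holomorphic_fun C a (overlap C a b) (F t)" and "t\<^sub>0 \<in> S"
  shows "((\<lambda>t. edge_integral C a b (F t)) has_field_derivative edge_integral C a b (\<lambda>p. deriv (\<lambda>t. F t p) t\<^sub>0)) (at t\<^sub>0)"
  unfolding edge_integral_def o_def
  by (rule has_field_derivative_contour_integral_param[OF open_coord_overlap[OF assms(1) nbrsD(1)[OF assms(1,2)]]
      nbrsD(5)[OF assms(1,2), unfolded o_def] edge_path_image[OF assms(1,2), unfolded o_def] assms(3)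
      continuous_on_uncoord_param[OF assms(1,4)] _ _ assms(7)])
    (use assms(5,6) uncoord_image[OF assms(1) overlap_disk(1)] in \<open>auto simp: holomorphic_fun_iff\<close>)

lemma holomorphic_fun_deriv_param:
  assumes "a \<in> labels C" "b \<in> labels C" "open S" "continuous_on (S \<times> overlap C a b) (\<lambda>(t, p). F t p)"
    and "\<And>p. p \<in> overlap C a b \<Longrightarrow> (\<lambda>t. F t p) holomorphic_on S"
    and "\<And>t. t \<in> S \<Longrightarrow> holomorphic_fun C a (overlap C a b) (F t)" and "t\<^sub>0 \<in> S"
  shows "holomorphic_fun C a (overlap C a b) (\<lambda>p. deriv (\<lambda>t. F t p) t\<^sub>0)"
  unfolding holomorphic_fun_iff
  by (rule holomorphic_on_deriv_param[OF assms(3) open_coord_overlap[OF assms(1,2)]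
      continuous_on_uncoord_param[OF assms(1,4)] _ _ assms(7)])
    (use assms(5,6) uncoord_image[OF assms(1) overlap_disk(1)] in \<open>auto simp: holomorphic_fun_iff\<close>)

end

section \<open>The action of frame changes\<close>

lemma agree_refl: "agree C x x"
  and agree_sym: "agree C x y \<Longrightarrow> agree C y x"
  and agree_trans: "agree C x y \<Longrightarrow> agree C y z \<Longrightarrow> agree C x z"
  by (simp_all add: agree_def)

lemma act_cong: "agree C x y \<Longrightarrow> agree C (act f x) (act f y)"
  by (simp add: agree_def act_def)

lemma act_one: "act (\<lambda>_ _. mat 1) x = x"
  by (simp add: act_def matrix_inv_mat_1)

text \<open>Holomorphy and invertibility are asked on overlaps only. As a marked point lies in no
  overlap of its disk, frames with a zero or a pole there, such as the elementary modifications, are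
  included.\<close>

definition frame_change :: "('s, 'i) curve \<Rightarrow> ('i \<Rightarrow> 's \<Rightarrow> complex^'n^'n::finite) \<Rightarrow> bool" where
  "frame_change C \<phi> \<longleftrightarrow> (\<forall>a\<in>labels C. \<forall>b\<in>labels C. a \<noteq> b \<longrightarrow>
     holomorphic_mat C a (overlap C a b) (\<phi> a) \<and> (\<forall>p\<in>overlap C a b. invertible (\<phi> a p)))"

context riemann_surface
begin

lemma act_frame_cong:
  assumes "\<And>a b p. a \<in> labels C \<Longrightarrow> b \<in> labels C \<Longrightarrow> a \<noteq> b \<Longrightarrow> p \<in> overlap C a b \<Longrightarrow> f a p = g a p"
  shows "agree C (act f x) (act g x)"
  unfolding agree_def
proof (intro ballI impI)
  fix a b p assume *: "a \<in> labels C" "b \<in> labels C" "a \<noteq> b" "p \<in> overlap C a b"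
  then have "f a p = g a p" "f b p = g b p"
    using assms[of a b p] assms[of b a p] by (simp_all add: overlap_commute)
  then show "fst (act f x) a b p = fst (act g x) a b p \<and> snd (act f x) a b p = snd (act g x) a b p"
    by (simp add: act_def)
qed

lemma frame_changeD:
  assumes "frame_change C \<phi>" "a \<in> labels C" "b \<in> labels C" "a \<noteq> b"
  shows "holomorphic_mat C a (overlap C a b) (\<phi> a)" "holomorphic_mat C a (overlap C a b) (\<phi> b)"
    "p \<in> overlap C a b \<Longrightarrow> invertible (\<phi> a p)" "p \<in> overlap C a b \<Longrightarrow> invertible (\<phi> b p)"
proof -
  have "holomorphic_mat C b (overlap C b a) (\<phi> b)"
    using assms by (simp add: frame_change_def)
  then show "holomorphic_mat C a (overlap C a b) (\<phi> b)"
    using holomorphic_mat_change_chart[OF assms(2,3) order_refl] by (simp add: overlap_commute)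
  show "p \<in> overlap C a b \<Longrightarrow> invertible (\<phi> b p)"
    using assms overlap_commute[of a b] by (simp add: frame_change_def)
qed (use assms in \<open>simp_all add: frame_change_def\<close>)

lemma frame_change_mult:
  assumes "frame_change C \<phi>" "frame_change C \<psi>"
  shows "frame_change C (\<lambda>a p. \<phi> a p ** \<psi> a p)"
  using assms unfolding frame_change_def by (simp add: holomorphic_mat_mult invertible_mult)

lemma frame_change_inv:
  assumes "frame_change C \<phi>"
  shows "frame_change C (\<lambda>a p. matrix_inv (\<phi> a p))"
  using assms unfolding frame_change_def
  by (simp add: holomorphic_mat_inv[OF _ overlap_disk(1)] invertible_matrix_inv)

text \<open>Equality up to \<open>agree\<close> is the natural form: off the overlaps the frames may
  be singular, and there \<open>matrix_inv\<close> need not reverse products.\<close>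

lemma act_act:
  assumes "frame_change C \<phi>" "frame_change C \<psi>"
  shows "agree C (act \<phi> (act \<psi> x)) (act (\<lambda>a p. \<phi> a p ** \<psi> a p) x)"
  using frame_changeD(3,4)[OF assms(1)] frame_changeD(3,4)[OF assms(2)]
  by (simp add: agree_def act_def matrix_inv_mult matrix_mul_assoc)

lemma act_inv_act:
  assumes "frame_change C \<phi>"
  shows "agree C (act (\<lambda>a p. matrix_inv (\<phi> a p)) (act \<phi> x)) x"
proof -
  have "agree C (act (\<lambda>a p. matrix_inv (\<phi> a p) ** \<phi> a p) x) (act (\<lambda>_ _. mat 1) x)"
    using frame_changeD(3)[OF assms] by (intro act_frame_cong) (simp add: matrix_inv_left)
  then show ?thesis
    using agree_trans[OF act_act[OF frame_change_inv[OF assms] assms]] by (simp add: act_one)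
qed

lemma act_eq_imp_inv:
  assumes "frame_change C \<phi>" "agree C y (act \<phi> x)"
  shows "agree C x (act (\<lambda>a p. matrix_inv (\<phi> a p)) y)"
  using act_cong[OF assms(2)] act_inv_act[OF assms(1)] agree_trans agree_sym by metis

lemma is_bundle_act:
  assumes \<phi>: "frame_change C \<phi>" and g: "is_bundle C (snd x)"
  shows "is_bundle C (snd (act \<phi> x))"
  unfolding is_bundle_def
proof (intro conjI ballI impI)
  fix a b assume ab: "a \<in> labels C" "b \<in> labels C" "a \<noteq> b"
  then have g': "holomorphic_mat C a (overlap C a b) (snd x a b)"
      "\<And>p. p \<in> overlap C a b \<Longrightarrow> invertible (snd x a b p) \<and> snd x a b p ** snd x b a p = mat 1"
    using g by (simp_all add: is_bundle_def)
  note f = frame_changeD[OF \<phi> ab]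
  show "holomorphic_mat C a (overlap C a b) (snd (act \<phi> x) a b)"
    using g' f ab unfolding act_def snd_conv
    by (intro holomorphic_mat_mult holomorphic_mat_inv) (simp_all add: overlap_disk)
  fix p assume p: "p \<in> overlap C a b"
  show "invertible (snd (act \<phi> x) a b p)"
    using g' f p by (simp add: act_def invertible_mult invertible_matrix_inv)
  have "\<phi> a p ** snd x a b p ** matrix_inv (\<phi> b p) ** (\<phi> b p ** snd x b a p ** matrix_inv (\<phi> a p)) =
      \<phi> a p ** (snd x a b p ** (matrix_inv (\<phi> b p) ** \<phi> b p) ** snd x b a p) ** matrix_inv (\<phi> a p)"
    by (simp add: matrix_mul_assoc)
  then show "snd (act \<phi> x) a b p ** snd (act \<phi> x) b a p = mat 1"
    using g'(2)[OF p] f(3,4)[OF p] by (simp add: act_def matrix_inv_left matrix_inv_right)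
next
  fix a b c p assume abc: "a \<in> labels C" "b \<in> labels C" "c \<in> labels C" "a \<noteq> b \<and> b \<noteq> c \<and> c \<noteq> a"
    and p: "p \<in> disk C a \<inter> disk C b \<inter> disk C c"
  have ov: "p \<in> overlap C a b" "p \<in> overlap C b c" "p \<in> overlap C c a"
    using p by (simp_all add: overlap_def)
  have inv: "invertible (\<phi> a p)" "invertible (\<phi> b p)" "invertible (\<phi> c p)"
    using abc ov frame_changeD(3,4)[OF \<phi>] by blast+
  have "\<phi> a p ** snd x a b p ** matrix_inv (\<phi> b p) ** (\<phi> b p ** snd x b c p ** matrix_inv (\<phi> c p)) **
      (\<phi> c p ** snd x c a p ** matrix_inv (\<phi> a p)) =
    \<phi> a p ** (snd x a b p ** (matrix_inv (\<phi> b p) ** \<phi> b p) ** snd x b c p ** (matrix_inv (\<phi> c p) ** \<phi> c p) **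
      snd x c a p) ** matrix_inv (\<phi> a p)"
    by (simp add: matrix_mul_assoc)
  moreover have "snd x a b p ** snd x b c p ** snd x c a p = mat 1"
    using g abc p by (simp add: is_bundle_def)
  ultimately show "snd (act \<phi> x) a b p ** snd (act \<phi> x) b c p ** snd (act \<phi> x) c a p = mat 1"
    using inv by (simp add: act_def matrix_inv_left matrix_inv_right)
qed

lemma is_higgs_field_act:
  assumes \<phi>: "frame_change C \<phi>" and g: "is_bundle C (snd x)" and h: "is_higgs_field C x"
  shows "is_higgs_field C (act \<phi> x)"
  unfolding is_higgs_field_def
proof (intro conjI ballI impI allI)
  fix a b assume ab: "a \<in> labels C" "b \<in> labels C" "a \<noteq> b"
  note f = frame_changeD[OF \<phi> ab]
  have h': "holomorphic_mat C a (overlap C a b) (fst x a b)"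
      "\<And>p i j. p \<in> overlap C a b \<Longrightarrow> fst x a b p $ i $ j = transition_deriv C a b p *
        (snd x a b p ** fst x b a p ** matrix_inv (snd x a b p)) $ i $ j"
    using h ab by (simp_all add: is_higgs_field_def)
  show "holomorphic_mat C a (overlap C a b) (fst (act \<phi> x) a b)"
    using h' f ab unfolding act_def fst_conv
    by (intro holomorphic_mat_mult holomorphic_mat_inv) (simp_all add: overlap_disk)
  fix p i j assume p: "p \<in> overlap C a b"
  let ?g = "snd x a b p" and ?c = "transition_deriv C a b p"
  let ?E = "?g ** fst x b a p ** matrix_inv ?g"
  have inv: "invertible ?g" "invertible (\<phi> a p)" "invertible (\<phi> b p)"
    using g ab p f by (auto simp: is_bundle_def)
  have "matrix_inv (\<phi> a p ** ?g ** matrix_inv (\<phi> b p)) = \<phi> b p ** matrix_inv ?g ** matrix_inv (\<phi> a p)"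
    using inv by (simp add: matrix_inv_mult invertible_mult invertible_matrix_inv matrix_inv_inv matrix_mul_assoc)
  then have "snd (act \<phi> x) a b p ** fst (act \<phi> x) b a p ** matrix_inv (snd (act \<phi> x) a b p) =
      \<phi> a p ** ?g ** (matrix_inv (\<phi> b p) ** \<phi> b p) ** fst x b a p ** (matrix_inv (\<phi> b p) ** \<phi> b p) **
        matrix_inv ?g ** matrix_inv (\<phi> a p)"
    by (simp add: act_def matrix_mul_assoc)
  also have "\<dots> = \<phi> a p ** ?E ** matrix_inv (\<phi> a p)"
    using inv by (simp add: matrix_inv_left matrix_mul_assoc)
  finally have 1: "snd (act \<phi> x) a b p ** fst (act \<phi> x) b a p ** matrix_inv (snd (act \<phi> x) a b p) =
      \<phi> a p ** ?E ** matrix_inv (\<phi> a p)" .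
  have "fst (act \<phi> x) a b p $ i $ j = ?c * (\<phi> a p ** ?E ** matrix_inv (\<phi> a p)) $ i $ j"
    using h'(2)[OF p] by (simp add: act_def matrix_mul_nth sum_distrib_left sum_distrib_right mult_ac)
  then show "fst (act \<phi> x) a b p $ i $ j = ?c * (snd (act \<phi> x) a b p ** fst (act \<phi> x) b a p **
      matrix_inv (snd (act \<phi> x) a b p)) $ i $ j"
    by (simp only: 1)
qed

section \<open>The degree after a frame change with a zero or pole at a marked point\<close>

lemma zorder_local_coord:
  assumes "\<alpha> \<in> marked C" "p \<in> disk C \<alpha>"
  shows "zorder (local_coord C \<alpha> \<circ> uncoord C \<alpha>) (coord C \<alpha> p) = (if p = mpoint C \<alpha> then 1 else 0)"
proof -
  note lab = marked_label[OF assms(1)]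
  let ?w = "coord C \<alpha> (mpoint C \<alpha>)"
  have "\<forall>\<^sub>F z in nhds (coord C \<alpha> p). z \<in> coord C \<alpha> ` disk C \<alpha>"
    using coord_disk(1)[OF lab] assms(2) by (intro eventually_nhds_in_open) auto
  then have "\<forall>\<^sub>F z in nhds (coord C \<alpha> p). (local_coord C \<alpha> \<circ> uncoord C \<alpha>) z = z - ?w"
    by (rule eventually_mono) (simp add: local_coord_def coord_uncoord[OF lab order_refl])
  then have ev: "\<forall>\<^sub>F z in at (coord C \<alpha> p). (local_coord C \<alpha> \<circ> uncoord C \<alpha>) z = z - ?w"
    using eventually_nhds_conv_at by blast
  have eq: "zorder (local_coord C \<alpha> \<circ> uncoord C \<alpha>) (coord C \<alpha> p) = zorder (\<lambda>z. z - ?w) (coord C \<alpha> p)"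
    by (rule zorder_cong[OF ev refl])
  show ?thesis
  proof (cases "p = mpoint C \<alpha>")
    case True
    have "zorder (\<lambda>z. z - ?w) ?w = 1"
      by (rule zorder_eqI[of UNIV _ "\<lambda>_. 1"]) auto
    then show ?thesis using eq True by simp
  next
    case False
    then have "coord C \<alpha> p - ?w \<noteq> 0"
      using local_coord_nz[OF assms] by (simp add: local_coord_def)
    then have "zorder (\<lambda>z. z - ?w) (coord C \<alpha> p) = 0"
      by (intro zorder_eq_0I) (auto intro!: analytic_intros)
    then show ?thesis using eq False by simp
  qed
qed

text \<open>A meromorphic section \<open>s\<close> of the old determinant bundle becomes one of the
  new bundle after multiplication by the determinant of the frame. The factor \<open>u\<close> has
  no zeros, so only the power of z_\<alpha> changes the divisor, by \<open>e\<close> times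
  w_\<alpha>.\<close>

lemma has_degree_act:
  assumes \<alpha>: "\<alpha> \<in> marked C" and d: "has_degree C (snd x) d" and \<phi>: "frame_change C \<phi>"
    and u: "\<And>a. a \<in> labels C \<Longrightarrow> holomorphic_fun C a (disk C a) (u a)" "\<And>a p. a \<in> labels C \<Longrightarrow> p \<in> disk C a \<Longrightarrow> u a p \<noteq> 0"
    and det: "\<And>a b p. a \<in> labels C \<Longrightarrow> b \<in> labels C \<Longrightarrow> a \<noteq> b \<Longrightarrow> p \<in> overlap C a b \<Longrightarrow>
      det (\<phi> a p) = u a p * (if a = \<alpha> then local_coord C \<alpha> p powi e else 1)"
  shows "has_degree C (snd (act \<phi> x)) (d + e)"
proof -
  note lab = marked_label[OF \<alpha>]
  let ?w = "mpoint C \<alpha>"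
  obtain s Z and ord :: "'s \<Rightarrow> int" where *: "finite Z \<and>
     (\<forall>a\<in>labels C. (s a \<circ> uncoord C a) meromorphic_on coord C a ` disk C a \<and>
        holomorphic_fun C a (disk C a - Z) (s a) \<and> (\<forall>p\<in>disk C a - Z. s a p \<noteq> 0) \<and>
        (\<forall>p\<in>disk C a \<inter> Z. zorder (s a \<circ> uncoord C a) (coord C a p) = ord p)) \<and>
     (\<forall>a\<in>labels C. \<forall>b\<in>labels C. a \<noteq> b \<longrightarrow>
        (\<forall>p\<in>overlap C a b - Z. s a p = det (snd x a b p) * s b p)) \<and>
     d = (\<Sum>p\<in>Z. ord p)"
    using d unfolding has_degree_def by (elim exE) (rule that)
  then have Z: "finite Z"
    and mero: "\<And>a. a \<in> labels C \<Longrightarrow> (s a \<circ> uncoord C a) meromorphic_on coord C a ` disk C a"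
    and hol: "\<And>a. a \<in> labels C \<Longrightarrow> holomorphic_fun C a (disk C a - Z) (s a)"
    and nz: "\<And>a p. a \<in> labels C \<Longrightarrow> p \<in> disk C a - Z \<Longrightarrow> s a p \<noteq> 0"
    and ord: "\<And>a p. a \<in> labels C \<Longrightarrow> p \<in> disk C a \<inter> Z \<Longrightarrow> zorder (s a \<circ> uncoord C a) (coord C a p) = ord p"
    and sec: "\<And>a b p. a \<in> labels C \<Longrightarrow> b \<in> labels C \<Longrightarrow> a \<noteq> b \<Longrightarrow> p \<in> overlap C a b - Z \<Longrightarrow>
      s a p = det (snd x a b p) * s b p"
    and dsum: "d = (\<Sum>p\<in>Z. ord p)"
    by blast+
  \<comment> \<open>The product of \<open>u\<close> and \<open>k\<close> extends the determinant of
    the frame from the overlaps to the whole disks.\<close>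
  define k where "k a p = (if a = \<alpha> then local_coord C \<alpha> p powi e else 1)" for a p
  define s' where "s' a p = u a p * (k a p * s a p)" for a p
  \<comment> \<open>The marked point may or may not already belong to \<open>Z\<close>; the two
    summands give the right order in both cases, and the divisor is summed over
    \<open>insert ?w Z\<close>.\<close>
  define ord' :: "'s \<Rightarrow> int" where "ord' p = (if p \<in> Z then ord p else 0) + (if p = ?w then e else 0)" for p
  have k_nz: "k a p \<noteq> 0" if "a \<in> labels C" "p \<in> disk C a" "p \<noteq> ?w" for a p
    using that local_coord_nz[OF \<alpha>] by (auto simp: k_def power_int_eq_0_iff)
  have u_an: "(u a \<circ> uncoord C a) analytic_on coord C a ` disk C a" if "a \<in> labels C" for a
    using u(1)[OF that] coord_disk(1)[OF that] by (simp add: analytic_on_open holomorphic_fun_def)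
  have lc_an: "(local_coord C a \<circ> uncoord C a) analytic_on coord C a ` disk C a" if "a \<in> labels C" for a
    using holomorphic_fun_local_coord[OF that order_refl] coord_disk(1)[OF that]
    by (simp add: analytic_on_open holomorphic_fun_def)
  have k_mero: "(k a \<circ> uncoord C a) meromorphic_on coord C a ` disk C a" if "a \<in> labels C" for a
  proof (cases "a = \<alpha>")
    case True
    have "(\<lambda>z. (local_coord C a \<circ> uncoord C a) z powi e) meromorphic_on coord C a ` disk C a"
      by (intro meromorphic_on_powi analytic_on_imp_meromorphic_on lc_an that)
    then show ?thesis using True by (simp add: k_def o_def)
  qed (simp add: k_def o_def analytic_on_imp_meromorphic_on)
  have s'_eq: "s' a \<circ> uncoord C a = (\<lambda>z. (u a \<circ> uncoord C a) z * ((k a \<circ> uncoord C a) z * (s a \<circ> uncoord C a) z))" for a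
    by (simp add: s'_def o_def)
  \<comment> \<open>Punctured neighbourhoods avoiding \<open>Z\<close> and the marked point: there
    all factors are nonzero, as the additivity of \<open>zorder\<close> requires.\<close>
  have near: "\<forall>\<^sub>F z in at (coord C a p). z \<in> coord C a ` (disk C a - insert ?w Z - {p})"
    if "a \<in> labels C" "p \<in> disk C a" for a p
  proof -
    have im: "coord C a ` (disk C a - insert ?w Z - {p}) = coord C a ` (disk C a - (insert ?w Z - {p})) - {coord C a p}"
      using inj_coord[OF that(1)] that(2) by (auto simp: inj_on_def)
    have "open (disk C a - (insert ?w Z - {p}))"
      using Z open_disk[OF that(1)] by (intro open_Diff finite_imp_closed) auto
    then have "open (coord C a ` (disk C a - (insert ?w Z - {p})))"
      using that(1) by (intro open_coord_image) auto
    then have "\<forall>\<^sub>F z in at (coord C a p). z \<in> coord C a ` (disk C a - (insert ?w Z - {p})) - {coord C a p}"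
      using that(2) by (intro eventually_at_in_open) auto
    then show ?thesis by (simp add: im)
  qed
  have freq: "\<exists>\<^sub>F z in at (coord C a p). f z \<noteq> 0"
    if "a \<in> labels C" "p \<in> disk C a" "\<And>q. q \<in> disk C a - insert ?w Z \<Longrightarrow> f (coord C a q) \<noteq> 0" for a p and f :: "complex \<Rightarrow> complex"
    by (rule eventually_frequently[OF at_neq_bot]) (rule eventually_mono[OF near[OF that(1,2)]], use that(3) in auto)
  have ord'_eq: "zorder (s' a \<circ> uncoord C a) (coord C a p) = ord' p"
    if a: "a \<in> labels C" and p: "p \<in> disk C a" for a p
  proof -
    have cp: "coord C a p \<in> coord C a ` disk C a" using p by blast
    have m: "(s a \<circ> uncoord C a) meromorphic_on {coord C a p}" "(k a \<circ> uncoord C a) meromorphic_on {coord C a p}"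
        "(u a \<circ> uncoord C a) analytic_on {coord C a p}"
      using mero[OF a] k_mero[OF a] u_an[OF a] p by (auto intro: meromorphic_on_subset analytic_on_subset)
    have f: "\<exists>\<^sub>F z in at (coord C a p). (s a \<circ> uncoord C a) z \<noteq> 0" "\<exists>\<^sub>F z in at (coord C a p). (k a \<circ> uncoord C a) z \<noteq> 0"
        "\<exists>\<^sub>F z in at (coord C a p). (u a \<circ> uncoord C a) z \<noteq> 0"
        "\<exists>\<^sub>F z in at (coord C a p). (k a \<circ> uncoord C a) z * (s a \<circ> uncoord C a) z \<noteq> 0"
      by (rule freq[OF a p], use nz[OF a] k_nz[OF a] u(2)[OF a] in \<open>simp add: uncoord_coord[OF a]\<close>)+
    have zu: "zorder (u a \<circ> uncoord C a) (coord C a p) = 0"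
      using m(3) u(2)[OF a p] by (intro zorder_eq_0I) (simp_all add: uncoord_coord a p)
    have zk: "zorder (k a \<circ> uncoord C a) (coord C a p) = (if p = ?w then e else 0)"
    proof (cases "a = \<alpha>")
      case True
      have 1: "(local_coord C \<alpha> \<circ> uncoord C \<alpha>) meromorphic_on {coord C \<alpha> p}"
        using lc_an[OF lab] p True by (auto intro: analytic_on_imp_meromorphic_on analytic_on_subset)
      have 2: "\<exists>\<^sub>F z in at (coord C \<alpha> p). (local_coord C \<alpha> \<circ> uncoord C \<alpha>) z \<noteq> 0"
        using p True local_coord_nz[OF \<alpha>] by (auto intro!: freq[OF lab] simp: uncoord_coord[OF lab])
      have "k a \<circ> uncoord C a = (\<lambda>z. (local_coord C \<alpha> \<circ> uncoord C \<alpha>) z powi e)"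
        using True by (simp add: k_def o_def)
      then show ?thesis
        using zorder_power_int[OF 1 2, of e] zorder_local_coord[OF \<alpha>, of p] p True by (simp add: o_def)
    next
      case False
      then have "p \<noteq> ?w" using mpoint_not_disk[OF \<alpha> a] p by blast
      then show ?thesis using False by (simp add: k_def o_def)
    qed
    have zs: "zorder (s a \<circ> uncoord C a) (coord C a p) = (if p \<in> Z then ord p else 0)"
    proof (cases "p \<in> Z")
      case False
      have op: "open (coord C a ` (disk C a - Z))"
        using Z open_disk[OF a] by (intro open_coord_image a open_Diff finite_imp_closed) auto
      then have "(s a \<circ> uncoord C a) analytic_on coord C a ` (disk C a - Z)"
        using hol[OF a] by (simp add: analytic_on_open holomorphic_fun_def)
      then have "(s a \<circ> uncoord C a) analytic_on {coord C a p}"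
        using p False by (auto intro: analytic_on_subset)
      then have "zorder (s a \<circ> uncoord C a) (coord C a p) = 0"
        using nz[OF a, of p] p False by (intro zorder_eq_0I) (simp_all add: uncoord_coord a)
      then show ?thesis using False by simp
    qed (use ord[OF a] p in simp)
    show ?thesis
      unfolding s'_eq ord'_def
      using zorder_mult[OF analytic_on_imp_meromorphic_on[OF m(3)] f(3) meromorphic_on_mult[OF m(2,1)] f(4)]
        zorder_mult[OF m(2) f(2) m(1) f(1)] zu zk zs by linarith
  qed
  show ?thesis
    unfolding has_degree_def
  proof (intro exI conjI ballI impI)
    show "finite (insert ?w Z)" using Z by simp
    fix a assume a: "a \<in> labels C"
    show "(s' a \<circ> uncoord C a) meromorphic_on coord C a ` disk C a"
      unfolding s'_eq by (intro meromorphic_on_mult analytic_on_imp_meromorphic_on u_an k_mero mero a)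
    have "holomorphic_fun C a (disk C a - insert ?w Z) (k a)"
    proof (cases "a = \<alpha>")
      case True
      have "holomorphic_fun C \<alpha> (disk C \<alpha> - insert ?w Z) (local_coord C \<alpha>)"
        by (intro holomorphic_fun_local_coord lab) auto
      then have "(\<lambda>z. (local_coord C \<alpha> (uncoord C \<alpha> z)) powi e) holomorphic_on coord C \<alpha> ` (disk C \<alpha> - insert ?w Z)"
        unfolding holomorphic_fun_iff
        by (rule holomorphic_on_power_int[rotated]) (auto simp: uncoord_coord lab local_coord_nz[OF \<alpha>])
      then show ?thesis using True by (simp add: k_def holomorphic_fun_iff)
    next
      case False
      then have "k a = (\<lambda>_. 1)" by (simp add: k_def fun_eq_iff)
      then show ?thesis by (simp add: holomorphic_fun_const)
    qed
    then show "holomorphic_fun C a (disk C a - insert ?w Z) (s' a)"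
      unfolding s'_def using u(1)[OF a] hol[OF a]
      by (intro holomorphic_fun_mult) (auto intro: holomorphic_fun_subset)
    fix p
    show "p \<in> disk C a - insert ?w Z \<Longrightarrow> s' a p \<noteq> 0"
      using u(2)[OF a] k_nz[OF a] nz[OF a] by (auto simp: s'_def)
    show "p \<in> disk C a \<inter> insert ?w Z \<Longrightarrow> zorder (s' a \<circ> uncoord C a) (coord C a p) = ord' p"
      using ord'_eq[OF a] by simp
    fix b assume b: "b \<in> labels C" "a \<noteq> b"
    assume p: "p \<in> overlap C a b - insert ?w Z"
    note f = frame_changeD[OF \<phi> a b]
    have "det (\<phi> a p) = u a p * k a p" "det (\<phi> b p) = u b p * k b p"
      using det[OF a b, of p] det[OF b(1) a b(2)[symmetric], of p] p by (simp_all add: k_def overlap_commute)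
    moreover have "det (\<phi> b p) * det (matrix_inv (\<phi> b p)) = 1"
      using f(4) p by (simp add: matrix_inv_right flip: det_mul)
    moreover have "s a p = det (snd x a b p) * s b p" using sec[OF a b, of p] p by simp
    ultimately show "s' a p = det (snd (act \<phi> x) a b p) * s' b p"
      by (simp add: act_def det_mul s'_def mult_ac)
  next
    have "(\<Sum>p\<in>insert ?w Z. ord' p) = (\<Sum>p\<in>insert ?w Z. if p \<in> Z then ord p else 0) + (\<Sum>p\<in>insert ?w Z. if p = ?w then e else 0)"
      by (simp add: ord'_def sum.distrib)
    also have "(\<Sum>p\<in>insert ?w Z. if p = ?w then e else 0) = e"
      using Z by (simp add: sum.delta)
    also have "(\<Sum>p\<in>insert ?w Z. if p \<in> Z then ord p else 0) = (\<Sum>p\<in>Z. ord p)"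
      using Z by (intro sum.mono_neutral_cong_right) auto
    finally show "d + e = (\<Sum>p\<in>insert ?w Z. ord' p)" by (simp add: dsum)
  qed
qed

end

section \<open>Gauge equivalence on the level set\<close>

lemma polar_part_mult: "(polar_part C D a p ** A) $ i $ j = polar_part C D a p $ i $ i * A $ i $ j"
  by (simp add: matrix_mul_nth polar_part_def if_distrib[of "\<lambda>x. x * _"] cong: if_cong)

lemma mult_polar_part: "(A ** polar_part C D a p) $ i $ j = A $ i $ j * polar_part C D a p $ j $ j"
proof -
  have "(A ** polar_part C D a p) $ i $ j = (\<Sum>l\<in>UNIV. if l = j then A $ i $ j * polar_part C D a p $ j $ j else 0)"
    unfolding matrix_mul_nth by (rule sum.cong) (auto simp: polar_part_def)
  then show ?thesis by simp
qed

definition commutes_residue :: "('i, 'n::finite) parabolic \<Rightarrow> 'i \<Rightarrow> complex^'n^'n \<Rightarrow> bool" where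
  "commutes_residue D a A \<longleftrightarrow> (\<forall>i j. residue_entry D a i * A $ i $ j = A $ i $ j * residue_entry D a j)"

text \<open>Commutation kills the entries of \<open>A\<close> between indices with different
  residues, and by genericity the residues of different blocks differ. So \<open>A\<close> is block
  diagonal and preserves every flag subspace.\<close>

lemma commutes_residue_parabolic:
  assumes "parabolic_data C D" "a \<in> marked C" "invertible A" "commutes_residue D a A"
  shows "A \<in> parabolic_subgroup D a"
proof -
  have block: "A $ i $ j = 0" if "flag D a i \<noteq> flag D a j" for i j
  proof -
    have "residue_entry D a i \<noteq> residue_entry D a j"
      using that assms(1,2) unfolding parabolic_data_def by blast
    then show ?thesis
      using assms(4) by (auto simp: commutes_residue_def)
  qed
  have "(A *v v) $ i = 0" if "v \<in> flag_subspace D a k" "k < flag D a i" for v k i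
    unfolding matrix_vector_mult_def using that block[of i]
    by (auto simp: flag_subspace_def intro!: sum.neutral) (metis)
  then show ?thesis
    using assms(3) by (simp add: parabolic_subgroup_def flag_subspace_def)
qed

lemma gauge_onD:
  assumes "f \<in> gauge_on C D M" "a \<in> labels C"
  shows "holomorphic_mat C a (disk C a) (f a)" "p \<in> disk C a \<Longrightarrow> invertible (f a p)"
  using assms by (simp_all add: gauge_on_def)

lemma gauge_on_mono: "f \<in> gauge_on C D M \<Longrightarrow> M' \<subseteq> M \<Longrightarrow> f \<in> gauge_on C D M'"
  by (auto simp: gauge_on_def)

lemma gauge_on_mult:
  assumes "f \<in> gauge_on C D {}" "g \<in> gauge_on C D {}"
  shows "(\<lambda>a p. f a p ** g a p) \<in> gauge_on C D {}"
  using assms by (simp add: gauge_on_def holomorphic_mat_mult invertible_mult)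

lemma gauge_on_one: "(\<lambda>_ _. mat 1) \<in> gauge_on C D {}"
  by (simp add: gauge_on_def holomorphic_mat_const invertible_mat_1)

context riemann_surface
begin

lemma gauge_on_inv:
  assumes "f \<in> gauge_on C D {}"
  shows "(\<lambda>a p. matrix_inv (f a p)) \<in> gauge_on C D {}"
  using assms by (simp add: gauge_on_def holomorphic_mat_inv invertible_matrix_inv)

lemma gauge_on_frame_change:
  assumes "f \<in> gauge_on C D M"
  shows "frame_change C f"
  unfolding frame_change_def
proof (intro ballI impI conjI)
  fix a b assume a: "a \<in> labels C"
  show "holomorphic_mat C a (overlap C a b) (f a)"
    by (rule holomorphic_mat_subset[OF gauge_onD(1)[OF assms a] overlap_disk(1)])
  show "invertible (f a p)" if "p \<in> overlap C a b" for p
    using that by (intro gauge_onD(2)[OF assms a]) (simp add: overlap_def)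
qed

text \<open>
  By the identity theorem the relation between the two forms extends from the overlaps to the
  disk; comparing residues shows that the frame change commutes with \<open>p_a\<^sup>(\<^sup>0\<^sup>)\<close> at \<open>w_a\<close>.
\<close>

lemma commutes_at_mpoint:
  assumes a: "a \<in> marked C" and F: "holomorphic_mat C a (disk C a) F"
    and x: "moment_condition C D x" and y: "moment_condition C D y"
    and eq: "\<And>b p. b \<in> labels C \<Longrightarrow> b \<noteq> a \<Longrightarrow> p \<in> overlap C a b \<Longrightarrow> fst y a b p ** F p = F p ** fst x a b p"
  shows "commutes_residue D a (F (mpoint C a))"
  unfolding commutes_residue_def
proof (intro allI)
  fix i j
  note lab = marked_label[OF a]
  obtain h where h: "holomorphic_mat C a (disk C a) h"
      "\<And>b p. b \<in> labels C \<Longrightarrow> b \<noteq> a \<Longrightarrow> p \<in> overlap C a b \<Longrightarrow> fst x a b p = polar_part C D a p + h p"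
    using x lab unfolding moment_condition_def by blast
  obtain h' where h': "holomorphic_mat C a (disk C a) h'"
      "\<And>b p. b \<in> labels C \<Longrightarrow> b \<noteq> a \<Longrightarrow> p \<in> overlap C a b \<Longrightarrow> fst y a b p = polar_part C D a p + h' p"
    using y lab unfolding moment_condition_def by blast
  \<comment> \<open>Both sides of the relation are multiplied by the local coordinate, which clears
    the pole and makes them holomorphic on the whole disk.\<close>
  let ?l = "\<lambda>p. residue_entry D a i * F p $ i $ j + local_coord C a p * (h' p ** F p) $ i $ j"
  let ?r = "\<lambda>p. F p $ i $ j * residue_entry D a j + local_coord C a p * (F p ** h p) $ i $ j"
  have "?l (mpoint C a) = ?r (mpoint C a)"
  proof (rule holomorphic_fun_eq_on_disk[OF lab _ _ _ mpoint_disk[OF a]])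
    show "holomorphic_fun C a (disk C a) ?l" "holomorphic_fun C a (disk C a) ?r"
      using F h(1) h'(1)
      by (auto intro!: holomorphic_fun_intros holomorphic_fun_local_coord lab holomorphic_matD holomorphic_mat_mult)
    fix b p assume b: "b \<in> labels C" "b \<noteq> a" and p: "p \<in> overlap C a b"
    have "polar_part C D a p ** F p + h' p ** F p = F p ** polar_part C D a p + F p ** h p"
      using eq[OF b p] h(2)[OF b p] h'(2)[OF b p] by (simp add: matrix_add_ldistrib matrix_add_rdistrib)
    then have "(polar_part C D a p ** F p) $ i $ j + (h' p ** F p) $ i $ j =
        (F p ** polar_part C D a p) $ i $ j + (F p ** h p) $ i $ j"
      by (metis vector_add_component)
    then have "residue_entry D a i / local_coord C a p * F p $ i $ j + (h' p ** F p) $ i $ j =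
        F p $ i $ j * (residue_entry D a j / local_coord C a p) + (F p ** h p) $ i $ j"
      unfolding polar_part_mult mult_polar_part using a by (simp add: polar_part_def)
    then show "?l p = ?r p"
      using local_coord_overlap_nz[OF a b p] by (simp add: field_simps)
  qed
  then show "residue_entry D a i * F (mpoint C a) $ i $ j = F (mpoint C a) $ i $ j * residue_entry D a j"
    by (simp add: local_coord_mpoint)
qed

lemma gauge_commutes:
  assumes "a \<in> marked C" "f \<in> gauge_on C D M" "moment_condition C D x" "moment_condition C D y"
    and "agree C y (act f x)"
  shows "commutes_residue D a (f a (mpoint C a))"
proof (rule commutes_at_mpoint[OF assms(1) _ assms(3,4)])
  note lab = marked_label[OF assms(1)]
  show "holomorphic_mat C a (disk C a) (f a)" by (rule gauge_onD(1)[OF assms(2) lab])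
  fix b p assume b: "b \<in> labels C" "b \<noteq> a" "p \<in> overlap C a b"
  then have "fst y a b p = f a p ** fst x a b p ** matrix_inv (f a p)"
    using assms(5) lab by (simp add: agree_def act_def)
  moreover have "invertible (f a p)"
    using gauge_onD(2)[OF assms(2) lab] b(3) overlap_disk(1) by blast
  ultimately show "fst y a b p ** f a p = f a p ** fst x a b p"
    by (metis matrix_inv_left matrix_mul_assoc matrix_mul_rid)
qed

text \<open>Let p be the residue and z the local coordinate. If f commutes with p at the marked
  point, [f, p] vanishes there and [f, p]/z extends holomorphically, to \<open>G\<close>. The new
  Higgs field is then p/z plus (G + f h) f^{-1}.\<close>

lemma gauge_act_moment:
  assumes f: "f \<in> gauge_on C D {}" and x: "moment_condition C D x"
    and c: "\<And>a. a \<in> marked C \<Longrightarrow> commutes_residue D a (f a (mpoint C a))"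
  shows "moment_condition C D (act f x)"
  unfolding moment_condition_def
proof (intro ballI)
  fix a assume a: "a \<in> labels C"
  obtain h where h: "holomorphic_mat C a (disk C a) h"
      "\<And>b p. b \<in> labels C \<Longrightarrow> b \<noteq> a \<Longrightarrow> p \<in> overlap C a b \<Longrightarrow> fst x a b p = polar_part C D a p + h p"
    using x a unfolding moment_condition_def by blast
  have "\<exists>G. holomorphic_mat C a (disk C a) G \<and>
      (\<forall>b\<in>labels C. b \<noteq> a \<longrightarrow> (\<forall>p\<in>overlap C a b. f a p ** polar_part C D a p - polar_part C D a p ** f a p = G p))"
  proof (cases "a \<in> marked C")
    case True
    have "\<exists>g. holomorphic_fun C a (disk C a) g \<and>
        (\<forall>p\<in>disk C a. f a p $ i $ j * residue_entry D a j - residue_entry D a i * f a p $ i $ j = local_coord C a p * g p)" for i j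
    proof -
      have "holomorphic_fun C a (disk C a) (\<lambda>p. f a p $ i $ j * residue_entry D a j - residue_entry D a i * f a p $ i $ j)"
        using gauge_onD(1)[OF f a] by (auto intro!: holomorphic_fun_intros holomorphic_matD)
      then show ?thesis
        using c[OF True] holomorphic_fun_quotient[OF True] unfolding commutes_residue_def
        by (smt (verit, ccfv_threshold) eq_iff_diff_eq_0)
    qed
    then obtain g where g: "\<And>i j. holomorphic_fun C a (disk C a) (g i j)"
        "\<And>i j p. p \<in> disk C a \<Longrightarrow> f a p $ i $ j * residue_entry D a j - residue_entry D a i * f a p $ i $ j = local_coord C a p * g i j p"
      by metis
    show ?thesis
    proof (intro exI[of _ "\<lambda>p. \<chi> i j. g i j p"] conjI ballI impI)
      show "holomorphic_mat C a (disk C a) (\<lambda>p. \<chi> i j. g i j p)"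
        using g(1) by (simp add: holomorphic_mat_def)
      fix b p assume b: "b \<in> labels C" "b \<noteq> a" "p \<in> overlap C a b"
      then have z: "local_coord C a p \<noteq> 0" "p \<in> disk C a"
        using local_coord_overlap_nz[OF True] overlap_disk(1) by blast+
      show "f a p ** polar_part C D a p - polar_part C D a p ** f a p = (\<chi> i j. g i j p)"
        unfolding vec_eq_iff
      proof (intro allI)
        fix i j
        have "g i j p = (f a p $ i $ j * residue_entry D a j - residue_entry D a i * f a p $ i $ j) / local_coord C a p"
          using g(2)[OF z(2), of i j] z(1) by simp
        then show "(f a p ** polar_part C D a p - polar_part C D a p ** f a p) $ i $ j = (\<chi> i j. g i j p) $ i $ j"
          using True by (simp add: polar_part_mult mult_polar_part) (simp add: polar_part_def diff_divide_distrib)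
      qed
    qed
  next
    case False
    then have "polar_part C D a p = 0" for p by (simp add: polar_part_def vec_eq_iff)
    then show ?thesis
      by (intro exI[of _ "\<lambda>_. 0"]) (simp add: holomorphic_mat_const matrix_zero_left matrix_zero_right)
  qed
  then obtain G where G: "holomorphic_mat C a (disk C a) G"
      "\<And>b p. b \<in> labels C \<Longrightarrow> b \<noteq> a \<Longrightarrow> p \<in> overlap C a b \<Longrightarrow> f a p ** polar_part C D a p - polar_part C D a p ** f a p = G p"
    by blast
  show "\<exists>h'. holomorphic_mat C a (disk C a) h' \<and>
      (\<forall>b\<in>labels C. b \<noteq> a \<longrightarrow> (\<forall>p\<in>overlap C a b. fst (act f x) a b p = polar_part C D a p + h' p))"
  proof (intro exI[of _ "\<lambda>p. (G p + f a p ** h p) ** matrix_inv (f a p)"] conjI ballI impI)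
    show "holomorphic_mat C a (disk C a) (\<lambda>p. (G p + f a p ** h p) ** matrix_inv (f a p))"
      using G(1) h(1) gauge_onD[OF f a]
      by (intro holomorphic_mat_mult holomorphic_mat_add holomorphic_mat_inv a order_refl)
    fix b p assume b: "b \<in> labels C" "b \<noteq> a" "p \<in> overlap C a b"
    then have "invertible (f a p)"
      using gauge_onD(2)[OF f a] overlap_disk(1) by blast
    then have "polar_part C D a p = polar_part C D a p ** f a p ** matrix_inv (f a p)"
      by (metis matrix_inv_right matrix_mul_assoc matrix_mul_rid)
    then have "polar_part C D a p + (G p + f a p ** h p) ** matrix_inv (f a p) =
        (polar_part C D a p ** f a p + G p + f a p ** h p) ** matrix_inv (f a p)"
      by (metis add.assoc matrix_add_rdistrib)
    also have "polar_part C D a p ** f a p + G p = f a p ** polar_part C D a p"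
      using G(2)[OF b] by (metis add.commute diff_add_cancel)
    finally show "fst (act f x) a b p = polar_part C D a p + (G p + f a p ** h p) ** matrix_inv (f a p)"
      using h(2)[OF b] by (simp add: act_def matrix_add_ldistrib)
  qed
qed

lemma gauge_act_level:
  assumes f: "f \<in> gauge_on C D {}" and x: "x \<in> level_set C D d" and "\<alpha> \<in> marked C"
    and c: "\<And>a. a \<in> marked C \<Longrightarrow> commutes_residue D a (f a (mpoint C a))"
  shows "act f x \<in> level_set C D d"
proof -
  have fc: "frame_change C f" by (rule gauge_on_frame_change[OF f])
  have x': "is_bundle C (snd x)" "has_degree C (snd x) d" "is_higgs_field C x" "moment_condition C D x"
    using x by (simp_all add: level_set_def)
  have "has_degree C (snd (act f x)) (d + 0)"
    using gauge_onD[OF f] overlap_disk(1)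
    by (intro has_degree_act[OF \<open>\<alpha> \<in> marked C\<close> x'(2) fc, of "\<lambda>a p. det (f a p)"])
      (auto simp: holomorphic_fun_det invertible_det_nz)
  then show ?thesis
    using is_bundle_act[OF fc x'(1)] is_higgs_field_act[OF fc x'(1,3)] gauge_act_moment[OF f x'(4) c]
    by (simp add: level_set_def)
qed

text \<open>On the level set the parabolic condition is automatic: a gauge transformation between
  Higgs fields with the same residue commutes with it at the marked point. Frame computations can
  thus take place in \<open>gauge_on C D {}\<close>, which is closed under products and
  inverses.\<close>

lemma gauge_rel_iff:
  assumes "parabolic_data C D"
  shows "(x, y) \<in> gauge_rel C D d \<longleftrightarrow> x \<in> level_set C D d \<and> y \<in> level_set C D d \<and>
    (\<exists>f\<in>gauge_on C D {}. agree C y (act f x))"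
proof -
  have "f \<in> gauge_on C D (marked C)"
    if l: "x \<in> level_set C D d" "y \<in> level_set C D d" and f: "f \<in> gauge_on C D {}" "agree C y (act f x)" for f
  proof -
    have "f a (mpoint C a) \<in> parabolic_subgroup D a" if a: "a \<in> marked C" for a
    proof (rule commutes_residue_parabolic[OF assms a])
      show "invertible (f a (mpoint C a))"
        by (rule gauge_onD(2)[OF f(1) marked_label[OF a] mpoint_disk[OF a]])
      show "commutes_residue D a (f a (mpoint C a))"
        by (rule gauge_commutes[OF a f(1) _ _ f(2)]) (use l in \<open>simp_all add: level_set_def\<close>)
    qed
    then show ?thesis using f(1) by (simp add: gauge_on_def)
  qed
  moreover have "f \<in> gauge_on C D {}" if "f \<in> gauge_on C D (marked C)" for f
    using that gauge_on_mono by blast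
  ultimately show ?thesis unfolding gauge_rel_def by blast
qed

lemma equiv_gauge_rel:
  assumes "parabolic_data C D"
  shows "equiv (level_set C D d) (gauge_rel C D d)"
proof (rule equivI)
  show "refl_on (level_set C D d) (gauge_rel C D d)"
    by (rule refl_onI)
      (auto simp: gauge_rel_iff[OF assms] act_one agree_refl intro!: bexI[OF _ gauge_on_one])
  show "sym (gauge_rel C D d)"
  proof (rule symI)
    fix x y assume "(x, y) \<in> gauge_rel C D d"
    then obtain f where f: "f \<in> gauge_on C D {}" "agree C y (act f x)" and l: "x \<in> level_set C D d" "y \<in> level_set C D d"
      unfolding gauge_rel_iff[OF assms] by blast
    then show "(y, x) \<in> gauge_rel C D d"
      unfolding gauge_rel_iff[OF assms]
      using gauge_on_inv[OF f(1)] act_eq_imp_inv[OF gauge_on_frame_change[OF f(1)] f(2)] by blast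
  qed
  show "trans (gauge_rel C D d)"
  proof (rule transI)
    fix x y z assume "(x, y) \<in> gauge_rel C D d" "(y, z) \<in> gauge_rel C D d"
    then obtain f g where f: "f \<in> gauge_on C D {}" "agree C y (act f x)" and g: "g \<in> gauge_on C D {}" "agree C z (act g y)"
        and l: "x \<in> level_set C D d" "z \<in> level_set C D d"
      unfolding gauge_rel_iff[OF assms] by blast
    have "agree C z (act (\<lambda>a p. g a p ** f a p) x)"
      using agree_trans[OF g(2) agree_trans[OF act_cong[OF f(2)] act_act]] f(1) g(1) gauge_on_frame_change by blast
    then show "(x, z) \<in> gauge_rel C D d"
      unfolding gauge_rel_iff[OF assms] using l gauge_on_mult[OF g(1) f(1)] by blast
  qed
qed (auto simp: gauge_rel_def)

lemma phase_space_class: "x \<in> level_set C D d \<Longrightarrow> gauge_rel C D d `` {x} \<in> phase_space C D d"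
  by (simp add: phase_space_def quotientI)

lemma phase_spaceE:
  assumes "X \<in> phase_space C D d"
  obtains x where "x \<in> level_set C D d" "X = gauge_rel C D d `` {x}"
  using assms by (auto simp: phase_space_def elim: quotientE)

end

section \<open>Elementary modifications\<close>

definition elem_weight :: "bool \<Rightarrow> 'n \<Rightarrow> complex \<Rightarrow> 'n \<Rightarrow> complex" where
  "elem_weight up k z i = (if i = k then if up then z else inverse z else 1)"

definition elem_mod :: "bool \<Rightarrow> 'n::finite \<Rightarrow> complex \<Rightarrow> complex^'n^'n" where
  "elem_mod up k z = (\<chi> i j. if i = j then elem_weight up k z i else 0)"

text \<open>The positions at which conjugation by \<open>elem_mod up k z\<close> divides by \<open>z\<close>.\<close>

definition raised :: "bool \<Rightarrow> 'n \<Rightarrow> 'n \<Rightarrow> 'n \<Rightarrow> bool" where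
  "raised up k i j \<longleftrightarrow> i \<noteq> j \<and> (if up then j = k else i = k)"

text \<open>The nilpotent radical of the stabiliser of a hyperplane (for \<open>up\<close>) or of a
  line (otherwise). The correcting unipotent matrices have the form 1 + N with N in this
  space.\<close>

definition raising :: "bool \<Rightarrow> 'n \<Rightarrow> complex^'n^'n::finite \<Rightarrow> bool" where
  "raising up k N \<longleftrightarrow> (\<forall>i j. \<not> raised up k i j \<longrightarrow> N $ i $ j = 0)"

lemma elem_mod_nth: "elem_mod up k z $ i $ j = (if i = j then elem_weight up k z i else 0)"
  by (simp add: elem_mod_def)

lemma elem_mod_mult: "(elem_mod up k z ** A) $ i $ j = elem_weight up k z i * A $ i $ j"
  by (simp add: matrix_mul_nth elem_mod_def if_distrib[of "\<lambda>x. x * _"] cong: if_cong)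

lemma mult_elem_mod: "(A ** elem_mod up k z) $ i $ j = A $ i $ j * elem_weight up k z j"
proof -
  have "(A ** elem_mod up k z) $ i $ j = (\<Sum>l\<in>UNIV. if l = j then A $ i $ j * elem_weight up k z j else 0)"
    unfolding matrix_mul_nth by (rule sum.cong) (auto simp: elem_mod_def)
  then show ?thesis by simp
qed

lemma elem_mod_conj:
  assumes "z \<noteq> 0"
  shows "(elem_mod up k z ** A ** elem_mod (\<not> up) k z) $ i $ j =
    (if raised up k i j then A $ i $ j / z else if raised up k j i then z * A $ i $ j else A $ i $ j)"
  using assms by (auto simp: mult_elem_mod elem_mod_mult elem_weight_def raised_def divide_inverse)

lemma elem_mod_inverse:
  assumes "z \<noteq> 0"
  shows "elem_mod up k z ** elem_mod (\<not> up) k z = mat 1"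
  using assms by (auto simp: vec_eq_iff elem_mod_mult elem_mod_nth elem_weight_def mat_nth)

lemma invertible_elem_mod: "z \<noteq> 0 \<Longrightarrow> invertible (elem_mod up k z)"
  using elem_mod_inverse invertibleI by blast

lemma det_elem_mod: "det (elem_mod up k z) = (if up then z else inverse z)"
proof -
  have "det (elem_mod up k z) = (\<Prod>i\<in>UNIV. elem_weight up k z i)"
    by (subst det_diagonal) (auto simp: elem_mod_def)
  then show ?thesis by (simp add: elem_weight_def)
qed

text \<open>In each summand the inner index would have to be \<open>k\<close> for one factor and
  different from \<open>k\<close> for the other.\<close>

lemma raising_mult:
  assumes "raising up k M" "raising up k N"
  shows "M ** N = 0"
  unfolding vec_eq_iff
proof (intro allI)
  fix i j
  have "M $ i $ l * N $ l $ j = 0" for l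
    using assms by (cases up; cases "l = k"; cases "j = k") (auto simp: raising_def raised_def)
  then show "(M ** N) $ i $ j = 0 $ i $ j" unfolding matrix_mul_nth by (simp only: sum.neutral_const zero_index)
qed

lemma mat_mult_nth: "(mat z ** A) $ i $ j = z * A $ i $ j"
  by (simp add: matrix_mul_nth mat_nth if_distrib[of "\<lambda>x. x * _"] cong: if_cong)

lemma mult_mat_nth: "(A ** mat z) $ i $ j = A $ i $ j * z"
proof -
  have "(A ** mat z) $ i $ j = (\<Sum>l\<in>UNIV. if l = j then A $ i $ j * z else 0)"
    unfolding matrix_mul_nth by (rule sum.cong) (auto simp: mat_nth)
  then show ?thesis by simp
qed

lemma mat_mult_commute: "mat z ** A = A ** mat (z :: 'a::comm_ring_1)"
  by (simp add: vec_eq_iff mat_mult_nth mult_mat_nth mult.commute)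

text \<open>Conjugation with the opposite sign multiplies exactly the raised positions by z. This is
  the source of the factor z in the logarithmic derivative of the lift.\<close>

lemma elem_mod_raising:
  assumes "raising up k N" "z \<noteq> 0"
  shows "elem_mod (\<not> up) k z ** N ** elem_mod up k z = mat z ** N"
  unfolding vec_eq_iff mat_mult_nth
proof (intro allI)
  fix i j
  show "(elem_mod (\<not> up) k z ** N ** elem_mod up k z) $ i $ j = z * N $ i $ j"
    using elem_mod_conj[OF assms(2), of "\<not> up" k N i j] assms(1)
    by (auto simp: raising_def raised_def split: if_splits)
qed

lemma unipotent_inverse:
  assumes "raising up k N"
  shows "(mat 1 + N) ** (mat 1 - N) = mat 1" "(mat 1 - N) ** (mat 1 + N) = mat 1"
  using raising_mult[OF assms assms] by (simp_all add: matrix_algebra)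

lemma matrix_inv_unipotent_elem_mod:
  assumes "raising up k N" "z \<noteq> 0"
  shows "matrix_inv ((mat 1 + N) ** elem_mod up k z) = elem_mod (\<not> up) k z ** (mat 1 - N)"
proof (rule matrix_inv_eqI)
  have "(mat 1 + N) ** elem_mod up k z ** (elem_mod (\<not> up) k z ** (mat 1 - N)) =
      (mat 1 + N) ** (elem_mod up k z ** elem_mod (\<not> up) k z) ** (mat 1 - N)"
    by (simp add: matrix_mul_assoc)
  then show "(mat 1 + N) ** elem_mod up k z ** (elem_mod (\<not> up) k z ** (mat 1 - N)) = mat 1"
    by (simp add: elem_mod_inverse assms unipotent_inverse[OF assms(1)])
qed

section \<open>The lift of a Hecke correspondence to the level set\<close>

type_synonym 'n cmat = "((complex, 'n) vec, 'n) vec"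

text \<open>\<open>k\<close> is the index of the component that is multiplied or divided by
  z_\<alpha>: the first one for the upper correspondence, \<open>s (Max UNIV)\<close> for the lower
  one. By \<open>single\<close> it forms a block of its own, so its residue differs from all
  others.\<close>

locale hecke_point = riemann_surface C for C :: "('s::t2_space, 'i) curve" +
  fixes D :: "('i, 'n::{finite,linorder}) parabolic" and \<alpha> :: 'i and k :: 'n
  assumes D: "parabolic_data C D" and \<alpha>: "\<alpha> \<in> marked C"
    and single: "\<And>i. flag D \<alpha> i = flag D \<alpha> k \<Longrightarrow> i = k"
begin

lemmas \<alpha>_label = marked_label[OF \<alpha>]

abbreviation z\<alpha> :: "'s \<Rightarrow> complex" where "z\<alpha> \<equiv> local_coord C \<alpha>"

lemma residue_entry_distinct: "i \<noteq> k \<Longrightarrow> residue_entry D \<alpha> i \<noteq> residue_entry D \<alpha> k"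
  using D \<alpha> single[of i] unfolding parabolic_data_def by blast

lemma residue_entry_raised: "raised up k i j \<Longrightarrow> residue_entry D \<alpha> i \<noteq> residue_entry D \<alpha> j"
  using residue_entry_distinct[of i] residue_entry_distinct[of j] by (auto simp: raised_def split: if_splits)

lemma commutes_residue_raised:
  fixes A :: "'n cmat"
  assumes "commutes_residue D \<alpha> A" "raised up k i j"
  shows "A $ i $ j = 0" "A $ j $ i = 0"
  using assms(1) residue_entry_raised[OF assms(2)] unfolding commutes_residue_def
  by (metis mult.commute mult_cancel_left)+

text \<open>For \<open>i \<noteq> j\<close> this is the value at \<open>w_\<alpha>\<close> of the holomorphic part of the Higgs field.\<close>

definition hecke_coeff :: "('s, 'i, 'n) config \<Rightarrow> 'n \<Rightarrow> 'n \<Rightarrow> complex" where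
  "hecke_coeff x i j = (\<Sum>b\<in>set (nbrs C \<alpha>). edge_integral C \<alpha> b (\<lambda>p. fst x \<alpha> b p $ i $ j / z\<alpha> p)) /
     (2 * of_real pi * \<i>)"

definition hecke_nil :: "bool \<Rightarrow> ('s, 'i, 'n) config \<Rightarrow> 'n cmat" where
  "hecke_nil up x = (\<chi> i j. if raised up k i j
     then hecke_coeff x i j / (residue_entry D \<alpha> i - residue_entry D \<alpha> j) else 0)"

definition hecke_frame :: "bool \<Rightarrow> ('s, 'i, 'n) config \<Rightarrow> 'i \<Rightarrow> 's \<Rightarrow> 'n cmat" where
  "hecke_frame up x = at_label \<alpha> (\<lambda>p. (mat 1 + hecke_nil up x) ** elem_mod up k (z\<alpha> p))"

definition hecke_lift :: "bool \<Rightarrow> ('s, 'i, 'n) config \<Rightarrow> ('s, 'i, 'n) config" where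
  "hecke_lift up x = act (hecke_frame up x) x"

lemma raising_hecke_nil: "raising up k (hecke_nil up x)"
  by (simp add: raising_def hecke_nil_def)

lemma z\<alpha>_nz: "b \<in> labels C \<Longrightarrow> b \<noteq> \<alpha> \<Longrightarrow> p \<in> overlap C \<alpha> b \<Longrightarrow> z\<alpha> p \<noteq> 0"
  by (rule local_coord_overlap_nz[OF \<alpha>])

lemma momentE:
  assumes "moment_condition C D x"
  obtains h where "holomorphic_mat C \<alpha> (disk C \<alpha>) h"
    "\<And>b p. b \<in> labels C \<Longrightarrow> b \<noteq> \<alpha> \<Longrightarrow> p \<in> overlap C \<alpha> b \<Longrightarrow> fst x \<alpha> b p = polar_part C D \<alpha> p + h p"
  using assms \<alpha>_label unfolding moment_condition_def by blast

text \<open>The polar part is diagonal, so off the diagonal only \<open>h\<close> contributes, and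
  Cauchy's formula evaluates it. The definition of \<open>hecke_coeff\<close> does not mention
  \<open>h\<close>, which makes the lift an explicit function of \<open>x\<close>.\<close>

lemma hecke_coeff_eq:
  assumes "holomorphic_mat C \<alpha> (disk C \<alpha>) h"
    and "\<And>b p. b \<in> labels C \<Longrightarrow> b \<noteq> \<alpha> \<Longrightarrow> p \<in> overlap C \<alpha> b \<Longrightarrow> fst x \<alpha> b p = polar_part C D \<alpha> p + h p"
    and "i \<noteq> j"
  shows "hecke_coeff x i j = h (mpoint C \<alpha>) $ i $ j"
proof -
  have "edge_integral C \<alpha> b (\<lambda>p. fst x \<alpha> b p $ i $ j / z\<alpha> p) = edge_integral C \<alpha> b (\<lambda>p. h p $ i $ j / z\<alpha> p)"
    if "b \<in> set (nbrs C \<alpha>)" for b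
    by (rule edge_integral_cong[OF \<alpha>_label that])
      (use nbrsD[OF \<alpha>_label that] assms(2,3) in \<open>simp add: polar_part_def\<close>)
  then have "hecke_coeff x i j = (\<Sum>b\<in>set (nbrs C \<alpha>). edge_integral C \<alpha> b (\<lambda>p. h p $ i $ j / z\<alpha> p)) / (2 * of_real pi * \<i>)"
    by (simp add: hecke_coeff_def)
  then show ?thesis
    using sum_edge_integral_pole[OF \<alpha> holomorphic_matD[OF assms(1), of i j]] by simp
qed

lemma at_label_simps [simp]: "at_label \<alpha> \<phi> \<alpha> = \<phi>" "a \<noteq> \<alpha> \<Longrightarrow> at_label \<alpha> \<phi> a = (\<lambda>_. mat 1)"
  by (auto simp: at_label_def)

lemma frame_change_at_label:
  assumes "\<And>b. b \<in> labels C \<Longrightarrow> b \<noteq> \<alpha> \<Longrightarrow> holomorphic_mat C \<alpha> (overlap C \<alpha> b) \<phi>"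
    and "\<And>b p. b \<in> labels C \<Longrightarrow> b \<noteq> \<alpha> \<Longrightarrow> p \<in> overlap C \<alpha> b \<Longrightarrow> invertible (\<phi> p)"
  shows "frame_change C (at_label \<alpha> \<phi>)"
  unfolding frame_change_def
proof (intro ballI impI)
  fix a b assume "a \<in> labels C" "b \<in> labels C" "a \<noteq> b"
  then show "holomorphic_mat C a (overlap C a b) (at_label \<alpha> \<phi> a) \<and>
      (\<forall>p\<in>overlap C a b. invertible (at_label \<alpha> \<phi> a p))"
    using assms by (cases "a = \<alpha>") (simp_all add: holomorphic_mat_const invertible_mat_1)
qed

lemma gauge_at_label:
  assumes "holomorphic_mat C \<alpha> (disk C \<alpha>) \<phi>" "\<And>p. p \<in> disk C \<alpha> \<Longrightarrow> invertible (\<phi> p)"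
  shows "at_label \<alpha> \<phi> \<in> gauge_on C D {}"
proof -
  have "holomorphic_mat C a (disk C a) (at_label \<alpha> \<phi> a) \<and> (\<forall>p\<in>disk C a. invertible (at_label \<alpha> \<phi> a p))" for a
    using assms by (cases "a = \<alpha>") (simp_all add: holomorphic_mat_const invertible_mat_1)
  then show ?thesis by (simp add: gauge_on_def)
qed

lemma holomorphic_elem_mod:
  assumes "b \<in> labels C" "b \<noteq> \<alpha>"
  shows "holomorphic_mat C \<alpha> (overlap C \<alpha> b) (\<lambda>p. elem_mod up k (z\<alpha> p))"
proof -
  have z: "holomorphic_fun C \<alpha> (overlap C \<alpha> b) z\<alpha>"
    by (rule holomorphic_fun_local_coord[OF \<alpha>_label overlap_disk(1)])
  then have "holomorphic_fun C \<alpha> (overlap C \<alpha> b) (\<lambda>p. inverse (z\<alpha> p))"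
    using z\<alpha>_nz[OF assms] by (intro holomorphic_fun_inverse \<alpha>_label overlap_disk(1))
  then have "holomorphic_fun C \<alpha> (overlap C \<alpha> b) (\<lambda>p. if i = j then elem_weight up k (z\<alpha> p) i else 0)" for i j
    using z unfolding elem_weight_def
    by (cases "i = j"; cases "i = k"; cases up) (simp_all add: holomorphic_fun_const)
  then show ?thesis by (simp add: holomorphic_mat_def elem_mod_def)
qed

lemma frame_change_elem_mod: "frame_change C (at_label \<alpha> (\<lambda>p. elem_mod up k (z\<alpha> p)))"
  by (rule frame_change_at_label) (simp_all add: holomorphic_elem_mod invertible_elem_mod z\<alpha>_nz)

lemma invertible_unipotent: "invertible (mat 1 + hecke_nil up x)"
  using unipotent_inverse(1)[OF raising_hecke_nil] invertibleI by blast

lemma frame_change_hecke_frame: "frame_change C (hecke_frame up x)"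
  unfolding hecke_frame_def
  by (rule frame_change_at_label)
    (simp_all add: holomorphic_mat_mult holomorphic_mat_const holomorphic_elem_mod invertible_mult
      invertible_unipotent invertible_elem_mod z\<alpha>_nz)

text \<open>Write P = p/z. The elementary modification turns P + h into P + c/z + h' with c raising.
  The choice of N means [p, N] = c, and N c = 0, so (1 + N)(P + c/z) = P (1 + N): conjugation by 1 +
  N removes c/z and keeps P.\<close>

lemma hecke_lift_moment:
  assumes "moment_condition C D x"
  shows "moment_condition C D (hecke_lift up x)"
  unfolding moment_condition_def
proof (intro ballI)
  fix a assume a: "a \<in> labels C"
  show "\<exists>h'. holomorphic_mat C a (disk C a) h' \<and>
    (\<forall>b\<in>labels C. b \<noteq> a \<longrightarrow> (\<forall>p\<in>overlap C a b. fst (hecke_lift up x) a b p = polar_part C D a p + h' p))"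
  proof (cases "a = \<alpha>")
    case False
    then show ?thesis
      using assms a by (simp add: moment_condition_def hecke_lift_def hecke_frame_def act_def matrix_inv_mat_1)
  next
    case True
    obtain h where h: "holomorphic_mat C \<alpha> (disk C \<alpha>) h"
        "\<And>b p. b \<in> labels C \<Longrightarrow> b \<noteq> \<alpha> \<Longrightarrow> p \<in> overlap C \<alpha> b \<Longrightarrow> fst x \<alpha> b p = polar_part C D \<alpha> p + h p"
      using momentE[OF assms] by metis
    let ?N = "hecke_nil up x"
    define c where "c = (\<chi> i j. if raised up k i j then h (mpoint C \<alpha>) $ i $ j else 0)"
    have N: "raising up k ?N" by (rule raising_hecke_nil)
    have c: "raising up k c" by (simp add: raising_def c_def)
    have Nc: "c $ i $ j = (residue_entry D \<alpha> i - residue_entry D \<alpha> j) * ?N $ i $ j" for i j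
    proof (cases "raised up k i j")
      case True
      then have "hecke_coeff x i j = h (mpoint C \<alpha>) $ i $ j"
        using h by (intro hecke_coeff_eq) (simp_all add: raised_def)
      then show ?thesis
        using residue_entry_raised[OF True] True by (simp add: c_def hecke_nil_def)
    qed (simp add: c_def hecke_nil_def)
    have "\<exists>g. holomorphic_fun C \<alpha> (disk C \<alpha>) g \<and>
        (\<forall>p\<in>disk C \<alpha>. h p $ i $ j - h (mpoint C \<alpha>) $ i $ j = z\<alpha> p * g p)" for i j
    proof -
      have "holomorphic_fun C \<alpha> (disk C \<alpha>) (\<lambda>p. h p $ i $ j - h (mpoint C \<alpha>) $ i $ j)"
        using h(1) by (intro holomorphic_fun_diff holomorphic_fun_const holomorphic_matD)
      then show ?thesis
        using holomorphic_fun_quotient[OF \<alpha>, of "\<lambda>p. h p $ i $ j - h (mpoint C \<alpha>) $ i $ j"]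
        by (metis (no_types, lifting) diff_self)
    qed
    then obtain g where g: "\<And>i j. holomorphic_fun C \<alpha> (disk C \<alpha>) (g i j)"
        "\<And>i j p. p \<in> disk C \<alpha> \<Longrightarrow> h p $ i $ j - h (mpoint C \<alpha>) $ i $ j = z\<alpha> p * g i j p"
      by metis
    \<comment> \<open>At raised positions h/z splits into its polar term, which goes into
      \<open>c\<close>, and the difference quotient \<open>g\<close>; at the transposed positions
      the conjugation contributes a factor z.\<close>
    define h' where "h' p = (\<chi> i j. if raised up k i j then g i j p else
        if raised up k j i then z\<alpha> p * h p $ i $ j else h p $ i $ j)" for p
    have "holomorphic_fun C \<alpha> (disk C \<alpha>) (\<lambda>p. if raised up k i j then g i j p else
        if raised up k j i then z\<alpha> p * h p $ i $ j else h p $ i $ j)" for i j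
      using g(1)[of i j] holomorphic_matD[OF h(1), of i j] holomorphic_fun_local_coord[OF \<alpha>_label order_refl]
      by (cases "raised up k i j"; cases "raised up k j i") (simp_all add: holomorphic_fun_mult)
    then have h'_hol: "holomorphic_mat C \<alpha> (disk C \<alpha>) h'"
      by (simp add: holomorphic_mat_def h'_def)
    show ?thesis unfolding True
    proof (intro exI[of _ "\<lambda>p. (mat 1 + ?N) ** h' p ** (mat 1 - ?N)"] conjI ballI impI)
      show "holomorphic_mat C \<alpha> (disk C \<alpha>) (\<lambda>p. (mat 1 + ?N) ** h' p ** (mat 1 - ?N))"
        by (intro holomorphic_mat_mult holomorphic_mat_const h'_hol)
      fix b p assume b: "b \<in> labels C" "b \<noteq> \<alpha>" and p: "p \<in> overlap C \<alpha> b"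
      have z: "z\<alpha> p \<noteq> 0" "p \<in> disk C \<alpha>" using z\<alpha>_nz[OF b p] p by (simp_all add: overlap_def)
      let ?P = "polar_part C D \<alpha> p" and ?E = "elem_mod up k (z\<alpha> p)" and ?E' = "elem_mod (\<not> up) k (z\<alpha> p)"
      have 1: "?E ** fst x \<alpha> b p ** ?E' = ?P + mat (inverse (z\<alpha> p)) ** c + h' p"
        unfolding vec_eq_iff
      proof (intro allI)
        fix i j
        have "raised up k i j \<Longrightarrow> h p $ i $ j / z\<alpha> p = inverse (z\<alpha> p) * h (mpoint C \<alpha>) $ i $ j + g i j p"
          using g(2)[OF z(2), of i j] z(1) by (simp add: field_simps)
        then show "(?E ** fst x \<alpha> b p ** ?E') $ i $ j = (?P + mat (inverse (z\<alpha> p)) ** c + h' p) $ i $ j"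
          unfolding elem_mod_conj[OF z(1)] h(2)[OF b p]
          by (auto simp: mat_mult_nth c_def h'_def polar_part_def raised_def)
      qed
      have 2: "?N ** ?P + mat (inverse (z\<alpha> p)) ** c = ?P ** ?N"
        unfolding vec_eq_iff using Nc \<alpha> z(1)
        by (simp add: polar_part_mult mult_polar_part mat_mult_nth) (simp add: polar_part_def field_simps)
      have 3: "?N ** (mat (inverse (z\<alpha> p)) ** c) = 0"
        by (metis mat_mult_commute matrix_mul_assoc matrix_zero_left raising_mult[OF N c])
      have "(mat 1 + ?N) ** (?E ** fst x \<alpha> b p ** ?E') =
          ?P + (?N ** ?P + mat (inverse (z\<alpha> p)) ** c) + ?N ** (mat (inverse (z\<alpha> p)) ** c) + (mat 1 + ?N) ** h' p"
        unfolding 1 by (simp add: matrix_add_ldistrib matrix_add_rdistrib)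
      also have "\<dots> = ?P ** (mat 1 + ?N) + (mat 1 + ?N) ** h' p"
        unfolding 2 3 by (simp add: matrix_add_ldistrib)
      finally have 5: "(mat 1 + ?N) ** (?E ** fst x \<alpha> b p ** ?E') = ?P ** (mat 1 + ?N) + (mat 1 + ?N) ** h' p" .
      have 4: "(mat 1 + ?N) ** (?E ** fst x \<alpha> b p ** ?E') ** (mat 1 - ?N) =
          ?P ** ((mat 1 + ?N) ** (mat 1 - ?N)) + (mat 1 + ?N) ** h' p ** (mat 1 - ?N)"
        unfolding 5 matrix_add_rdistrib[of "?P ** (mat 1 + ?N)"] matrix_mul_assoc[of ?P] ..
      have "fst (hecke_lift up x) \<alpha> b p = (mat 1 + ?N) ** (?E ** fst x \<alpha> b p ** ?E') ** (mat 1 - ?N)"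
        by (simp add: hecke_lift_def hecke_frame_def act_def matrix_inv_unipotent_elem_mod[OF N z(1)] matrix_mul_assoc)
      then show "fst (hecke_lift up x) \<alpha> b p = ?P + (mat 1 + ?N) ** h' p ** (mat 1 - ?N)"
        unfolding 4 unipotent_inverse[OF N] by simp
    qed
  qed
qed

text \<open>At \<alpha> the determinant of the frame is a nonzero constant times z_\<alpha> or its
  inverse, which shifts the degree by 1 or -1.\<close>

lemma hecke_lift_level:
  assumes "x \<in> level_set C D d" "d' = d + (if up then 1 else - 1)"
  shows "hecke_lift up x \<in> level_set C D d'"
proof -
  have x: "is_bundle C (snd x)" "has_degree C (snd x) d" "is_higgs_field C x" "moment_condition C D x"
    using assms(1) by (simp_all add: level_set_def)
  note fc = frame_change_hecke_frame[of up x]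
  have "has_degree C (snd (act (hecke_frame up x) x)) (d + (if up then 1 else - 1))"
    by (rule has_degree_act[OF \<alpha> x(2) fc, of "\<lambda>a p. if a = \<alpha> then det (mat 1 + hecke_nil up x) else 1"])
      (use invertible_unipotent in \<open>auto simp: holomorphic_fun_const invertible_det_nz hecke_frame_def det_mul
        det_elem_mod power_int_minus\<close>)
  then show ?thesis
    using is_bundle_act[OF fc x(1)] is_higgs_field_act[OF fc x(1,3)] hecke_lift_moment[OF x(4), of up]
    by (simp add: level_set_def hecke_lift_def assms(2))
qed

section \<open>The Hecke correspondence on gauge classes\<close>

text \<open>
  A gauge transformation between points of the level set is block diagonal at \<open>w_\<alpha>\<close>, therefore its
  conjugate by the elementary modification is again holomorphic and invertible there.
\<close>

lemma elem_mod_conj_gauge: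
  assumes g: "g \<in> gauge_on C D {}" and c: "commutes_residue D \<alpha> (g \<alpha> (mpoint C \<alpha>))"
  obtains g' where "g' \<in> gauge_on C D {}"
    "\<And>x. agree C (act (at_label \<alpha> (\<lambda>p. elem_mod up k (z\<alpha> p))) (act g x))
      (act g' (act (at_label \<alpha> (\<lambda>p. elem_mod up k (z\<alpha> p))) x))"
proof -
  note g\<alpha> = gauge_onD[OF g \<alpha>_label]
  \<comment> \<open>Commutation with the residue makes the raised entries vanish at the marked
    point, so they are divisible by the coordinate.\<close>
  have "\<exists>q. holomorphic_fun C \<alpha> (disk C \<alpha>) q \<and> (raised up k i j \<longrightarrow> (\<forall>p\<in>disk C \<alpha>. g \<alpha> p $ i $ j = z\<alpha> p * q p))" for i j
  proof (cases "raised up k i j")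
    case True
    then show ?thesis
      using holomorphic_fun_quotient[OF \<alpha> holomorphic_matD[OF g\<alpha>(1)] commutes_residue_raised(1)[OF c True]] by metis
  qed (auto intro: holomorphic_fun_const)
  then obtain q where q: "\<And>i j. holomorphic_fun C \<alpha> (disk C \<alpha>) (q i j)"
      "\<And>i j p. raised up k i j \<Longrightarrow> p \<in> disk C \<alpha> \<Longrightarrow> g \<alpha> p $ i $ j = z\<alpha> p * q i j p"
    by metis
  define G where "G p = (\<chi> i j. if raised up k i j then q i j p else
        if raised up k j i then z\<alpha> p * g \<alpha> p $ i $ j else g \<alpha> p $ i $ j)" for p
  have "holomorphic_fun C \<alpha> (disk C \<alpha>) (\<lambda>p. if raised up k i j then q i j p else
        if raised up k j i then z\<alpha> p * g \<alpha> p $ i $ j else g \<alpha> p $ i $ j)" for i j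
    using q(1)[of i j] holomorphic_matD[OF g\<alpha>(1), of i j] holomorphic_fun_local_coord[OF \<alpha>_label order_refl]
    by (cases "raised up k i j"; cases "raised up k j i") (simp_all add: holomorphic_fun_mult)
  then have G_hol: "holomorphic_mat C \<alpha> (disk C \<alpha>) G"
    by (simp add: holomorphic_mat_def G_def)
  have G_eq: "G p = elem_mod up k (z\<alpha> p) ** g \<alpha> p ** elem_mod (\<not> up) k (z\<alpha> p)"
    if "b \<in> labels C" "b \<noteq> \<alpha>" "p \<in> overlap C \<alpha> b" for b p
  proof -
    have "z\<alpha> p \<noteq> 0" "p \<in> disk C \<alpha>" using z\<alpha>_nz[OF that] that(3) by (simp_all add: overlap_def)
    then show ?thesis
      using q(2)[of _ _ p] by (simp add: vec_eq_iff elem_mod_conj G_def)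
  qed
  \<comment> \<open>The description of \<open>G\<close> as a conjugate holds on the overlaps only.
    The equality of determinants extends to the disk and gives invertibility at the marked point as
    well.\<close>
  have det: "det (G p) = det (g \<alpha> p)" if "p \<in> disk C \<alpha>" for p
  proof (rule holomorphic_fun_eq_on_disk[OF \<alpha>_label _ _ _ that])
    show "holomorphic_fun C \<alpha> (disk C \<alpha>) (\<lambda>p. det (G p))" "holomorphic_fun C \<alpha> (disk C \<alpha>) (\<lambda>p. det (g \<alpha> p))"
      by (intro holomorphic_fun_det G_hol g\<alpha>(1))+
    fix b p assume *: "b \<in> labels C" "b \<noteq> \<alpha>" "p \<in> overlap C \<alpha> b"
    then show "det (G p) = det (g \<alpha> p)"
      using z\<alpha>_nz[OF *] by (cases up) (simp_all add: G_eq det_mul det_elem_mod)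
  qed
  define g' where "g' a = (if a = \<alpha> then G else g a)" for a
  have "holomorphic_mat C a (disk C a) (g' a) \<and> (\<forall>p\<in>disk C a. invertible (g' a p))" if "a \<in> labels C" for a
    using gauge_onD[OF g that] g\<alpha> det G_hol by (cases "a = \<alpha>") (simp_all add: g'_def invertible_det_nz)
  then have g': "g' \<in> gauge_on C D {}" by (simp add: gauge_on_def)
  let ?e = "at_label \<alpha> (\<lambda>p. elem_mod up k (z\<alpha> p))"
  have eq: "?e a p ** g a p = g' a p ** ?e a p" if "a \<in> labels C" "b \<in> labels C" "a \<noteq> b" "p \<in> overlap C a b" for a b p
  proof (cases "a = \<alpha>")
    case True
    then have "z\<alpha> p \<noteq> 0" using z\<alpha>_nz that by blast
    then have "elem_mod (\<not> up) k (z\<alpha> p) ** elem_mod up k (z\<alpha> p) = mat 1"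
      using elem_mod_inverse[of "z\<alpha> p" "\<not> up" k] by simp
    then show ?thesis
      using G_eq[of b p] that True by (simp add: g'_def flip: matrix_mul_assoc)
  qed (simp add: g'_def)
  have "agree C (act ?e (act g x)) (act g' (act ?e x))" for x
    using agree_trans[OF act_act[OF frame_change_elem_mod gauge_on_frame_change[OF g]]
        agree_trans[OF act_frame_cong[OF eq] agree_sym[OF act_act[OF gauge_on_frame_change[OF g'] frame_change_elem_mod]]]] .
  then show thesis using that g' by blast
qed

lemma hecke_lift_eq_act:
  "agree C (hecke_lift up x) (act (at_label \<alpha> (\<lambda>_. mat 1 + hecke_nil up x))
    (act (at_label \<alpha> (\<lambda>p. elem_mod up k (z\<alpha> p))) x))"
proof -
  have "frame_change C (at_label \<alpha> (\<lambda>_. mat 1 + hecke_nil up x))"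
    by (rule frame_change_at_label) (simp_all add: holomorphic_mat_const invertible_unipotent)
  moreover have "hecke_frame up x = (\<lambda>a p. at_label \<alpha> (\<lambda>_. mat 1 + hecke_nil up x) a p **
      at_label \<alpha> (\<lambda>p. elem_mod up k (z\<alpha> p)) a p)"
    by (auto simp: hecke_frame_def at_label_def fun_eq_iff)
  ultimately show ?thesis
    using agree_sym[OF act_act[OF _ frame_change_elem_mod]] by (simp add: hecke_lift_def)
qed

lemma unipotent_gauge: "at_label \<alpha> (\<lambda>_. mat 1 + hecke_nil up x) \<in> gauge_on C D {}"
  by (rule gauge_at_label) (simp_all add: holomorphic_mat_const invertible_unipotent)

text \<open>At a marked point other than w_\<alpha> the singular frame is trivial, so
  \<open>f\<close> relates two Higgs fields with the same residue there and must be
  parabolic.\<close>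

lemma gauge_parabolic_away:
  assumes f: "f \<in> gauge_on C D {}" and x: "x \<in> level_set C D d" and y: "y \<in> level_set C D d'"
    and eq: "agree C y (act f (act (at_label \<alpha> \<phi>) x))"
  shows "f \<in> gauge_on C D (marked C - {\<alpha>})"
proof -
  have "f a (mpoint C a) \<in> parabolic_subgroup D a" if "a \<in> marked C - {\<alpha>}" for a
  proof (rule commutes_residue_parabolic[OF D])
    show a: "a \<in> marked C" using that by blast
    note lab = marked_label[OF a]
    show "invertible (f a (mpoint C a))" by (rule gauge_onD(2)[OF f lab mpoint_disk[OF a]])
    show "commutes_residue D a (f a (mpoint C a))"
    proof (rule commutes_at_mpoint[OF a gauge_onD(1)[OF f lab], of _ x y])
      fix b p assume b: "b \<in> labels C" "b \<noteq> a" "p \<in> overlap C a b"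
      then have "fst y a b p = f a p ** fst x a b p ** matrix_inv (f a p)"
        using eq lab that by (simp add: agree_def act_def matrix_inv_mat_1)
      moreover have "invertible (f a p)"
        using gauge_onD(2)[OF f lab] b(3) by (simp add: overlap_def)
      ultimately show "fst y a b p ** f a p = f a p ** fst x a b p"
        by (metis matrix_inv_left matrix_mul_assoc matrix_mul_rid)
    qed (use x y in \<open>simp_all add: level_set_def\<close>)
  qed
  then show ?thesis using f by (simp add: gauge_on_def)
qed

text \<open>In the definition of \<open>hecke\<close> the frame is unrestricted at w_\<alpha>, so it
  can absorb the constant matrix \<open>P\<close> as well as the unipotent correction. A gauge
  change of the representative passes through the elementary modification and becomes a gauge change
  of the image. The image is thus a single class, that of the explicit lift.\<close>

theorem hecke_class:
  assumes x: "x \<in> level_set C D d" and d': "d' = d + (if up then 1 else - 1)" and P: "invertible P"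
  shows "hecke C D d' \<alpha> (\<lambda>z. P ** elem_mod up k z) (gauge_rel C D d `` {x}) = gauge_rel C D d' `` {hecke_lift up x}"
proof -
  let ?e = "at_label \<alpha> (\<lambda>p. elem_mod up k (z\<alpha> p))" and ?u = "at_label \<alpha> (\<lambda>_. mat 1 + hecke_nil up x)"
    and ?P = "at_label \<alpha> (\<lambda>_. P)"
  note Hx = hecke_lift_level[OF x d']
  have Pg: "?P \<in> gauge_on C D {}"
    by (rule gauge_at_label) (simp_all add: holomorphic_mat_const P)
  note fce = frame_change_elem_mod[of up]
  have Pe: "agree C (act (at_label \<alpha> (\<lambda>p. P ** elem_mod up k (z\<alpha> p))) x') (act ?P (act ?e x'))" for x'
  proof -
    have "at_label \<alpha> (\<lambda>p. P ** elem_mod up k (z\<alpha> p)) = (\<lambda>a p. ?P a p ** ?e a p)"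
      by (auto simp: at_label_def fun_eq_iff)
    then show ?thesis
      using agree_sym[OF act_act[OF gauge_on_frame_change[OF Pg] fce]] by simp
  qed
  show ?thesis
  proof (intro equalityI subsetI)
    fix y assume "y \<in> hecke C D d' \<alpha> (\<lambda>z. P ** elem_mod up k z) (gauge_rel C D d `` {x})"
    then obtain x' f where y: "y \<in> level_set C D d'" and x': "(x, x') \<in> gauge_rel C D d"
      and f: "f \<in> gauge_on C D (marked C - {\<alpha>})"
      and eq: "agree C y (act f (act (at_label \<alpha> (\<lambda>p. P ** elem_mod up k (z\<alpha> p))) x'))"
      unfolding hecke_def by blast
    obtain g where g: "g \<in> gauge_on C D {}" "agree C x' (act g x)" and x'l: "x' \<in> level_set C D d"
      using x' unfolding gauge_rel_iff[OF D] by blast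
    \<comment> \<open>Representatives of one class differ by a gauge transformation that commutes
      with the residue; this is what lets it pass through the elementary modification.\<close>
    have "commutes_residue D \<alpha> (g \<alpha> (mpoint C \<alpha>))"
      by (rule gauge_commutes[OF \<alpha> g(1) _ _ g(2)]) (use x x'l in \<open>simp_all add: level_set_def\<close>)
    then obtain g' where g': "g' \<in> gauge_on C D {}" "agree C (act ?e (act g x)) (act g' (act ?e x))"
      using elem_mod_conj_gauge[OF g(1), of up] by metis
    have f0: "f \<in> gauge_on C D {}" using gauge_on_mono[OF f] by simp
    note ui = gauge_on_inv[OF unipotent_gauge[of up x]]
    have "agree C (act ?e x) (act (\<lambda>a p. matrix_inv (?u a p)) (hecke_lift up x))"
      by (rule act_eq_imp_inv[OF gauge_on_frame_change[OF unipotent_gauge] hecke_lift_eq_act])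
    from act_cong[OF this, of g'] have "agree C (act g' (act ?e x)) (act g' (act (\<lambda>a p. matrix_inv (?u a p)) (hecke_lift up x)))" .
    from agree_trans[OF this act_act[OF gauge_on_frame_change[OF g'(1)] gauge_on_frame_change[OF ui]]]
    have "agree C (act ?e x') (act (\<lambda>a p. g' a p ** matrix_inv (?u a p)) (hecke_lift up x))"
      using agree_trans[OF act_cong[OF g(2)] agree_trans[OF g'(2)]] by blast
    from agree_trans[OF act_cong[OF this] act_act[OF gauge_on_frame_change[OF Pg] gauge_on_frame_change[OF gauge_on_mult[OF g'(1) ui]]]]
    have "agree C (act ?P (act ?e x')) (act (\<lambda>a p. ?P a p ** (g' a p ** matrix_inv (?u a p))) (hecke_lift up x))" .
    from act_cong[OF agree_trans[OF Pe this], of f] have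
      "agree C y (act f (act (\<lambda>a p. ?P a p ** (g' a p ** matrix_inv (?u a p))) (hecke_lift up x)))"
      using agree_trans[OF eq] by blast
    from agree_trans[OF this act_act[OF gauge_on_frame_change[OF f0] gauge_on_frame_change[OF gauge_on_mult[OF Pg gauge_on_mult[OF g'(1) ui]]]]]
    have "agree C y (act (\<lambda>a p. f a p ** (?P a p ** (g' a p ** matrix_inv (?u a p)))) (hecke_lift up x))" .
    moreover have "(\<lambda>a p. f a p ** (?P a p ** (g' a p ** matrix_inv (?u a p)))) \<in> gauge_on C D {}"
      by (intro gauge_on_mult f0 Pg g'(1) ui)
    ultimately show "y \<in> gauge_rel C D d' `` {hecke_lift up x}"
      using Hx y gauge_rel_iff[OF D] by blast
  next
    fix y assume "y \<in> gauge_rel C D d' `` {hecke_lift up x}"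
    then obtain g where y: "y \<in> level_set C D d'" and g: "g \<in> gauge_on C D {}" "agree C y (act g (hecke_lift up x))"
      unfolding Image_singleton_iff gauge_rel_iff[OF D] by blast
    note Pi = gauge_on_inv[OF Pg]
    let ?v = "\<lambda>a p. ?u a p ** matrix_inv (?P a p)" and ?Pe = "at_label \<alpha> (\<lambda>p. P ** elem_mod up k (z\<alpha> p))"
    have v: "?v \<in> gauge_on C D {}" by (rule gauge_on_mult[OF unipotent_gauge Pi])
    have "agree C (act ?e x) (act (\<lambda>a p. matrix_inv (?P a p)) (act ?Pe x))"
      by (rule act_eq_imp_inv[OF gauge_on_frame_change[OF Pg] Pe])
    from agree_trans[OF act_cong[OF this] act_act[OF gauge_on_frame_change[OF unipotent_gauge] gauge_on_frame_change[OF Pi]]]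
    have "agree C (hecke_lift up x) (act ?v (act ?Pe x))"
      using agree_trans[OF hecke_lift_eq_act] by blast
    from agree_trans[OF act_cong[OF this] act_act[OF gauge_on_frame_change[OF g(1)] gauge_on_frame_change[OF v]]]
    have 1: "agree C y (act (\<lambda>a p. g a p ** ?v a p) (act ?Pe x))"
      using agree_trans[OF g(2)] by blast
    \<comment> \<open>The frame found is automatically parabolic at the remaining marked
      points.\<close>
    moreover have "(\<lambda>a p. g a p ** ?v a p) \<in> gauge_on C D (marked C - {\<alpha>})"
      by (rule gauge_parabolic_away[OF gauge_on_mult[OF g(1) v] x y 1])
    moreover have "(x, x) \<in> gauge_rel C D d"
      using equiv_class_self[OF equiv_gauge_rel[OF D] x] by simp
    ultimately show "y \<in> hecke C D d' \<alpha> (\<lambda>z. P ** elem_mod up k z) (gauge_rel C D d `` {x})"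
      unfolding hecke_def using y by blast
  qed
qed

text \<open>Moving 1 + N back through the elementary modification gives 1 + z N, so the composite
  frame (1 + N')(1 + z N) has no singularity. Its explicit form is recorded because the transport of
  Hamilton's equation compares frames at a point.\<close>

lemma hecke_lift_lift:
  obtains V where "holomorphic_mat C \<alpha> (disk C \<alpha>) V" "\<And>p. p \<in> disk C \<alpha> \<Longrightarrow> invertible (V p)"
    "agree C (hecke_lift (\<not> up) (hecke_lift up x)) (act (at_label \<alpha> V) x)"
    "\<And>p. V p = (mat 1 + hecke_nil (\<not> up) (hecke_lift up x)) ** (mat 1 + mat (z\<alpha> p) ** hecke_nil up x)"
proof -
  let ?N = "hecke_nil up x" and ?N' = "hecke_nil (\<not> up) (hecke_lift up x)"
  let ?V = "\<lambda>p. (mat 1 + ?N') ** (mat 1 + mat (z\<alpha> p) ** ?N)"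
  have zN: "holomorphic_mat C \<alpha> (disk C \<alpha>) (\<lambda>p. mat (z\<alpha> p) ** ?N)"
    unfolding holomorphic_mat_def mat_mult_nth
    by (intro allI holomorphic_fun_mult holomorphic_fun_const holomorphic_fun_local_coord \<alpha>_label order_refl)
  have 1: "holomorphic_mat C \<alpha> (disk C \<alpha>) ?V"
    by (rule holomorphic_mat_mult[OF holomorphic_mat_const holomorphic_mat_add[OF holomorphic_mat_const zN]])
  have "raising up k (mat z ** ?N)" for z
    using raising_hecke_nil[of up x] by (simp add: raising_def mat_mult_nth)
  then have "invertible (mat 1 + mat z ** ?N)" for z
    using unipotent_inverse(1) invertibleI by blast
  then have 2: "invertible (?V p)" for p
    by (intro invertible_mult invertible_unipotent)
  have eq: "hecke_frame (\<not> up) (hecke_lift up x) a p ** hecke_frame up x a p = at_label \<alpha> ?V a p"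
    if "a \<in> labels C" "b \<in> labels C" "a \<noteq> b" "p \<in> overlap C a b" for a b p
  proof (cases "a = \<alpha>")
    case True
    then have z: "z\<alpha> p \<noteq> 0" using that z\<alpha>_nz by blast
    have "elem_mod (\<not> up) k (z\<alpha> p) ** ((mat 1 + ?N) ** elem_mod up k (z\<alpha> p)) = mat 1 + mat (z\<alpha> p) ** ?N"
      using elem_mod_raising[OF raising_hecke_nil z] elem_mod_inverse[OF z, of "\<not> up"]
      by (simp add: matrix_algebra)
    then show ?thesis
      using True by (simp add: hecke_frame_def flip: matrix_mul_assoc)
  qed (simp add: hecke_frame_def)
  have 3: "agree C (hecke_lift (\<not> up) (hecke_lift up x)) (act (at_label \<alpha> ?V) x)"
    using agree_trans[OF act_act[OF frame_change_hecke_frame frame_change_hecke_frame] act_frame_cong[OF eq]]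
    by (simp add: hecke_lift_def)
  show thesis by (rule that[OF 1 2 3]) simp
qed

lemma hecke_lift_lift_rel:
  assumes "x \<in> level_set C D d"
  shows "(x, hecke_lift (\<not> up) (hecke_lift up x)) \<in> gauge_rel C D d"
proof -
  have "hecke_lift (\<not> up) (hecke_lift up x) \<in> level_set C D d"
    by (rule hecke_lift_level[OF hecke_lift_level[OF assms refl]]) simp
  then show ?thesis
    using hecke_lift_lift[of up x] gauge_at_label assms unfolding gauge_rel_iff[OF D] by metis
qed

end

section \<open>Velocities of holomorphic curves of configurations\<close>

definition has_mat_deriv :: "(complex \<Rightarrow> complex^'n^'n) \<Rightarrow> complex^'n^'n \<Rightarrow> complex \<Rightarrow> bool" where
  "has_mat_deriv F F' t \<longleftrightarrow> (\<forall>i j. ((\<lambda>s. F s $ i $ j) has_field_derivative F' $ i $ j) (at t))"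

lemma has_mat_deriv_const: "has_mat_deriv (\<lambda>_. A) 0 t"
  by (simp add: has_mat_deriv_def)

lemma has_mat_deriv_add:
  "has_mat_deriv F F' t \<Longrightarrow> has_mat_deriv G G' t \<Longrightarrow> has_mat_deriv (\<lambda>s. F s + G s) (F' + G') t"
  by (simp add: has_mat_deriv_def DERIV_add)

lemma has_mat_deriv_diff:
  "has_mat_deriv F F' t \<Longrightarrow> has_mat_deriv G G' t \<Longrightarrow> has_mat_deriv (\<lambda>s. F s - G s) (F' - G') t"
  by (simp add: has_mat_deriv_def DERIV_diff)

lemma has_mat_deriv_mult:
  assumes "has_mat_deriv F F' t" "has_mat_deriv G G' t"
  shows "has_mat_deriv (\<lambda>s. F s ** G s) (F' ** G t + F t ** G') t"
  unfolding has_mat_deriv_def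
proof (intro allI)
  fix i j
  have "((\<lambda>s. \<Sum>l\<in>UNIV. F s $ i $ l * G s $ l $ j) has_field_derivative
      (\<Sum>l\<in>UNIV. F' $ i $ l * G t $ l $ j + F t $ i $ l * G' $ l $ j)) (at t)"
    by (intro DERIV_sum) (use assms in \<open>auto simp: has_mat_deriv_def intro!: derivative_eq_intros\<close>)
  then show "((\<lambda>s. (F s ** G s) $ i $ j) has_field_derivative (F' ** G t + F t ** G') $ i $ j) (at t)"
    by (simp add: matrix_mul_nth sum.distrib)
qed

lemma has_mat_deriv_mult_left: "has_mat_deriv G G' t \<Longrightarrow> has_mat_deriv (\<lambda>s. A ** G s) (A ** G') t"
  using has_mat_deriv_mult[OF has_mat_deriv_const] by (force simp: matrix_zero_left)

lemma has_mat_deriv_mult_right: "has_mat_deriv F F' t \<Longrightarrow> has_mat_deriv (\<lambda>s. F s ** A) (F' ** A) t"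
  using has_mat_deriv_mult[OF _ has_mat_deriv_const] by (force simp: matrix_zero_right)

lemma has_mat_deriv_unique:
  assumes "has_mat_deriv F F' t" "has_mat_deriv F F'' t"
  shows "F' = F''"
  using assms unfolding has_mat_deriv_def vec_eq_iff by (metis DERIV_unique)

lemma has_mat_deriv_cong:
  assumes "open S" "t \<in> S" "\<And>s. s \<in> S \<Longrightarrow> F s = G s" "has_mat_deriv F F' t"
  shows "has_mat_deriv G F' t"
  unfolding has_mat_deriv_def
proof (intro allI)
  fix i j
  show "((\<lambda>s. G s $ i $ j) has_field_derivative F' $ i $ j) (at t)"
    by (rule has_field_derivative_transform_within_open[of "\<lambda>s. F s $ i $ j", OF _ assms(1,2)])
      (use assms(3,4) in \<open>simp_all add: has_mat_deriv_def\<close>)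
qed

lemma has_mat_deriv_imp: "has_mat_deriv F F' t \<Longrightarrow> (\<chi> i j. deriv (\<lambda>s. F s $ i $ j) t) = F'"
  by (simp add: has_mat_deriv_def vec_eq_iff DERIV_imp_deriv)

definition velocity :: "(complex \<Rightarrow> ('s, 'i, 'n::finite) config) \<Rightarrow> complex \<Rightarrow> ('s, 'i, 'n) config" where
  "velocity X t =
     (\<lambda>a b p. \<chi> i j. deriv (\<lambda>s. fst (X s) a b p $ i $ j) t,
      \<lambda>a b p. \<chi> i j. deriv (\<lambda>s. snd (X s) a b p $ i $ j) t)"

lemma velocity_eqI:
  "has_mat_deriv (\<lambda>s. fst (X s) a b p) A t \<Longrightarrow> fst (velocity X t) a b p = A"
  "has_mat_deriv (\<lambda>s. snd (X s) a b p) A t \<Longrightarrow> snd (velocity X t) a b p = A"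
  by (simp_all add: velocity_def has_mat_deriv_imp)

text \<open>One-parameter counterpart of \<open>family_in_level\<close>, with a subset of the
  complex line as parameter set. Two-parameter families, families in the times and test curves are
  all restricted to it, one coordinate at a time.\<close>

definition level_curve ::
    "('s::topological_space, 'i) curve \<Rightarrow> ('i, 'n::finite) parabolic \<Rightarrow> int \<Rightarrow> complex set \<Rightarrow>
     (complex \<Rightarrow> ('s, 'i, 'n) config) \<Rightarrow> bool" where
  "level_curve C D d S X \<longleftrightarrow> open S \<and> (\<forall>t\<in>S. X t \<in> level_set C D d) \<and>
     (\<forall>a\<in>labels C. \<forall>b\<in>labels C. a \<noteq> b \<longrightarrow>
       continuous_on (S \<times> overlap C a b) (\<lambda>(t, p). fst (X t) a b p) \<and>
       continuous_on (S \<times> overlap C a b) (\<lambda>(t, p). snd (X t) a b p) \<and>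
       (\<forall>p\<in>overlap C a b. \<forall>i j. (\<lambda>t. fst (X t) a b p $ i $ j) holomorphic_on S \<and>
         (\<lambda>t. snd (X t) a b p $ i $ j) holomorphic_on S))"

lemma continuous_on_fun_upd: "continuous_on A (\<lambda>t. \<tau>(m := t))" for \<tau> :: "'m \<Rightarrow> complex"
proof (rule continuous_on_coordinatewise_then_product)
  show "continuous_on A (\<lambda>t. (\<tau>(m := t)) i)" for i
    by (cases "i = m") auto
qed

lemma level_curve_of_family:
  fixes x :: "('m \<Rightarrow> complex) \<Rightarrow> ('s::topological_space, 'i, 'n::finite) config"
  assumes "family_in_level C D d T x" "\<tau> \<in> T"
  shows "level_curve C D d {t. \<tau>(m := t) \<in> T} (\<lambda>t. x (\<tau>(m := t)))"
proof -
  let ?S = "{t. \<tau>(m := t) \<in> T}"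
  have fam: "open T" "holomorphic_family C T x" "\<And>\<tau>. \<tau> \<in> T \<Longrightarrow> x \<tau> \<in> level_set C D d"
    using assms(1) by (simp_all add: family_in_level_def)
  have S: "open ?S"
    using continuous_open_vimage[OF fam(1), of "\<lambda>t. \<tau>(m := t)"] continuous_on_fun_upd[of UNIV \<tau> m]
    by (simp add: continuous_on_eq_continuous_at vimage_def)
  have c: "continuous_on (?S \<times> V) (\<lambda>(t, p). F (\<tau>(m := t)) p)"
    if "continuous_on (T \<times> V) (\<lambda>(\<tau>, p). F \<tau> p)" for V and F :: "('m \<Rightarrow> complex) \<Rightarrow> 's \<Rightarrow> complex^'n^'n"
    unfolding split_beta
    by (intro continuous_on_uncurry[OF that] continuous_on_compose2[OF continuous_on_fun_upd[of UNIV]] continuous_on_fst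
        continuous_on_snd continuous_on_id) auto
  show ?thesis
    unfolding level_curve_def
  proof (intro conjI ballI impI allI)
    fix a b assume ab: "a \<in> labels C" "b \<in> labels C" "a \<noteq> b"
    show "continuous_on (?S \<times> overlap C a b) (\<lambda>(t, p). fst (x (\<tau>(m := t))) a b p)"
      "continuous_on (?S \<times> overlap C a b) (\<lambda>(t, p). snd (x (\<tau>(m := t))) a b p)"
      using fam(2) ab by (auto simp: holomorphic_family_def intro!: c)
    fix p i j assume "p \<in> overlap C a b"
    then show "(\<lambda>t. fst (x (\<tau>(m := t))) a b p $ i $ j) holomorphic_on ?S"
      "(\<lambda>t. snd (x (\<tau>(m := t))) a b p $ i $ j) holomorphic_on ?S"
      using fam(2) ab assms(2) by (simp_all add: holomorphic_family_def)
  qed (use S fam(3) in auto)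
qed

lemma pderiv_family_velocity: "pderiv_family m x \<tau> = velocity (\<lambda>t. x (\<tau>(m := t))) (\<tau> m)"
  by (simp add: pderiv_family_def velocity_def)

lemma symplectic_form_density:
  "symplectic_form C x u v = (\<Sum>(a, b)\<in>edges C. edge_integral C a b (\<lambda>p.
     symp_density (fst x a b p) (fst u a b p) (fst v a b p)
       (snd u a b p ** matrix_inv (snd x a b p)) (snd v a b p ** matrix_inv (snd x a b p))))"
  by (simp add: symplectic_form_def symp_density_def Let_def)

lemma symp_density_scale:
  fixes E :: "complex^'n^'n"
  shows "symp_density (mat c ** E) (mat c ** u) (mat c ** v) U V = c * symp_density E u v U V"
proof -
  have "trace (mat c ** X) = c * trace X" for X :: "complex^'n^'n"
    by (simp add: trace_def mat_mult_nth sum_distrib_left)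
  then show ?thesis
    by (simp add: symp_density_def algebra_simps flip: matrix_mul_assoc)
qed

context riemann_surface
begin

lemma level_curveD:
  fixes X :: "complex \<Rightarrow> ('s, 'i, 'n::finite) config"
  assumes "level_curve C D d S X" "a \<in> labels C" "b \<in> labels C" "a \<noteq> b"
  shows "continuous_on (S \<times> overlap C a b) (\<lambda>(t, p). fst (X t) a b p $ i $ j)"
    "continuous_on (S \<times> overlap C a b) (\<lambda>(t, p). snd (X t) a b p $ i $ j)"
    "p \<in> overlap C a b \<Longrightarrow> (\<lambda>t. fst (X t) a b p $ i $ j) holomorphic_on S"
    "p \<in> overlap C a b \<Longrightarrow> (\<lambda>t. snd (X t) a b p $ i $ j) holomorphic_on S"
    "t \<in> S \<Longrightarrow> holomorphic_fun C a (overlap C a b) (\<lambda>p. fst (X t) a b p $ i $ j)"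
    "t \<in> S \<Longrightarrow> holomorphic_fun C a (overlap C a b) (\<lambda>p. snd (X t) a b p $ i $ j)"
proof -
  have c: "continuous_on (S \<times> overlap C a b) (\<lambda>(t, p). fst (X t) a b p)"
      "continuous_on (S \<times> overlap C a b) (\<lambda>(t, p). snd (X t) a b p)"
    using assms by (simp_all add: level_curve_def)
  show "continuous_on (S \<times> overlap C a b) (\<lambda>(t, p). fst (X t) a b p $ i $ j)"
    "continuous_on (S \<times> overlap C a b) (\<lambda>(t, p). snd (X t) a b p $ i $ j)"
    using c by (auto simp: split_beta intro!: continuous_intros)
  show "p \<in> overlap C a b \<Longrightarrow> (\<lambda>t. fst (X t) a b p $ i $ j) holomorphic_on S"
    "p \<in> overlap C a b \<Longrightarrow> (\<lambda>t. snd (X t) a b p $ i $ j) holomorphic_on S"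
    using assms by (simp_all add: level_curve_def)
  assume "t \<in> S"
  then have "X t \<in> level_set C D d" using assms(1) by (simp add: level_curve_def)
  then have "is_bundle C (snd (X t))" "is_higgs_field C (X t)"
    by (simp_all add: level_set_def)
  then show "holomorphic_fun C a (overlap C a b) (\<lambda>p. fst (X t) a b p $ i $ j)"
    "holomorphic_fun C a (overlap C a b) (\<lambda>p. snd (X t) a b p $ i $ j)"
    using assms(2-4) by (simp_all add: is_bundle_def is_higgs_field_def holomorphic_mat_def)
qed

lemma level_curve_open: "level_curve C D d S X \<Longrightarrow> open S"
  and level_curve_level: "level_curve C D d S X \<Longrightarrow> t \<in> S \<Longrightarrow> X t \<in> level_set C D d"
  by (simp_all add: level_curve_def)

lemma velocity_has_mat_deriv:
  fixes X :: "complex \<Rightarrow> ('s, 'i, 'n::finite) config"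
  assumes "level_curve C D d S X" "a \<in> labels C" "b \<in> labels C" "a \<noteq> b" "t \<in> S" "p \<in> overlap C a b"
  shows "has_mat_deriv (\<lambda>s. fst (X s) a b p) (fst (velocity X t) a b p) t"
    "has_mat_deriv (\<lambda>s. snd (X s) a b p) (snd (velocity X t) a b p) t"
  using level_curveD(3,4)[OF assms(1-4,6)] holomorphic_derivI[OF _ level_curve_open[OF assms(1)] assms(5)]
  by (simp_all add: has_mat_deriv_def velocity_def)

lemma velocity_holomorphic:
  fixes X :: "complex \<Rightarrow> ('s, 'i, 'n::finite) config"
  assumes "level_curve C D d S X" "a \<in> labels C" "b \<in> labels C" "a \<noteq> b" "t \<in> S"
  shows "holomorphic_mat C a (overlap C a b) (fst (velocity X t) a b)"
    "holomorphic_mat C a (overlap C a b) (snd (velocity X t) a b)"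
  unfolding holomorphic_mat_def velocity_def fst_conv snd_conv vec_lambda_beta
  using level_curveD[OF assms(1-4)] level_curve_open[OF assms(1)] assms(2-5)
  by (intro allI holomorphic_fun_deriv_param; blast)+

text \<open>An infinitesimal moment condition. The polar part of the Higgs field does not move along
  the curve, and by Cauchy's theorem the holomorphic part contributes nothing to the sum over the
  edges; so the sum is constant in the parameter and its derivative vanishes.\<close>

lemma velocity_moment:
  fixes X :: "complex \<Rightarrow> ('s, 'i, 'n::finite) config"
  assumes X: "level_curve C D d S X" and a: "a \<in> labels C" and t: "t \<in> S" and q: "holomorphic_fun C a (disk C a) q"
  shows "(\<Sum>b\<in>set (nbrs C a). edge_integral C a b (\<lambda>p. fst (velocity X t) a b p $ i $ j * q p)) = 0"
proof -
  let ?F = "\<lambda>b s p. fst (X s) a b p $ i $ j * q p"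
  have q': "holomorphic_fun C a (overlap C a b) q" for b
    by (rule holomorphic_fun_subset[OF q overlap_disk(1)])
  have D: "((\<lambda>s. edge_integral C a b (?F b s)) has_field_derivative
      edge_integral C a b (\<lambda>p. fst (velocity X t) a b p $ i $ j * q p)) (at t)" if b: "b \<in> set (nbrs C a)" for b
  proof -
    note n = nbrsD(1,2)[OF a b]
    note l = level_curveD[OF X a n(1) n(2)[symmetric], where i = i and j = j]
    have "continuous_on (overlap C a b) q"
      by (rule holomorphic_fun_continuous[OF a overlap_disk(1) q'])
    then have "continuous_on (S \<times> overlap C a b) (\<lambda>x. q (snd x))"
      by (rule continuous_on_compose2) (auto intro: continuous_intros)
    then have c: "continuous_on (S \<times> overlap C a b) (\<lambda>(s, p). ?F b s p)"
      using l(1) unfolding split_beta by (intro continuous_on_mult)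
    have "((\<lambda>s. edge_integral C a b (?F b s)) has_field_derivative
        edge_integral C a b (\<lambda>p. deriv (\<lambda>s. ?F b s p) t)) (at t)"
      by (rule has_field_derivative_edge_integral[OF a b level_curve_open[OF X] c _ _ t])
        (use l(3,5) q' in \<open>auto intro!: holomorphic_intros holomorphic_fun_mult\<close>)
    also have "edge_integral C a b (\<lambda>p. deriv (\<lambda>s. ?F b s p) t) =
        edge_integral C a b (\<lambda>p. fst (velocity X t) a b p $ i $ j * q p)"
    proof (rule edge_integral_cong[OF a b])
      fix p assume "p \<in> overlap C a b"
      then have "((\<lambda>s. fst (X s) a b p $ i $ j) has_field_derivative fst (velocity X t) a b p $ i $ j) (at t)"
        using velocity_has_mat_deriv(1)[OF X a n(1) n(2)[symmetric] t] by (simp add: has_mat_deriv_def)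
      then show "deriv (\<lambda>s. ?F b s p) t = fst (velocity X t) a b p $ i $ j * q p"
        by (intro DERIV_imp_deriv DERIV_cmult_right)
    qed
    finally show ?thesis .
  qed
  \<comment> \<open>The constant value of the sum, computed from the polar part alone.\<close>
  define c where "c = (\<Sum>b\<in>set (nbrs C a). edge_integral C a b (\<lambda>p. polar_part C D a p $ i $ j * q p))"
  have const: "(\<Sum>b\<in>set (nbrs C a). edge_integral C a b (?F b s)) = c" if "s \<in> S" for s
  proof -
    have "moment_condition C D (X s)"
      using level_curve_level[OF X that] by (simp add: level_set_def)
    then obtain h where h: "holomorphic_mat C a (disk C a) h"
        "\<And>b p. b \<in> labels C \<Longrightarrow> b \<noteq> a \<Longrightarrow> p \<in> overlap C a b \<Longrightarrow> fst (X s) a b p = polar_part C D a p + h p"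
      using a unfolding moment_condition_def by blast
    have hq: "holomorphic_fun C a (disk C a) (\<lambda>p. h p $ i $ j * q p)"
      by (intro holomorphic_fun_mult holomorphic_matD h(1) q)
    have "edge_integral C a b (\<lambda>p. polar_part C D a p $ i $ j * q p) =
        edge_integral C a b (?F b s) - edge_integral C a b (\<lambda>p. h p $ i $ j * q p)" if b: "b \<in> set (nbrs C a)" for b
    proof -
      note n = nbrsD(1,2)[OF a b]
      have "edge_integral C a b (\<lambda>p. polar_part C D a p $ i $ j * q p) =
          edge_integral C a b (\<lambda>p. ?F b s p - h p $ i $ j * q p)"
        by (rule edge_integral_cong[OF a b]) (simp add: h(2)[OF n] algebra_simps)
      also have "\<dots> = edge_integral C a b (?F b s) - edge_integral C a b (\<lambda>p. h p $ i $ j * q p)"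
        by (intro edge_integral_diff a b holomorphic_fun_mult[OF level_curveD(5)[OF X a n(1) n(2)[symmetric] \<open>s \<in> S\<close>] q']
            holomorphic_fun_subset[OF hq overlap_disk(1)])
      finally show ?thesis .
    qed
    then show ?thesis
      using sum_edge_integral_holomorphic[OF a hq] by (simp add: c_def sum_subtractf)
  qed
  have "((\<lambda>s. \<Sum>b\<in>set (nbrs C a). edge_integral C a b (?F b s)) has_field_derivative
      (\<Sum>b\<in>set (nbrs C a). edge_integral C a b (\<lambda>p. fst (velocity X t) a b p $ i $ j * q p))) (at t)"
    by (intro DERIV_sum D)
  then have "((\<lambda>_. c) has_field_derivative
      (\<Sum>b\<in>set (nbrs C a). edge_integral C a b (\<lambda>p. fst (velocity X t) a b p $ i $ j * q p))) (at t)"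
    by (rule has_field_derivative_transform_within_open[OF _ level_curve_open[OF X] t]) (rule const)
  then show ?thesis
    using DERIV_const DERIV_unique by blast
qed

lemma velocity_trace_moment:
  fixes X :: "complex \<Rightarrow> ('s, 'i, 'n::finite) config"
  assumes X: "level_curve C D d S X" and a: "a \<in> labels C" and t: "t \<in> S" and \<theta>: "holomorphic_mat C a (disk C a) \<theta>"
  shows "(\<Sum>b\<in>set (nbrs C a). edge_integral C a b (\<lambda>p. trace (fst (velocity X t) a b p ** \<theta> p))) = 0"
proof -
  have "edge_integral C a b (\<lambda>p. trace (fst (velocity X t) a b p ** \<theta> p)) =
      (\<Sum>i\<in>UNIV. \<Sum>j\<in>UNIV. edge_integral C a b (\<lambda>p. fst (velocity X t) a b p $ i $ j * \<theta> p $ j $ i))"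
    if b: "b \<in> set (nbrs C a)" for b
  proof -
    note n = nbrsD(1,2)[OF a b]
    have h: "holomorphic_fun C a (overlap C a b) (\<lambda>p. fst (velocity X t) a b p $ i $ j * \<theta> p $ j $ i)" for i j
      by (intro holomorphic_fun_mult holomorphic_matD velocity_holomorphic(1)[OF X a n(1) n(2)[symmetric] t]
          holomorphic_mat_subset[OF \<theta> overlap_disk(1)])
    show ?thesis
      unfolding trace_mult_nth
      by (subst edge_integral_sum[OF a b]; (subst edge_integral_sum[OF a b])?) (auto intro!: holomorphic_fun_sum h)
  qed
  then have "(\<Sum>b\<in>set (nbrs C a). edge_integral C a b (\<lambda>p. trace (fst (velocity X t) a b p ** \<theta> p))) =
    (\<Sum>b\<in>set (nbrs C a). \<Sum>i\<in>UNIV. \<Sum>j\<in>UNIV. edge_integral C a b (\<lambda>p. fst (velocity X t) a b p $ i $ j * \<theta> p $ j $ i))"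
    by simp
  also have "\<dots> = (\<Sum>i\<in>UNIV. \<Sum>j\<in>UNIV. \<Sum>b\<in>set (nbrs C a). edge_integral C a b (\<lambda>p. fst (velocity X t) a b p $ i $ j * \<theta> p $ j $ i))"
    by (subst sum.swap, rule sum.cong[OF refl], rule sum.swap)
  also have "\<dots> = 0"
    using velocity_moment[OF X a t holomorphic_matD[OF \<theta>]] by simp
  finally show ?thesis .
qed

lemma symp_density_holomorphic:
  fixes X\<^sub>1 X\<^sub>2 :: "complex \<Rightarrow> ('s, 'i, 'n::finite) config"
  assumes X1: "level_curve C D d S\<^sub>1 X\<^sub>1" and X2: "level_curve C D d S\<^sub>2 X\<^sub>2" and t: "t\<^sub>1 \<in> S\<^sub>1" "t\<^sub>2 \<in> S\<^sub>2"
    and ab: "a \<in> labels C" "b \<in> labels C" "a \<noteq> b" and x: "x \<in> level_set C D d"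
  shows "holomorphic_fun C a (overlap C a b) (\<lambda>p. symp_density (fst x a b p) (fst (velocity X\<^sub>1 t\<^sub>1) a b p)
    (fst (velocity X\<^sub>2 t\<^sub>2) a b p) (snd (velocity X\<^sub>1 t\<^sub>1) a b p ** matrix_inv (snd x a b p))
    (snd (velocity X\<^sub>2 t\<^sub>2) a b p ** matrix_inv (snd x a b p)))"
proof -
  have "holomorphic_mat C a (overlap C a b) (fst x a b)" "holomorphic_mat C a (overlap C a b) (snd x a b)"
    "\<And>p. p \<in> overlap C a b \<Longrightarrow> invertible (snd x a b p)"
    using x ab by (simp_all add: level_set_def is_bundle_def is_higgs_field_def)
  then show ?thesis
    unfolding symp_density_def
    by (intro holomorphic_fun_add holomorphic_fun_diff holomorphic_fun_trace holomorphic_mat_mult holomorphic_mat_diff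
        holomorphic_mat_inv velocity_holomorphic[OF X1 ab t(1)] velocity_holomorphic[OF X2 ab t(2)] ab(1) overlap_disk(1))
qed

end

section \<open>Invariance of the symplectic form under singular frame changes\<close>

context hecke_point
begin

text \<open>
  One factor of \<open>z_\<alpha>\<close> in \<open>\<theta>\<^sub>1\<close> cancels the pole of the Higgs field in \<open>tr (\<eta> [\<theta>\<^sub>1, \<theta>\<^sub>2])\<close>, so
  that the sum of the integrals over the boundary of the face vanishes by Cauchy's theorem.
\<close>

lemma symp_defect_integral:
  fixes M :: "'n cmat"
  assumes X1: "level_curve C D d S\<^sub>1 X\<^sub>1" and X2: "level_curve C D d S\<^sub>2 X\<^sub>2" and t: "t\<^sub>1 \<in> S\<^sub>1" "t\<^sub>2 \<in> S\<^sub>2"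
    and x: "x \<in> level_set C D d" and \<theta>2: "holomorphic_mat C \<alpha> (disk C \<alpha>) \<theta>\<^sub>2"
  defines "Q \<equiv> \<lambda>b p. symp_defect (fst x \<alpha> b p) (fst (velocity X\<^sub>1 t\<^sub>1) \<alpha> b p) (fst (velocity X\<^sub>2 t\<^sub>2) \<alpha> b p)
    (mat (z\<alpha> p) ** M) (\<theta>\<^sub>2 p)"
  shows "(\<Sum>b\<in>set (nbrs C \<alpha>). edge_integral C \<alpha> b (Q b)) = 0"
    and "b \<in> labels C \<Longrightarrow> b \<noteq> \<alpha> \<Longrightarrow> holomorphic_fun C \<alpha> (overlap C \<alpha> b) (Q b)"
proof -
  obtain h where h: "holomorphic_mat C \<alpha> (disk C \<alpha>) h"
      "\<And>b p. b \<in> labels C \<Longrightarrow> b \<noteq> \<alpha> \<Longrightarrow> p \<in> overlap C \<alpha> b \<Longrightarrow> fst x \<alpha> b p = polar_part C D \<alpha> p + h p"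
    using x momentE[of x] unfolding level_set_def by blast
  \<comment> \<open>The residue matrix: z times the Higgs field extends over the marked point with
    value \<open>R\<close>.\<close>
  define R where "R = (\<chi> i j. if i = j then residue_entry D \<alpha> i else 0)"
  let ?\<theta> = "\<lambda>p. mat (z\<alpha> p) ** M"
  let ?r = "\<lambda>p. trace ((R + mat (z\<alpha> p) ** h p) ** (M ** \<theta>\<^sub>2 p - \<theta>\<^sub>2 p ** M))"
  have zF: "holomorphic_mat C \<alpha> (disk C \<alpha>) (\<lambda>p. mat (z\<alpha> p) ** F p)" if "holomorphic_mat C \<alpha> (disk C \<alpha>) F" for F :: "'s \<Rightarrow> 'n cmat"
    unfolding holomorphic_mat_def mat_mult_nth
    by (intro allI holomorphic_fun_mult holomorphic_matD[OF that] holomorphic_fun_local_coord \<alpha>_label order_refl)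
  have \<theta>1: "holomorphic_mat C \<alpha> (disk C \<alpha>) ?\<theta>" by (rule zF[OF holomorphic_mat_const])
  have r: "holomorphic_fun C \<alpha> (disk C \<alpha>) ?r"
    by (rule holomorphic_fun_trace, rule holomorphic_mat_mult, rule holomorphic_mat_add[OF holomorphic_mat_const zF[OF h(1)]],
        rule holomorphic_mat_diff[OF holomorphic_mat_mult[OF holomorphic_mat_const \<theta>2] holomorphic_mat_mult[OF \<theta>2 holomorphic_mat_const]])
  have Q: "Q b p = trace (fst (velocity X\<^sub>1 t\<^sub>1) \<alpha> b p ** \<theta>\<^sub>2 p) - trace (fst (velocity X\<^sub>2 t\<^sub>2) \<alpha> b p ** ?\<theta> p) - ?r p"
    if "b \<in> labels C" "b \<noteq> \<alpha>" "p \<in> overlap C \<alpha> b" for b p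
  proof -
    have "mat (z\<alpha> p) ** polar_part C D \<alpha> p = R"
      using z\<alpha>_nz[OF that] \<alpha> by (simp add: vec_eq_iff mat_mult_nth polar_part_def R_def)
    then have "mat (z\<alpha> p) ** fst x \<alpha> b p = R + mat (z\<alpha> p) ** h p"
      by (simp only: h(2)[OF that] matrix_add_ldistrib)
    then have eta: "fst x \<alpha> b p ** mat (z\<alpha> p) = R + mat (z\<alpha> p) ** h p"
      by (simp only: mat_mult_commute)
    have "\<theta>\<^sub>2 p ** ?\<theta> p = mat (z\<alpha> p) ** (\<theta>\<^sub>2 p ** M)"
      by (simp only: matrix_mul_assoc mat_mult_commute[of "z\<alpha> p" "\<theta>\<^sub>2 p"])
    then have "?\<theta> p ** \<theta>\<^sub>2 p - \<theta>\<^sub>2 p ** ?\<theta> p = mat (z\<alpha> p) ** (M ** \<theta>\<^sub>2 p - \<theta>\<^sub>2 p ** M)"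
      by (simp only: matrix_diff_ldistrib matrix_mul_assoc)
    then have "fst x \<alpha> b p ** (?\<theta> p ** \<theta>\<^sub>2 p - \<theta>\<^sub>2 p ** ?\<theta> p) = (R + mat (z\<alpha> p) ** h p) ** (M ** \<theta>\<^sub>2 p - \<theta>\<^sub>2 p ** M)"
      by (simp add: matrix_mul_assoc eta)
    then show ?thesis by (simp add: Q_def symp_defect_def)
  qed
  have hol: "holomorphic_fun C \<alpha> (overlap C \<alpha> b) (\<lambda>p. trace (fst (velocity X\<^sub>1 t\<^sub>1) \<alpha> b p ** \<theta>\<^sub>2 p))"
      "holomorphic_fun C \<alpha> (overlap C \<alpha> b) (\<lambda>p. trace (fst (velocity X\<^sub>2 t\<^sub>2) \<alpha> b p ** ?\<theta> p))"
      "holomorphic_fun C \<alpha> (overlap C \<alpha> b) ?r" if "b \<in> labels C" "b \<noteq> \<alpha>" for b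
    using velocity_holomorphic(1)[OF X1 \<alpha>_label that(1) that(2)[symmetric] t(1)]
      velocity_holomorphic(1)[OF X2 \<alpha>_label that(1) that(2)[symmetric] t(2)]
      holomorphic_mat_subset[OF \<theta>2 overlap_disk(1)] holomorphic_mat_subset[OF \<theta>1 overlap_disk(1)]
      holomorphic_fun_subset[OF r overlap_disk(1)]
    by (simp_all add: holomorphic_fun_trace holomorphic_mat_mult)
  show "holomorphic_fun C \<alpha> (overlap C \<alpha> b) (Q b)" if "b \<in> labels C" "b \<noteq> \<alpha>" for b
    by (rule holomorphic_fun_cong[OF \<alpha>_label overlap_disk(1) Q[OF that, symmetric]])
      (use hol[OF that] in \<open>simp_all add: holomorphic_fun_diff\<close>)
  have "edge_integral C \<alpha> b (Q b) = edge_integral C \<alpha> b (\<lambda>p. trace (fst (velocity X\<^sub>1 t\<^sub>1) \<alpha> b p ** \<theta>\<^sub>2 p)) -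
      edge_integral C \<alpha> b (\<lambda>p. trace (fst (velocity X\<^sub>2 t\<^sub>2) \<alpha> b p ** ?\<theta> p)) - edge_integral C \<alpha> b ?r"
    if b: "b \<in> set (nbrs C \<alpha>)" for b
  proof -
    note n = nbrsD(1,2)[OF \<alpha>_label b]
    have "edge_integral C \<alpha> b (Q b) = edge_integral C \<alpha> b (\<lambda>p. trace (fst (velocity X\<^sub>1 t\<^sub>1) \<alpha> b p ** \<theta>\<^sub>2 p) -
        trace (fst (velocity X\<^sub>2 t\<^sub>2) \<alpha> b p ** ?\<theta> p) - ?r p)"
      by (rule edge_integral_cong[OF \<alpha>_label b]) (rule Q[OF n])
    then show ?thesis
      using hol[OF n] by (simp add: edge_integral_diff[OF \<alpha>_label b] holomorphic_fun_diff)
  qed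
  then show "(\<Sum>b\<in>set (nbrs C \<alpha>). edge_integral C \<alpha> b (Q b)) = 0"
    using velocity_trace_moment[OF X1 \<alpha>_label t(1) \<theta>2] velocity_trace_moment[OF X2 \<alpha>_label t(2) \<theta>1]
      sum_edge_integral_holomorphic[OF \<alpha>_label r]
    by (simp add: sum_subtractf)
qed

end

context riemann_surface
begin

text \<open>The compatibility relation between the two ends of an edge is differentiated. The
  inverse of g_ab enters as g_ba, which is itself holomorphic in the parameter; the derivative of
  g_ab g_ba = 1 then eliminates its velocity.\<close>

lemma higgs_velocity:
  fixes X :: "complex \<Rightarrow> ('s, 'i, 'n::finite) config"
  assumes X: "level_curve C D d S X" and ab: "a \<in> labels C" "b \<in> labels C" "a \<noteq> b" and t: "t \<in> S" and p: "p \<in> overlap C a b"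
  defines "g \<equiv> snd (X t) a b p"
  defines "E \<equiv> g ** fst (X t) b a p ** matrix_inv g" and "U \<equiv> snd (velocity X t) a b p ** matrix_inv g"
  shows "fst (X t) a b p = mat (transition_deriv C a b p) ** E"
    and "fst (velocity X t) a b p = mat (transition_deriv C a b p) **
      (g ** fst (velocity X t) b a p ** matrix_inv g + U ** E - E ** U)"
proof -
  let ?c = "mat (transition_deriv C a b p) :: complex^'n^'n"
  let ?g = "\<lambda>s. snd (X s) a b p" and ?k = "\<lambda>s. snd (X s) b a p"
  let ?g' = "snd (velocity X t) a b p" and ?k' = "snd (velocity X t) b a p"
  note S = level_curve_open[OF X]
  have lev: "invertible (?g s)" "?g s ** ?k s = mat 1" "fst (X s) a b p = ?c ** (?g s ** fst (X s) b a p ** ?k s)"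
    if "s \<in> S" for s
  proof -
    have l: "is_bundle C (snd (X s))" "is_higgs_field C (X s)"
      using level_curve_level[OF X that] by (simp_all add: level_set_def)
    show 1: "invertible (?g s)" "?g s ** ?k s = mat 1"
      using l(1) ab p by (simp_all add: is_bundle_def)
    show "fst (X s) a b p = ?c ** (?g s ** fst (X s) b a p ** ?k s)"
      using l(2) ab p unfolding is_higgs_field_def vec_eq_iff mat_mult_nth matrix_inv_eqI[OF 1(2), symmetric] by blast
  qed
  have k: "?k t = matrix_inv g"
    unfolding g_def by (rule matrix_inv_eqI[OF lev(2)[OF t], symmetric])
  show "fst (X t) a b p = ?c ** E"
    using lev(3)[OF t] by (simp only: k E_def g_def)
  have p': "p \<in> overlap C b a" using p by (simp add: overlap_commute)
  note D = velocity_has_mat_deriv[OF X ab t p] velocity_has_mat_deriv[OF X ab(2,1) ab(3)[symmetric] t p']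
  have "has_mat_deriv (\<lambda>s. ?g s ** ?k s) (?g' ** ?k t + ?g t ** ?k') t"
    by (rule has_mat_deriv_mult[OF D(2,4)])
  then have "has_mat_deriv (\<lambda>_. mat 1) (?g' ** ?k t + ?g t ** ?k') t"
    by (rule has_mat_deriv_cong[OF S t lev(2), rotated])
  then have "?g' ** ?k t + g ** ?k' = 0"
    using has_mat_deriv_unique[OF _ has_mat_deriv_const] g_def by blast
  then have gk: "g ** ?k' = - U"
    by (simp add: U_def k add_eq_0_iff)
  have "?k' = matrix_inv g ** (g ** ?k')"
    using matrix_inv_left[OF lev(1)[OF t]] by (simp add: matrix_mul_assoc g_def)
  then have k': "?k' = - (matrix_inv g ** U)"
    by (simp add: gk matrix_minus_right)
  have g': "?g' = U ** g"
    using matrix_inv_left[OF lev(1)[OF t]] by (simp add: U_def g_def flip: matrix_mul_assoc)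
  have "has_mat_deriv (\<lambda>s. ?c ** (?g s ** fst (X s) b a p ** ?k s))
      (?c ** ((?g' ** fst (X t) b a p + ?g t ** fst (velocity X t) b a p) ** ?k t + ?g t ** fst (X t) b a p ** ?k')) t"
    by (intro has_mat_deriv_mult_left has_mat_deriv_mult D)
  then have "has_mat_deriv (\<lambda>s. fst (X s) a b p)
      (?c ** ((?g' ** fst (X t) b a p + ?g t ** fst (velocity X t) b a p) ** ?k t + ?g t ** fst (X t) b a p ** ?k')) t"
    by (rule has_mat_deriv_cong[OF S t lev(3)[symmetric], rotated])
  from velocity_eqI(1)[of X a b p, OF this]
  show "fst (velocity X t) a b p = ?c ** (g ** fst (velocity X t) b a p ** matrix_inv g + U ** E - E ** U)"
    unfolding k k' g' g_def[symmetric] E_def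
    by (simp add: matrix_add_ldistrib matrix_add_rdistrib matrix_minus_right matrix_mul_assoc add.commute)
qed

end

context hecke_point
begin

abbreviation overlaps :: "'s set" where "overlaps \<equiv> (\<Union>b\<in>labels C - {\<alpha>}. overlap C \<alpha> b)"

text \<open>Product rule for a frame \<Phi> with logarithmic derivative \<theta>, its inverse being
  supplied as a separate function \<Psi>. The frame conjugates \<eta>_{\<alpha>b}, acts on
  g_{\<alpha>b} from the left and on g_{b\<alpha>} by its inverse from the right, and leaves the
  other data unchanged.\<close>

lemma velocity_singular_change:
  assumes X: "level_curve C D d S X" and t: "t \<in> S"
    and Y: "\<forall>s\<in>S. agree C (Y s) (act (at_label \<alpha> (\<Phi> s)) (X s))"
    and inv: "\<forall>s\<in>S. \<forall>p\<in>overlaps. \<Phi> s p ** \<Psi> s p = mat 1"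
    and D\<Phi>: "\<forall>p\<in>overlaps. has_mat_deriv (\<lambda>s. \<Phi> s p) (\<Phi> t p ** \<theta> p) t"
    and D\<Psi>: "\<forall>p\<in>overlaps. has_mat_deriv (\<lambda>s. \<Psi> s p) (- (\<theta> p ** \<Psi> t p)) t"
  shows "\<And>b p. b \<in> labels C \<Longrightarrow> b \<noteq> \<alpha> \<Longrightarrow> p \<in> overlap C \<alpha> b \<Longrightarrow> fst (velocity Y t) \<alpha> b p =
      \<Phi> t p ** (fst (velocity X t) \<alpha> b p + \<theta> p ** fst (X t) \<alpha> b p - fst (X t) \<alpha> b p ** \<theta> p) ** \<Psi> t p"
    and "\<And>b p. b \<in> labels C \<Longrightarrow> b \<noteq> \<alpha> \<Longrightarrow> p \<in> overlap C \<alpha> b \<Longrightarrow> snd (velocity Y t) \<alpha> b p =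
      \<Phi> t p ** (snd (velocity X t) \<alpha> b p + \<theta> p ** snd (X t) \<alpha> b p)"
    and "\<And>a b p. a \<in> labels C \<Longrightarrow> b \<in> labels C \<Longrightarrow> a \<noteq> b \<Longrightarrow> a \<noteq> \<alpha> \<Longrightarrow> p \<in> overlap C a b \<Longrightarrow>
      fst (velocity Y t) a b p = fst (velocity X t) a b p"
    and "\<And>b p. b \<in> labels C \<Longrightarrow> b \<noteq> \<alpha> \<Longrightarrow> p \<in> overlap C \<alpha> b \<Longrightarrow> snd (velocity Y t) b \<alpha> p =
      (snd (velocity X t) b \<alpha> p - snd (X t) b \<alpha> p ** \<theta> p) ** \<Psi> t p"
    and "\<And>a b p. a \<in> labels C \<Longrightarrow> b \<in> labels C \<Longrightarrow> a \<noteq> b \<Longrightarrow> a \<noteq> \<alpha> \<Longrightarrow> b \<noteq> \<alpha> \<Longrightarrow> p \<in> overlap C a b \<Longrightarrow>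
      snd (velocity Y t) a b p = snd (velocity X t) a b p"
proof -
  note S = level_curve_open[OF X]
  have Yeq: "fst (Y s) a b p = fst (act (at_label \<alpha> (\<Phi> s)) (X s)) a b p"
      "snd (Y s) a b p = snd (act (at_label \<alpha> (\<Phi> s)) (X s)) a b p"
    if "s \<in> S" "a \<in> labels C" "b \<in> labels C" "a \<noteq> b" "p \<in> overlap C a b" for s a b p
    using bspec[OF Y that(1)] that(2-5) by (simp_all add: agree_def)
  {
    fix b p assume b: "b \<in> labels C" "b \<noteq> \<alpha>" and p: "p \<in> overlap C \<alpha> b"
    note V = velocity_has_mat_deriv[OF X \<alpha>_label b(1) b(2)[symmetric] t p]
    have O: "p \<in> overlaps" using b p by blast
    have "has_mat_deriv (\<lambda>s. \<Phi> s p ** fst (X s) \<alpha> b p ** \<Psi> s p)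
        ((\<Phi> t p ** \<theta> p ** fst (X t) \<alpha> b p + \<Phi> t p ** fst (velocity X t) \<alpha> b p) ** \<Psi> t p +
          \<Phi> t p ** fst (X t) \<alpha> b p ** - (\<theta> p ** \<Psi> t p)) t"
      by (intro has_mat_deriv_mult V bspec[OF D\<Phi> O] bspec[OF D\<Psi> O])
    then have "has_mat_deriv (\<lambda>s. fst (Y s) \<alpha> b p)
        ((\<Phi> t p ** \<theta> p ** fst (X t) \<alpha> b p + \<Phi> t p ** fst (velocity X t) \<alpha> b p) ** \<Psi> t p +
          \<Phi> t p ** fst (X t) \<alpha> b p ** - (\<theta> p ** \<Psi> t p)) t"
      by (rule has_mat_deriv_cong[OF S t, rotated])
        (use Yeq(1)[OF _ \<alpha>_label b(1) b(2)[symmetric] p] matrix_inv_eqI[OF bspec[OF bspec[OF inv] O]] in \<open>simp add: act_def\<close>)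
    from velocity_eqI(1)[of Y, OF this]
    show "fst (velocity Y t) \<alpha> b p =
      \<Phi> t p ** (fst (velocity X t) \<alpha> b p + \<theta> p ** fst (X t) \<alpha> b p - fst (X t) \<alpha> b p ** \<theta> p) ** \<Psi> t p"
      by (simp add: matrix_algebra)
    have "has_mat_deriv (\<lambda>s. \<Phi> s p ** snd (X s) \<alpha> b p)
        (\<Phi> t p ** \<theta> p ** snd (X t) \<alpha> b p + \<Phi> t p ** snd (velocity X t) \<alpha> b p) t"
      by (intro has_mat_deriv_mult V bspec[OF D\<Phi> O])
    then have "has_mat_deriv (\<lambda>s. snd (Y s) \<alpha> b p)
        (\<Phi> t p ** \<theta> p ** snd (X t) \<alpha> b p + \<Phi> t p ** snd (velocity X t) \<alpha> b p) t"
      by (rule has_mat_deriv_cong[OF S t, rotated])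
        (use Yeq(2)[OF _ \<alpha>_label b(1) b(2)[symmetric] p] b in \<open>simp add: act_def matrix_inv_mat_1\<close>)
    from velocity_eqI(2)[of Y, OF this]
    show "snd (velocity Y t) \<alpha> b p = \<Phi> t p ** (snd (velocity X t) \<alpha> b p + \<theta> p ** snd (X t) \<alpha> b p)"
      by (simp add: matrix_algebra)
    have p': "p \<in> overlap C b \<alpha>" using p by (simp add: overlap_commute)
    note V = velocity_has_mat_deriv[OF X b(1) \<alpha>_label b(2) t p']
    have "has_mat_deriv (\<lambda>s. snd (X s) b \<alpha> p ** \<Psi> s p)
        (snd (velocity X t) b \<alpha> p ** \<Psi> t p + snd (X t) b \<alpha> p ** - (\<theta> p ** \<Psi> t p)) t"
      by (intro has_mat_deriv_mult V bspec[OF D\<Psi> O])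
    then have "has_mat_deriv (\<lambda>s. snd (Y s) b \<alpha> p)
        (snd (velocity X t) b \<alpha> p ** \<Psi> t p + snd (X t) b \<alpha> p ** - (\<theta> p ** \<Psi> t p)) t"
      by (rule has_mat_deriv_cong[OF S t, rotated])
        (use Yeq(2)[OF _ b(1) \<alpha>_label b(2) p'] b matrix_inv_eqI[OF bspec[OF bspec[OF inv] O]] in \<open>simp add: act_def\<close>)
    from velocity_eqI(2)[of Y, OF this]
    show "snd (velocity Y t) b \<alpha> p = (snd (velocity X t) b \<alpha> p - snd (X t) b \<alpha> p ** \<theta> p) ** \<Psi> t p"
      by (simp add: matrix_algebra)
  next
    fix a b p assume a: "a \<in> labels C" "b \<in> labels C" "a \<noteq> b" "a \<noteq> \<alpha>" and p: "p \<in> overlap C a b"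
    note V = velocity_has_mat_deriv[OF X a(1-3) t p]
    have "has_mat_deriv (\<lambda>s. fst (Y s) a b p) (fst (velocity X t) a b p) t"
      by (rule has_mat_deriv_cong[OF S t _ V(1)]) (use Yeq(1)[OF _ a(1-3) p] a(4) in \<open>simp add: act_def matrix_inv_mat_1\<close>)
    then show "fst (velocity Y t) a b p = fst (velocity X t) a b p" by (rule velocity_eqI)
    assume "b \<noteq> \<alpha>"
    then have "has_mat_deriv (\<lambda>s. snd (Y s) a b p) (snd (velocity X t) a b p) t"
      by (intro has_mat_deriv_cong[OF S t _ V(2)]) (use Yeq(2)[OF _ a(1-3) p] a(4) in \<open>simp add: act_def matrix_inv_mat_1\<close>)
    then show "snd (velocity Y t) a b p = snd (velocity X t) a b p" by (rule velocity_eqI)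
  }
qed

text \<open>The curves pass through the same point and their frames coincide there, but only the
  first logarithmic derivative carries the factor z. Seen from \<alpha>, the contribution of each
  edge of its face changes by the integral of \<open>symp_defect\<close>; the total change is an
  integral over the face boundary of \<alpha>, which vanishes.\<close>

lemma symplectic_form_singular_change:
  assumes X1: "level_curve C D d S\<^sub>1 X\<^sub>1" and X2: "level_curve C D d S\<^sub>2 X\<^sub>2" and t: "t\<^sub>1 \<in> S\<^sub>1" "t\<^sub>2 \<in> S\<^sub>2"
    and base: "agree C (X\<^sub>2 t\<^sub>2) (X\<^sub>1 t\<^sub>1)"
    and Y1: "\<forall>s\<in>S\<^sub>1. agree C (Y\<^sub>1 s) (act (at_label \<alpha> (\<Phi>\<^sub>1 s)) (X\<^sub>1 s))"
    and Y2: "\<forall>s\<in>S\<^sub>2. agree C (Y\<^sub>2 s) (act (at_label \<alpha> (\<Phi>\<^sub>2 s)) (X\<^sub>2 s))"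
    and inv1: "\<forall>s\<in>S\<^sub>1. \<forall>p\<in>overlaps. \<Phi>\<^sub>1 s p ** \<Psi>\<^sub>1 s p = mat 1"
    and inv2: "\<forall>s\<in>S\<^sub>2. \<forall>p\<in>overlaps. \<Phi>\<^sub>2 s p ** \<Psi>\<^sub>2 s p = mat 1"
    and D1: "\<forall>p\<in>overlaps.
        has_mat_deriv (\<lambda>s. \<Phi>\<^sub>1 s p) (\<Phi>\<^sub>1 t\<^sub>1 p ** (mat (z\<alpha> p) ** M)) t\<^sub>1"
      "\<forall>p\<in>overlaps.
        has_mat_deriv (\<lambda>s. \<Psi>\<^sub>1 s p) (- (mat (z\<alpha> p) ** M ** \<Psi>\<^sub>1 t\<^sub>1 p)) t\<^sub>1"
    and D2: "\<forall>p\<in>overlaps.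
        has_mat_deriv (\<lambda>s. \<Phi>\<^sub>2 s p) (\<Phi>\<^sub>2 t\<^sub>2 p ** \<theta>\<^sub>2 p) t\<^sub>2"
      "\<forall>p\<in>overlaps.
        has_mat_deriv (\<lambda>s. \<Psi>\<^sub>2 s p) (- (\<theta>\<^sub>2 p ** \<Psi>\<^sub>2 t\<^sub>2 p)) t\<^sub>2"
    and \<theta>2: "holomorphic_mat C \<alpha> (disk C \<alpha>) \<theta>\<^sub>2"
    and eq: "\<forall>p\<in>overlaps. \<Phi>\<^sub>2 t\<^sub>2 p = \<Phi>\<^sub>1 t\<^sub>1 p"
  shows "symplectic_form C (Y\<^sub>1 t\<^sub>1) (velocity Y\<^sub>1 t\<^sub>1) (velocity Y\<^sub>2 t\<^sub>2) =
    symplectic_form C (X\<^sub>1 t\<^sub>1) (velocity X\<^sub>1 t\<^sub>1) (velocity X\<^sub>2 t\<^sub>2)"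
proof -
  note v1 = velocity_singular_change[of d S\<^sub>1 X\<^sub>1 t\<^sub>1 Y\<^sub>1 \<Phi>\<^sub>1 \<Psi>\<^sub>1, OF X1 t(1) Y1 inv1 D1]
  note v2 = velocity_singular_change[of d S\<^sub>2 X\<^sub>2 t\<^sub>2 Y\<^sub>2 \<Phi>\<^sub>2 \<Psi>\<^sub>2, OF X2 t(2) Y2 inv2 D2]
  let ?x = "X\<^sub>1 t\<^sub>1" and ?y = "Y\<^sub>1 t\<^sub>1" and ?u = "velocity X\<^sub>1 t\<^sub>1" and ?v = "velocity X\<^sub>2 t\<^sub>2"
    and ?u' = "velocity Y\<^sub>1 t\<^sub>1" and ?v' = "velocity Y\<^sub>2 t\<^sub>2"
  let ?\<theta> = "\<lambda>p. mat (z\<alpha> p) ** M"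
  define Q where "Q b p = symp_defect (fst ?x \<alpha> b p) (fst ?u \<alpha> b p) (fst ?v \<alpha> b p) (?\<theta> p) (\<theta>\<^sub>2 p)" for b p
  define I where "I x u v a b p = symp_density (fst x a b p) (fst u a b p) (fst v a b p)
     (snd u a b p ** matrix_inv (snd x a b p)) (snd v a b p ** matrix_inv (snd x a b p))" for x u v :: "('s, 'i, 'n) config" and a b p
  have xl: "?x \<in> level_set C D d" by (rule level_curve_level[OF X1 t(1)])
  have xinv: "invertible (snd ?x a b p)" if "a \<in> labels C" "b \<in> labels C" "a \<noteq> b" "p \<in> overlap C a b" for a b p
    using xl that by (simp add: level_set_def is_bundle_def)
  have ye: "fst ?y a b p = fst (act (at_label \<alpha> (\<Phi>\<^sub>1 t\<^sub>1)) ?x) a b p"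
      "snd ?y a b p = snd (act (at_label \<alpha> (\<Phi>\<^sub>1 t\<^sub>1)) ?x) a b p"
    if "a \<in> labels C" "b \<in> labels C" "a \<noteq> b" "p \<in> overlap C a b" for a b p
    using bspec[OF Y1 t(1)] that by (simp_all add: agree_def)
  have x2: "fst (X\<^sub>2 t\<^sub>2) a b p = fst ?x a b p" "snd (X\<^sub>2 t\<^sub>2) a b p = snd ?x a b p"
    if "a \<in> labels C" "b \<in> labels C" "a \<noteq> b" "p \<in> overlap C a b" for a b p
    using base that by (simp_all add: agree_def)
  have \<Psi>2: "\<Psi>\<^sub>2 t\<^sub>2 p = matrix_inv (\<Phi>\<^sub>1 t\<^sub>1 p)" "\<Psi>\<^sub>1 t\<^sub>1 p = matrix_inv (\<Phi>\<^sub>1 t\<^sub>1 p)" "invertible (\<Phi>\<^sub>1 t\<^sub>1 p)"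
    if "p \<in> overlaps" for p
    using bspec[OF bspec[OF inv2 t(2)] that] bspec[OF bspec[OF inv1 t(1)] that] bspec[OF eq that] matrix_inv_eqI invertibleI by metis+
  have hI: "holomorphic_fun C a (overlap C a b) (I ?x ?u ?v a b)" if "a \<in> labels C" "b \<in> labels C" "a \<noteq> b" for a b
    using symp_density_holomorphic[OF X1 X2 t that xl] by (simp add: I_def[abs_def])
  have Q: "(\<Sum>b\<in>set (nbrs C \<alpha>). edge_integral C \<alpha> b (Q b)) = 0"
      "\<And>b. b \<in> labels C \<Longrightarrow> b \<noteq> \<alpha> \<Longrightarrow> holomorphic_fun C \<alpha> (overlap C \<alpha> b) (Q b)"
    using symp_defect_integral[OF X1 X2 t xl \<theta>2, where M = M] by (simp_all add: Q_def[abs_def])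
  \<comment> \<open>Each edge occurs in \<open>edges\<close> with one orientation only. If it is
    stored from the other end, its change is rewritten as the integral of \<open>Q\<close> seen from
    \<alpha>.\<close>
  define \<delta> where "\<delta> a b = (if a = \<alpha> then edge_integral C \<alpha> b (Q b) else if b = \<alpha> then edge_integral C \<alpha> a (Q a) else 0)" for a b
  have edge: "edge_integral C a b (I ?y ?u' ?v' a b) = edge_integral C a b (I ?x ?u ?v a b) + \<delta> a b"
    if e: "(a, b) \<in> edges C" for a b
  proof -
    have ab: "a \<in> labels C" "b \<in> labels C" "a \<noteq> b" and nb: "b \<in> set (nbrs C a)" and na: "a \<in> set (nbrs C b)"
      using edge_nbrs[OF e] by simp_all
    consider "a = \<alpha>" | "a \<noteq> \<alpha>" "b = \<alpha>" | "a \<noteq> \<alpha>" "b \<noteq> \<alpha>" by blast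
    then show ?thesis
    proof cases
      case 1
      then have b: "b \<in> labels C" "b \<noteq> \<alpha>" using ab by simp_all
      have "I ?y ?u' ?v' \<alpha> b p = I ?x ?u ?v \<alpha> b p + Q b p" if p: "p \<in> overlap C \<alpha> b" for p
      proof -
        let ?\<Phi> = "\<Phi>\<^sub>1 t\<^sub>1 p" and ?\<Psi> = "matrix_inv (\<Phi>\<^sub>1 t\<^sub>1 p)" and ?g = "snd ?x \<alpha> b p"
        have O: "p \<in> overlaps" using b p by blast
        note \<Psi> = \<Psi>2[OF O]
        note e = ye[OF \<alpha>_label b(1) b(2)[symmetric] p] and x2 = x2[OF \<alpha>_label b(1) b(2)[symmetric] p]
        have gi: "invertible ?g" by (rule xinv[OF \<alpha>_label b(1) b(2)[symmetric] p])
        have y: "fst ?y \<alpha> b p = ?\<Phi> ** fst ?x \<alpha> b p ** ?\<Psi>" "snd ?y \<alpha> b p = ?\<Phi> ** ?g"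
          using e b by (simp_all add: act_def matrix_inv_mat_1)
        have yi: "matrix_inv (snd ?y \<alpha> b p) = matrix_inv ?g ** ?\<Psi>"
          unfolding y by (rule matrix_inv_mult[OF \<Psi>(3) gi])
        have U: "?\<Phi> ** (w + th ** ?g) ** (matrix_inv ?g ** ?\<Psi>) = ?\<Phi> ** (w ** matrix_inv ?g + th) ** ?\<Psi>" for w th
        proof -
          have "?\<Phi> ** (w + th ** ?g) ** (matrix_inv ?g ** ?\<Psi>) = ?\<Phi> ** (w ** matrix_inv ?g + th ** (?g ** matrix_inv ?g)) ** ?\<Psi>"
            by (simp add: matrix_algebra)
          then show ?thesis by (simp add: matrix_inv_right gi)
        qed
        show ?thesis
          unfolding I_def yi v1(1,2)[OF b p] v2(1,2)[OF b p] \<Psi>(1,2) bspec[OF eq O] x2 U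
          unfolding y Q_def by (rule symp_density_left) (rule matrix_inv_left[OF \<Psi>(3)])
      qed
      then have "edge_integral C \<alpha> b (I ?y ?u' ?v' \<alpha> b) = edge_integral C \<alpha> b (\<lambda>p. I ?x ?u ?v \<alpha> b p + Q b p)"
        using nb 1 by (intro edge_integral_cong \<alpha>_label) simp_all
      also have "\<dots> = edge_integral C \<alpha> b (I ?x ?u ?v \<alpha> b) + edge_integral C \<alpha> b (Q b)"
        using nb 1 ab b by (intro edge_integral_add \<alpha>_label hI Q(2)) simp_all
      finally show ?thesis using 1 by (simp add: \<delta>_def)
    next
      case 2
      then have a: "a \<in> labels C" "a \<noteq> \<alpha>" using ab by simp_all
      let ?c = "transition_deriv C a \<alpha>"
      have IQ: "I ?y ?u' ?v' a \<alpha> p = I ?x ?u ?v a \<alpha> p - ?c p * Q a p" if p: "p \<in> overlap C a \<alpha>" for p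
      proof -
        have p': "p \<in> overlap C \<alpha> a" using p by (simp add: overlap_commute)
        let ?\<Phi> = "\<Phi>\<^sub>1 t\<^sub>1 p" and ?\<Psi> = "matrix_inv (\<Phi>\<^sub>1 t\<^sub>1 p)" and ?g = "snd ?x a \<alpha> p"
        let ?k = "matrix_inv ?g" and ?\<eta> = "fst ?x \<alpha> a p"
        let ?E = "?g ** ?\<eta> ** ?k" and ?U = "snd ?u a \<alpha> p ** ?k" and ?V = "snd ?v a \<alpha> p ** ?k"
        have O: "p \<in> overlaps" using a p' by blast
        note \<Psi> = \<Psi>2[OF O]
        note e = ye[OF a(1) \<alpha>_label a(2) p] and x2 = x2[OF a(1) \<alpha>_label a(2) p] x2[OF \<alpha>_label a(1) a(2)[symmetric] p']
        have gi: "invertible ?g" by (rule xinv[OF a(1) \<alpha>_label a(2) p])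
        have y: "fst ?y a \<alpha> p = fst ?x a \<alpha> p" "snd ?y a \<alpha> p = ?g ** ?\<Psi>"
          using e a by (simp_all add: act_def matrix_inv_mat_1)
        have yi: "matrix_inv (snd ?y a \<alpha> p) = ?\<Phi> ** ?k"
          unfolding y using matrix_inv_mult[OF gi invertible_matrix_inv[OF \<Psi>(3)]] by (simp add: matrix_inv_inv \<Psi>(3))
        have U: "(w - ?g ** th) ** ?\<Psi> ** (?\<Phi> ** ?k) = w ** ?k - ?g ** th ** ?k" for w th
        proof -
          have "(w - ?g ** th) ** ?\<Psi> ** (?\<Phi> ** ?k) = (w - ?g ** th) ** (?\<Psi> ** ?\<Phi>) ** ?k"
            by (simp add: matrix_mul_assoc)
          then show ?thesis by (simp add: matrix_inv_left \<Psi>(3) matrix_diff_rdistrib)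
        qed
        \<comment> \<open>\<open>?E\<close> is the Higgs field of \<alpha> carried over to the frame
          of \<open>a\<close>; in the coordinate of \<open>a\<close> it acquires the factor
          \<open>?c\<close>.\<close>
        note h1 = higgs_velocity[OF X1 a(1) \<alpha>_label a(2) t(1) p]
        note h2 = higgs_velocity[OF X2 a(1) \<alpha>_label a(2) t(2) p, unfolded x2]
        have "I ?y ?u' ?v' a \<alpha> p = symp_density (mat (?c p) ** ?E)
            (mat (?c p) ** (?g ** fst ?u \<alpha> a p ** ?k + ?U ** ?E - ?E ** ?U))
            (mat (?c p) ** (?g ** fst ?v \<alpha> a p ** ?k + ?V ** ?E - ?E ** ?V)) (?U - ?g ** ?\<theta> p ** ?k) (?V - ?g ** \<theta>\<^sub>2 p ** ?k)"
          unfolding I_def yi v1(4)[OF a p'] v2(4)[OF a p'] \<Psi>(1,2) x2 U v1(3)[OF a(1) \<alpha>_label a(2,2) p]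
            v2(3)[OF a(1) \<alpha>_label a(2,2) p]
          unfolding y h1[symmetric] h2(2)[symmetric] ..
        also have "\<dots> = ?c p * (symp_density ?E (?g ** fst ?u \<alpha> a p ** ?k + ?U ** ?E - ?E ** ?U)
            (?g ** fst ?v \<alpha> a p ** ?k + ?V ** ?E - ?E ** ?V) ?U ?V - Q a p)"
          unfolding symp_density_scale Q_def by (subst symp_density_right[OF matrix_inv_left[OF gi]]) (rule refl)
        also have "\<dots> = I ?x ?u ?v a \<alpha> p - ?c p * Q a p"
          unfolding I_def h1 h2(2) symp_density_scale by (rule right_diff_distrib)
        finally show ?thesis .
      qed
      have Qa: "holomorphic_fun C a (overlap C a \<alpha>) (Q a)"
        using Q(2)[OF a] holomorphic_fun_change_chart[OF a(1) \<alpha>_label, of "overlap C a \<alpha>"] by (simp add: overlap_commute)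
      have c: "holomorphic_fun C a (overlap C a \<alpha>) (?c)"
      proof -
        have "(coord C \<alpha> \<circ> uncoord C a) holomorphic_on coord C a ` overlap C a \<alpha>"
          using covering(1) a(1) \<alpha>_label by (simp add: disk_covering_def)
        then have "deriv (coord C \<alpha> \<circ> uncoord C a) holomorphic_on coord C a ` overlap C a \<alpha>"
          by (rule holomorphic_deriv[OF _ open_coord_overlap[OF a(1) \<alpha>_label]])
        then show ?thesis
          unfolding holomorphic_fun_iff transition_deriv_def
          by (rule holomorphic_transform) (simp add: coord_uncoord[OF a(1) overlap_disk(1)])
      qed
      have "edge_integral C a \<alpha> (I ?y ?u' ?v' a \<alpha>) = edge_integral C a \<alpha> (\<lambda>p. I ?x ?u ?v a \<alpha> p - ?c p * Q a p)"
        using nb 2 by (intro edge_integral_cong a IQ) simp_all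
      also have "\<dots> = edge_integral C a \<alpha> (I ?x ?u ?v a \<alpha>) - edge_integral C a \<alpha> (\<lambda>p. ?c p * Q a p)"
        using nb 2 by (intro edge_integral_diff a hI \<alpha>_label holomorphic_fun_mult c Qa) simp_all
      \<comment> \<open>The minus sign of the defect at the far end and the reversed orientation of
        the edge cancel.\<close>
      also have "edge_integral C a \<alpha> (\<lambda>p. ?c p * Q a p) = - edge_integral C \<alpha> a (Q a)"
        using nb 2 by (intro edge_integral_reverse a) simp
      finally show ?thesis using 2 by (simp add: \<delta>_def)
    next
      case 3
      have "edge_integral C a b (I ?y ?u' ?v' a b) = edge_integral C a b (I ?x ?u ?v a b)"
      proof (rule edge_integral_cong[OF ab(1) nb])
        fix p assume p: "p \<in> overlap C a b"
        have "fst ?y a b p = fst ?x a b p" "snd ?y a b p = snd ?x a b p"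
          using ye[OF ab p] 3 by (simp_all add: act_def matrix_inv_mat_1)
        then show "I ?y ?u' ?v' a b p = I ?x ?u ?v a b p"
          using v1(3)[OF ab 3(1) p] v1(5)[OF ab 3 p] v2(3)[OF ab 3(1) p] v2(5)[OF ab 3 p] by (simp add: I_def)
      qed
      then show ?thesis using 3 by (simp add: \<delta>_def)
    qed
  qed
  have "(\<Sum>(a, b)\<in>edges C. \<delta> a b) = (\<Sum>b\<in>set (nbrs C \<alpha>). edge_integral C \<alpha> b (Q b))"
  proof -
    let ?E1 = "{b. (\<alpha>, b) \<in> edges C}" and ?E2 = "{b. (b, \<alpha>) \<in> edges C}"
    have "?E1 \<subseteq> set (nbrs C \<alpha>)" "?E2 \<subseteq> set (nbrs C \<alpha>)"
      using set_nbrs[OF \<alpha>_label] by auto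
    then have fin: "finite ?E1" "finite ?E2"
      by (simp_all add: finite_subset)
    \<comment> \<open>Only edges meeting \<alpha> contribute; the outgoing and incoming ones
      together list each neighbour of \<alpha> once.\<close>
    have "(\<Sum>(a, b)\<in>edges C. \<delta> a b) = (\<Sum>(a, b)\<in>Pair \<alpha> ` ?E1 \<union> (\<lambda>b. (b, \<alpha>)) ` ?E2. \<delta> a b)"
      by (rule sum.mono_neutral_right[OF finite_edges]) (auto simp: \<delta>_def split: if_splits)
    also have "\<dots> = (\<Sum>(a, b)\<in>Pair \<alpha> ` ?E1. \<delta> a b) + (\<Sum>(a, b)\<in>(\<lambda>b. (b, \<alpha>)) ` ?E2. \<delta> a b)"
      using fin edge_nbrs by (intro sum.union_disjoint) auto
    also have "\<dots> = (\<Sum>b\<in>?E1. edge_integral C \<alpha> b (Q b)) + (\<Sum>b\<in>?E2. edge_integral C \<alpha> b (Q b))"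
      using edge_nbrs by (subst (1 2) sum.reindex) (auto simp: inj_on_def \<delta>_def intro!: sum.cong arg_cong2[of _ _ _ _ "(+)"])
    also have "\<dots> = (\<Sum>b\<in>?E1 \<union> ?E2. edge_integral C \<alpha> b (Q b))"
      using fin edge_nbrs by (intro sum.union_disjoint[symmetric]) auto
    also have "?E1 \<union> ?E2 = set (nbrs C \<alpha>)"
      using set_nbrs[OF \<alpha>_label] by auto
    finally show ?thesis .
  qed
  then have \<delta>: "(\<Sum>(a, b)\<in>edges C. \<delta> a b) = 0" using Q(1) by simp
  have "symplectic_form C ?y ?u' ?v' = (\<Sum>(a, b)\<in>edges C. edge_integral C a b (I ?y ?u' ?v' a b))"
    by (simp add: symplectic_form_density I_def[abs_def])
  also have "\<dots> = (\<Sum>(a, b)\<in>edges C. edge_integral C a b (I ?x ?u ?v a b) + \<delta> a b)"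
    by (rule sum.cong) (auto simp: edge)
  also have "\<dots> = (\<Sum>(a, b)\<in>edges C. edge_integral C a b (I ?x ?u ?v a b))"
    using \<delta> by (simp add: split_beta sum.distrib)
  also have "\<dots> = symplectic_form C ?x ?u ?v"
    by (simp add: symplectic_form_density I_def[abs_def])
  finally show ?thesis .
qed

end

section \<open>Families of lifted configurations\<close>

lemma continuous_on_mat_iff:
  "continuous_on S F \<longleftrightarrow> (\<forall>i j. continuous_on S (\<lambda>x. F x $ i $ j))"
  for F :: "'a::topological_space \<Rightarrow> complex^'n^'m"
proof
  assume "\<forall>i j. continuous_on S (\<lambda>x. F x $ i $ j)"
  then have "continuous_on S (\<lambda>x. \<chi> i j. F x $ i $ j)"
    by (intro continuous_on_vec_lambda) auto
  then show "continuous_on S F" by simp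
qed (auto intro!: continuous_intros)

lemma continuous_on_mat_mult:
  fixes F G :: "'a::topological_space \<Rightarrow> complex^'n^'n"
  assumes "continuous_on S F" "continuous_on S G"
  shows "continuous_on S (\<lambda>x. F x ** G x)"
  using assms unfolding continuous_on_mat_iff matrix_mul_nth
  by (intro allI continuous_on_sum continuous_on_mult) blast+

definition mat_holomorphic_on :: "(complex \<Rightarrow> complex^'n^'n) \<Rightarrow> complex set \<Rightarrow> bool" where
  "mat_holomorphic_on F S \<longleftrightarrow> (\<forall>i j. (\<lambda>t. F t $ i $ j) holomorphic_on S)"

lemma mat_holomorphic_on_mult:
  "mat_holomorphic_on F S \<Longrightarrow> mat_holomorphic_on G S \<Longrightarrow> mat_holomorphic_on (\<lambda>t. F t ** G t) S"
  by (auto simp: mat_holomorphic_on_def matrix_mul_nth intro!: holomorphic_intros)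

lemma mat_holomorphic_on_const: "mat_holomorphic_on (\<lambda>_. A) S"
  by (simp add: mat_holomorphic_on_def)

text \<open>The action involves the inverse frame, whose regularity is therefore recorded
  alongside.\<close>

definition frame_family ::
    "('s::topological_space, 'i) curve \<Rightarrow> ('m \<Rightarrow> complex) set \<Rightarrow>
     (('m \<Rightarrow> complex) \<Rightarrow> 'i \<Rightarrow> 's \<Rightarrow> complex^'n::finite^'n) \<Rightarrow> bool" where
  "frame_family C T \<phi> \<longleftrightarrow> (\<forall>a\<in>labels C. \<forall>b\<in>labels C. a \<noteq> b \<longrightarrow>
     continuous_on (T \<times> overlap C a b) (\<lambda>(\<tau>, p). \<phi> \<tau> a p) \<and>
     continuous_on (T \<times> overlap C a b) (\<lambda>(\<tau>, p). matrix_inv (\<phi> \<tau> a p)) \<and>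
     (\<forall>\<tau>\<in>T. \<forall>m. \<forall>p\<in>overlap C a b.
        mat_holomorphic_on (\<lambda>t. \<phi> (\<tau>(m := t)) a p) {t. \<tau>(m := t) \<in> T} \<and>
        mat_holomorphic_on (\<lambda>t. matrix_inv (\<phi> (\<tau>(m := t)) a p)) {t. \<tau>(m := t) \<in> T}))"

lemma family_in_levelD:
  assumes "family_in_level C D d T x"
  shows "open T" "holomorphic_family C T x" "\<tau> \<in> T \<Longrightarrow> x \<tau> \<in> level_set C D d"
  using assms by (simp_all add: family_in_level_def)

context riemann_surface
begin

lemma holomorphic_family_act:
  assumes x: "holomorphic_family C T x" and \<phi>: "frame_family C T \<phi>"
  shows "holomorphic_family C T (\<lambda>\<tau>. act (\<phi> \<tau>) (x \<tau>))"
  unfolding holomorphic_family_def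
proof (intro ballI impI)
  fix a b assume ab: "a \<in> labels C" "b \<in> labels C" "a \<noteq> b"
  let ?V = "overlap C a b"
  have cx: "continuous_on (T \<times> ?V) (\<lambda>(\<tau>, p). fst (x \<tau>) a b p)" "continuous_on (T \<times> ?V) (\<lambda>(\<tau>, p). snd (x \<tau>) a b p)"
    and hx: "\<And>\<tau> m p. \<tau> \<in> T \<Longrightarrow> p \<in> ?V \<Longrightarrow> mat_holomorphic_on (\<lambda>t. fst (x (\<tau>(m := t))) a b p) {t. \<tau>(m := t) \<in> T}"
      "\<And>\<tau> m p. \<tau> \<in> T \<Longrightarrow> p \<in> ?V \<Longrightarrow> mat_holomorphic_on (\<lambda>t. snd (x (\<tau>(m := t))) a b p) {t. \<tau>(m := t) \<in> T}"
    using x ab by (simp_all add: holomorphic_family_def mat_holomorphic_on_def)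
  have f: "continuous_on (T \<times> ?V) (\<lambda>(\<tau>, p). \<phi> \<tau> c p)" "continuous_on (T \<times> ?V) (\<lambda>(\<tau>, p). matrix_inv (\<phi> \<tau> c p))"
      "\<And>\<tau> m p. \<tau> \<in> T \<Longrightarrow> p \<in> ?V \<Longrightarrow> mat_holomorphic_on (\<lambda>t. \<phi> (\<tau>(m := t)) c p) {t. \<tau>(m := t) \<in> T}"
      "\<And>\<tau> m p. \<tau> \<in> T \<Longrightarrow> p \<in> ?V \<Longrightarrow> mat_holomorphic_on (\<lambda>t. matrix_inv (\<phi> (\<tau>(m := t)) c p)) {t. \<tau>(m := t) \<in> T}"
    if "c = a \<or> c = b" for c
    using that \<phi> ab overlap_commute[of b a] unfolding frame_family_def by metis+
  have "continuous_on (T \<times> ?V) (\<lambda>(\<tau>, p). fst (act (\<phi> \<tau>) (x \<tau>)) a b p)"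
    "continuous_on (T \<times> ?V) (\<lambda>(\<tau>, p). snd (act (\<phi> \<tau>) (x \<tau>)) a b p)"
    using cx f(1,2) by (simp_all add: act_def split_beta continuous_on_mat_mult)
  moreover have "mat_holomorphic_on (\<lambda>t. fst (act (\<phi> (\<tau>(m := t))) (x (\<tau>(m := t)))) a b p) {t. \<tau>(m := t) \<in> T}"
    "mat_holomorphic_on (\<lambda>t. snd (act (\<phi> (\<tau>(m := t))) (x (\<tau>(m := t)))) a b p) {t. \<tau>(m := t) \<in> T}"
    if "\<tau> \<in> T" "p \<in> ?V" for \<tau> m p
    using hx[OF that] f(3,4)[OF _ that] by (simp_all add: act_def mat_holomorphic_on_mult)
  ultimately show "continuous_on (T \<times> ?V) (\<lambda>(\<tau>, p). fst (act (\<phi> \<tau>) (x \<tau>)) a b p) \<and>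
     continuous_on (T \<times> ?V) (\<lambda>(\<tau>, p). snd (act (\<phi> \<tau>) (x \<tau>)) a b p) \<and>
     (\<forall>\<tau>\<in>T. \<forall>m. \<forall>p\<in>?V. \<forall>i j.
        (\<lambda>t. fst (act (\<phi> (\<tau>(m := t))) (x (\<tau>(m := t)))) a b p $ i $ j) holomorphic_on {t. \<tau>(m := t) \<in> T} \<and>
        (\<lambda>t. snd (act (\<phi> (\<tau>(m := t))) (x (\<tau>(m := t)))) a b p $ i $ j) holomorphic_on {t. \<tau>(m := t) \<in> T})"
    unfolding mat_holomorphic_on_def by blast
qed

lemma holomorphic_mat_continuous:
  assumes "a \<in> labels C" "V \<subseteq> disk C a" "holomorphic_mat C a V F"
  shows "continuous_on (T \<times> V) (\<lambda>x. F (snd x))"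
proof -
  have "continuous_on V F"
    unfolding continuous_on_mat_iff
    using holomorphic_fun_continuous[OF assms(1,2) holomorphic_matD[OF assms(3)]] by blast
  then show ?thesis
    by (rule continuous_on_compose2) (auto intro: continuous_intros)
qed

lemma frame_family_const:
  assumes "f \<in> gauge_on C D {}"
  shows "frame_family C T (\<lambda>_. f)"
  unfolding frame_family_def split_beta
proof (intro ballI impI conjI allI)
  fix a b assume a: "a \<in> labels C"
  note f = holomorphic_mat_subset[OF gauge_onD(1)[OF assms a] overlap_disk(1)]
    holomorphic_mat_subset[OF gauge_onD(1)[OF gauge_on_inv[OF assms] a] overlap_disk(1)]
  show "continuous_on (T \<times> overlap C a b) (\<lambda>x. f a (snd x))"
    "continuous_on (T \<times> overlap C a b) (\<lambda>x. matrix_inv (f a (snd x)))"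
    by (rule holomorphic_mat_continuous[OF a overlap_disk(1) f(1)] holomorphic_mat_continuous[OF a overlap_disk(1) f(2)])+
qed (rule mat_holomorphic_on_const)+

lemma family_in_level_gauge:
  assumes x: "family_in_level C D d T x" and f: "f \<in> gauge_on C D {}" and "\<alpha> \<in> marked C"
    and c: "\<And>a. a \<in> marked C \<Longrightarrow> commutes_residue D a (f a (mpoint C a))"
  shows "family_in_level C D d T (\<lambda>\<tau>. act f (x \<tau>))"
  unfolding family_in_level_def
  using family_in_levelD[OF x] holomorphic_family_act[OF family_in_levelD(2)[OF x] frame_family_const[OF f]]
    gauge_act_level[OF f _ \<open>\<alpha> \<in> marked C\<close> c]
  by blast

text \<open>Traces of powers are conjugation invariant, and the edges lie in overlaps, where even a
  singular frame is invertible.\<close>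

lemma hitchin_hamiltonian_act:
  assumes "frame_change C \<phi>"
  shows "hitchin_hamiltonian C \<nu> j l (act \<phi> x) = hitchin_hamiltonian C \<nu> j l x"
  unfolding hitchin_hamiltonian_def
proof (rule sum.cong[OF refl], clarify)
  fix a b assume "(a, b) \<in> edges C"
  then have ab: "a \<in> labels C" "b \<in> labels C" "a \<noteq> b" "b \<in> set (nbrs C a)"
    using edge_nbrs by blast+
  show "edge_integral C a b (\<lambda>p. \<nu> j l a b p * trace (mat_power (fst (act \<phi> x) a b p) j)) =
      edge_integral C a b (\<lambda>p. \<nu> j l a b p * trace (mat_power (fst x a b p) j))"
    by (rule edge_integral_cong[OF ab(1,4)])
      (simp add: act_def trace_mat_power_conj frame_changeD(3)[OF assms ab(1-3)])
qed

end

context hecke_point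
begin

lemma hecke_nil_agree:
  assumes "agree C x y"
  shows "hecke_nil up x = hecke_nil up y"
proof -
  have "edge_integral C \<alpha> b (\<lambda>p. fst x \<alpha> b p $ i $ j / z\<alpha> p) = edge_integral C \<alpha> b (\<lambda>p. fst y \<alpha> b p $ i $ j / z\<alpha> p)"
    if b: "b \<in> set (nbrs C \<alpha>)" for b i j
    using assms nbrsD(1,2)[OF \<alpha>_label b] \<alpha>_label
    by (intro edge_integral_cong[OF \<alpha>_label b]) (auto simp: agree_def)
  then have "hecke_coeff x i j = hecke_coeff y i j" for i j
    by (simp add: hecke_coeff_def)
  then show ?thesis by (simp add: hecke_nil_def vec_eq_iff)
qed

lemma hecke_lift_agree:
  assumes "agree C x y"
  shows "agree C (hecke_lift up x) (hecke_lift up y)"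
  using act_cong[OF assms] hecke_nil_agree[OF assms, of up] by (simp add: hecke_lift_def hecke_frame_def)

lemma z\<alpha>_continuous: "continuous_on (T \<times> overlap C \<alpha> b) (\<lambda>x. z\<alpha> (snd x))"
proof -
  have "continuous_on (overlap C \<alpha> b) z\<alpha>"
    by (intro holomorphic_fun_continuous[OF \<alpha>_label overlap_disk(1)] holomorphic_fun_local_coord \<alpha>_label overlap_disk(1))
  then show ?thesis
    by (rule continuous_on_compose2) (auto intro: continuous_intros)
qed

lemma holomorphic_fun_div_coord:
  assumes "b \<in> labels C" "b \<noteq> \<alpha>" "holomorphic_fun C \<alpha> (overlap C \<alpha> b) f"
  shows "holomorphic_fun C \<alpha> (overlap C \<alpha> b) (\<lambda>p. f p / z\<alpha> p)"
  by (rule holomorphic_fun_divide[OF \<alpha>_label overlap_disk(1) assms(3)])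
    (simp_all add: holomorphic_fun_local_coord \<alpha>_label overlap_disk(1) z\<alpha>_nz[OF assms(1,2)])

text \<open>The entries of \<open>hecke_nil\<close> are fixed linear combinations of edge integrals
  of the Higgs field divided by z_\<alpha>. These are differentiated under the integral, and the
  derivative keeps the raising shape.\<close>

lemma hecke_nil_has_mat_deriv:
  assumes X: "level_curve C D d S X" and t: "t \<in> S"
  obtains M where "raising up k M" "has_mat_deriv (\<lambda>s. hecke_nil up (X s)) M t"
proof -
  let ?F = "\<lambda>i j b s p. fst (X s) \<alpha> b p $ i $ j / z\<alpha> p"
  have "((\<lambda>s. edge_integral C \<alpha> b (?F i j b s)) has_field_derivative
      edge_integral C \<alpha> b (\<lambda>p. deriv (\<lambda>s. ?F i j b s p) t)) (at t)" if b: "b \<in> set (nbrs C \<alpha>)" for b i j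
  proof (rule has_field_derivative_edge_integral[OF \<alpha>_label b level_curve_open[OF X] _ _ _ t])
    note n = nbrsD(1,2)[OF \<alpha>_label b]
    note l = level_curveD[OF X \<alpha>_label n(1) n(2)[symmetric], where i = i and j = j]
    show "continuous_on (S \<times> overlap C \<alpha> b) (\<lambda>(s, p). ?F i j b s p)"
      using l(1) z\<alpha>_nz[OF n] unfolding split_beta
      by (intro continuous_on_divide z\<alpha>_continuous) auto
    show "(\<lambda>s. ?F i j b s p) holomorphic_on S" if p: "p \<in> overlap C \<alpha> b" for p
      using l(3)[OF p] z\<alpha>_nz[OF n p] by (intro holomorphic_intros)
    show "holomorphic_fun C \<alpha> (overlap C \<alpha> b) (?F i j b s)" if "s \<in> S" for s
      by (rule holomorphic_fun_div_coord[OF n l(5)[OF that]])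
  qed
  then have D: "((\<lambda>s. hecke_coeff (X s) i j) has_field_derivative
      (\<Sum>b\<in>set (nbrs C \<alpha>). edge_integral C \<alpha> b (\<lambda>p. deriv (\<lambda>s. ?F i j b s p) t)) / (2 * of_real pi * \<i>)) (at t)" for i j
    unfolding hecke_coeff_def by (intro DERIV_cdivide DERIV_sum)
  define M where "M = (\<chi> i j. if raised up k i j
     then (\<Sum>b\<in>set (nbrs C \<alpha>). edge_integral C \<alpha> b (\<lambda>p. deriv (\<lambda>s. ?F i j b s p) t)) / (2 * of_real pi * \<i>) /
       (residue_entry D \<alpha> i - residue_entry D \<alpha> j) else 0)"
  show thesis
  proof (rule that[of M])
    show "raising up k M" by (simp add: raising_def M_def)
    have "((\<lambda>s. hecke_nil up (X s) $ i $ j) has_field_derivative M $ i $ j) (at t)" for i j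
    proof (cases "raised up k i j")
      case True
      have "((\<lambda>s. hecke_coeff (X s) i j / (residue_entry D \<alpha> i - residue_entry D \<alpha> j)) has_field_derivative M $ i $ j) (at t)"
        using DERIV_cdivide[OF D[of i j]] True by (simp add: M_def)
      then show ?thesis using True by (simp add: hecke_nil_def)
    qed (simp add: hecke_nil_def M_def)
    then show "has_mat_deriv (\<lambda>s. hecke_nil up (X s)) M t" by (simp add: has_mat_deriv_def)
  qed
qed

lemma hecke_nil_holomorphic:
  assumes "level_curve C D d S X"
  shows "mat_holomorphic_on (\<lambda>s. hecke_nil up (X s)) S"
  unfolding mat_holomorphic_on_def
proof (intro allI holomorphic_onI)
  fix i j t assume "t \<in> S"
  then obtain M where "has_mat_deriv (\<lambda>s. hecke_nil up (X s)) M t"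
    using hecke_nil_has_mat_deriv[OF assms] by metis
  then have "((\<lambda>s. hecke_nil up (X s) $ i $ j) has_field_derivative M $ i $ j) (at t)"
    unfolding has_mat_deriv_def by blast
  then show "(\<lambda>s. hecke_nil up (X s) $ i $ j) field_differentiable at t within S"
    unfolding field_differentiable_def using has_field_derivative_at_within by blast
qed

lemma hecke_nil_continuous:
  assumes x: "family_in_level C D d T x"
  shows "continuous_on T (\<lambda>\<tau>. hecke_nil up (x \<tau>))"
  unfolding continuous_on_mat_iff
proof (intro allI)
  fix i j
  have "continuous_on T (\<lambda>\<tau>. edge_integral C \<alpha> b (\<lambda>p. fst (x \<tau>) \<alpha> b p $ i $ j / z\<alpha> p))" if b: "b \<in> set (nbrs C \<alpha>)" for b
  proof (rule continuous_on_edge_integral[OF \<alpha>_label b])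
    note n = nbrsD(1,2)[OF \<alpha>_label b]
    have "continuous_on (T \<times> overlap C \<alpha> b) (\<lambda>(\<tau>, p). fst (x \<tau>) \<alpha> b p)"
      using family_in_levelD(2)[OF x] \<alpha>_label n by (simp add: holomorphic_family_def)
    then show "continuous_on (T \<times> overlap C \<alpha> b) (\<lambda>(\<tau>, p). fst (x \<tau>) \<alpha> b p $ i $ j / z\<alpha> p)"
      using z\<alpha>_nz[OF n] unfolding split_beta continuous_on_mat_iff
      by (intro continuous_on_divide z\<alpha>_continuous) auto
    fix \<tau> assume "\<tau> \<in> T"
    then have "is_higgs_field C (x \<tau>)" using family_in_levelD(3)[OF x] by (simp add: level_set_def)
    then show "holomorphic_fun C \<alpha> (overlap C \<alpha> b) (\<lambda>p. fst (x \<tau>) \<alpha> b p $ i $ j / z\<alpha> p)"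
      using \<alpha>_label n by (intro holomorphic_fun_div_coord n holomorphic_matD) (simp add: is_higgs_field_def)
  qed
  then have "continuous_on T (\<lambda>\<tau>. hecke_coeff (x \<tau>) i j)"
    unfolding hecke_coeff_def by (intro continuous_intros) auto
  then show "continuous_on T (\<lambda>\<tau>. hecke_nil up (x \<tau>) $ i $ j)"
    using residue_entry_raised[of up i j]
    by (cases "raised up k i j") (auto simp: hecke_nil_def intro!: continuous_intros)
qed

lemma frame_family_hecke_frame:
  assumes x: "family_in_level C D d T x"
  shows "frame_family C T (\<lambda>\<tau>. hecke_frame up (x \<tau>))"
  unfolding frame_family_def split_beta
proof (intro ballI impI conjI allI)
  fix a b assume ab: "a \<in> labels C" "b \<in> labels C" "a \<noteq> b"
  let ?N = "\<lambda>\<tau>. hecke_nil up (x \<tau>)"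
  \<comment> \<open>The explicit inverse, by which continuity and holomorphy of the inverse frame
    reduce to those of N.\<close>
  have inv: "matrix_inv (hecke_frame up (x \<tau>) \<alpha> p) = elem_mod (\<not> up) k (z\<alpha> p) ** (mat 1 - ?N \<tau>)"
    if "a = \<alpha>" "p \<in> overlap C a b" for \<tau> p
    using that z\<alpha>_nz[OF ab(2)] ab matrix_inv_unipotent_elem_mod[OF raising_hecke_nil] by (simp add: hecke_frame_def)
  have N: "continuous_on (T \<times> overlap C a b) (\<lambda>y. ?N (fst y))"
    by (rule continuous_on_compose2[OF hecke_nil_continuous[OF x]]) (auto intro: continuous_intros)
  have E: "continuous_on (T \<times> overlap C \<alpha> b) (\<lambda>y. elem_mod up' k (z\<alpha> (snd y)))" if "b \<noteq> \<alpha>" for up'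
    by (rule holomorphic_mat_continuous[OF \<alpha>_label overlap_disk(1) holomorphic_elem_mod[OF ab(2) that]])
  show "continuous_on (T \<times> overlap C a b) (\<lambda>y. hecke_frame up (x (fst y)) a (snd y))"
  proof (cases "a = \<alpha>")
    case True
    then show ?thesis
      using N E ab by (auto simp: hecke_frame_def intro!: continuous_on_mat_mult continuous_on_add)
  qed (simp add: hecke_frame_def)
  show "continuous_on (T \<times> overlap C a b) (\<lambda>y. matrix_inv (hecke_frame up (x (fst y)) a (snd y)))"
  proof (cases "a = \<alpha>")
    case True
    have "continuous_on (T \<times> overlap C a b) (\<lambda>y. elem_mod (\<not> up) k (z\<alpha> (snd y)) ** (mat 1 - ?N (fst y)))"
      using N E ab True by (auto intro!: continuous_on_mat_mult continuous_on_diff)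
    then show ?thesis
      by (rule continuous_on_eq) (use inv True in auto)
  qed (simp add: hecke_frame_def)
  fix \<tau> m p assume \<tau>: "\<tau> \<in> T" and p: "p \<in> overlap C a b"
  let ?S = "{t. \<tau>(m := t) \<in> T}"
  have "mat_holomorphic_on (\<lambda>t. ?N (\<tau>(m := t))) ?S"
    by (rule hecke_nil_holomorphic[OF level_curve_of_family[OF x \<tau>]])
  then have N: "mat_holomorphic_on (\<lambda>t. mat 1 + ?N (\<tau>(m := t))) ?S" "mat_holomorphic_on (\<lambda>t. mat 1 - ?N (\<tau>(m := t))) ?S"
    by (auto simp: mat_holomorphic_on_def intro!: holomorphic_intros)
  show "mat_holomorphic_on (\<lambda>t. hecke_frame up (x (\<tau>(m := t))) a p) ?S"
    by (cases "a = \<alpha>")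
      (use N in \<open>simp_all add: hecke_frame_def mat_holomorphic_on_mult mat_holomorphic_on_const\<close>)
  show "mat_holomorphic_on (\<lambda>t. matrix_inv (hecke_frame up (x (\<tau>(m := t))) a p)) ?S"
  proof (cases "a = \<alpha>")
    case True
    then show ?thesis
      using N inv[OF True p] by (simp add: mat_holomorphic_on_mult mat_holomorphic_on_const)
  qed (simp add: hecke_frame_def mat_holomorphic_on_const)
qed

lemma family_hecke_lift:
  assumes x: "family_in_level C D d T x" and "d' = d + (if up then 1 else - 1)"
  shows "family_in_level C D d' T (\<lambda>\<tau>. hecke_lift up (x \<tau>))"
  unfolding family_in_level_def
  using family_in_levelD[OF x] holomorphic_family_act[OF family_in_levelD(2)[OF x] frame_family_hecke_frame[OF x, of up]]
    hecke_lift_level[OF _ assms(2)]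
  unfolding hecke_lift_def by blast

section \<open>The lift is symplectic and preserves Hamilton's equations\<close>

lemma elem_mod_shift:
  assumes "raising up k M" "z \<noteq> 0"
  shows "elem_mod up k z ** (mat z ** M) = M ** elem_mod up k z"
    and "mat z ** M ** elem_mod (\<not> up) k z = elem_mod (\<not> up) k z ** M"
proof -
  note e = elem_mod_inverse[OF assms(2), of up k]
  have "elem_mod up k z ** (elem_mod (\<not> up) k z ** M ** elem_mod up k z) = (elem_mod up k z ** elem_mod (\<not> up) k z) ** M ** elem_mod up k z"
    by (simp add: matrix_mul_assoc)
  then show "elem_mod up k z ** (mat z ** M) = M ** elem_mod up k z"
    by (simp add: elem_mod_raising[OF assms] e)
  have "elem_mod (\<not> up) k z ** M ** elem_mod up k z ** elem_mod (\<not> up) k z = elem_mod (\<not> up) k z ** M ** (elem_mod up k z ** elem_mod (\<not> up) k z)"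
    by (simp add: matrix_mul_assoc)
  then show "mat z ** M ** elem_mod (\<not> up) k z = elem_mod (\<not> up) k z ** M"
    by (simp add: elem_mod_raising[OF assms] e)
qed

lemma overlaps_nz: "p \<in> overlaps \<Longrightarrow> z\<alpha> p \<noteq> 0"
  using z\<alpha>_nz by blast

text \<open>The frame \<open>(1 + N) \<Xi>\<close> has logarithmic derivative \<open>\<Xi>\<^sup>-\<^sup>1 DN \<Xi> = z_\<alpha> DN\<close>, because \<open>N DN = 0\<close>.\<close>

lemma hecke_frame_deriv:
  assumes M: "raising up k M" "has_mat_deriv N M t" and N: "\<And>s. raising up k (N s)" and z: "z \<noteq> 0"
  shows "has_mat_deriv (\<lambda>s. (mat 1 + N s) ** elem_mod up k z) ((mat 1 + N t) ** elem_mod up k z ** (mat z ** M)) t"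
    and "has_mat_deriv (\<lambda>s. elem_mod (\<not> up) k z ** (mat 1 - N s))
      (- (mat z ** M ** (elem_mod (\<not> up) k z ** (mat 1 - N t)))) t"
proof -
  have "has_mat_deriv (\<lambda>s. (mat 1 + N s) ** elem_mod up k z) ((0 + M) ** elem_mod up k z) t"
    by (intro has_mat_deriv_mult_right has_mat_deriv_add has_mat_deriv_const M)
  moreover have "(mat 1 + N t) ** elem_mod up k z ** (mat z ** M) = (mat 1 + N t) ** (M ** elem_mod up k z)"
    by (simp only: elem_mod_shift[OF M(1) z] flip: matrix_mul_assoc)
  moreover have "\<dots> = M ** elem_mod up k z"
    using raising_mult[OF N M(1)] by (simp add: matrix_algebra)
  ultimately show "has_mat_deriv (\<lambda>s. (mat 1 + N s) ** elem_mod up k z) ((mat 1 + N t) ** elem_mod up k z ** (mat z ** M)) t"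
    by simp
  have "has_mat_deriv (\<lambda>s. elem_mod (\<not> up) k z ** (mat 1 - N s)) (elem_mod (\<not> up) k z ** (0 - M)) t"
    by (intro has_mat_deriv_mult_left has_mat_deriv_diff has_mat_deriv_const M)
  moreover have "mat z ** M ** (elem_mod (\<not> up) k z ** (mat 1 - N t)) = elem_mod (\<not> up) k z ** M ** (mat 1 - N t)"
    by (simp only: elem_mod_shift[OF M(1) z] matrix_mul_assoc)
  moreover have "\<dots> = elem_mod (\<not> up) k z ** (M - M ** N t)"
    by (simp add: matrix_algebra)
  ultimately show "has_mat_deriv (\<lambda>s. elem_mod (\<not> up) k z ** (mat 1 - N s))
      (- (mat z ** M ** (elem_mod (\<not> up) k z ** (mat 1 - N t)))) t"
    using raising_mult[OF M(1) N] by (simp add: matrix_minus_right)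
qed

text \<open>Two coordinate directions of one family meet at \<tau>, where their frames agree because
  a frame depends on the configuration alone. Both logarithmic derivatives carry the factor
  z.\<close>

lemma hecke_lift_symplectic:
  assumes x: "family_in_level C D d T x" and \<tau>: "\<tau> \<in> T"
  shows "symplectic_form C (hecke_lift up (x \<tau>)) (pderiv_family m (\<lambda>\<tau>. hecke_lift up (x \<tau>)) \<tau>)
      (pderiv_family n (\<lambda>\<tau>. hecke_lift up (x \<tau>)) \<tau>) =
    symplectic_form C (x \<tau>) (pderiv_family m x \<tau>) (pderiv_family n x \<tau>)"
proof -
  let ?S = "\<lambda>m. {t. \<tau>(m := t) \<in> T}" and ?X = "\<lambda>m t. x (\<tau>(m := t))"
  let ?\<Phi> = "\<lambda>m t p. (mat 1 + hecke_nil up (?X m t)) ** elem_mod up k (z\<alpha> p)"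
    and ?\<Psi> = "\<lambda>m t p. elem_mod (\<not> up) k (z\<alpha> p) ** (mat 1 - hecke_nil up (?X m t))"
  note X = level_curve_of_family[OF x \<tau>]
  have t: "\<tau> m \<in> ?S m" for m using \<tau> by simp
  have "\<forall>m. \<exists>M. raising up k M \<and> has_mat_deriv (\<lambda>s. hecke_nil up (?X m s)) M (\<tau> m)"
  proof
    fix m
    obtain M where "raising up k M" "has_mat_deriv (\<lambda>s. hecke_nil up (?X m s)) M (\<tau> m)"
      by (rule hecke_nil_has_mat_deriv[OF X t]) (rule that)
    then show "\<exists>M. raising up k M \<and> has_mat_deriv (\<lambda>s. hecke_nil up (?X m s)) M (\<tau> m)" by blast
  qed
  from choice[OF this] obtain M where
      M': "\<forall>m. raising up k (M m) \<and> has_mat_deriv (\<lambda>s. hecke_nil up (?X m s)) (M m) (\<tau> m)"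
    by (elim exE) (rule that)
  have M: "raising up k (M m)" "has_mat_deriv (\<lambda>s. hecke_nil up (?X m s)) (M m) (\<tau> m)" for m
    using M' by simp_all
  have D: "\<forall>p\<in>overlaps. has_mat_deriv (\<lambda>s. ?\<Phi> m s p) (?\<Phi> m (\<tau> m) p ** (mat (z\<alpha> p) ** M m)) (\<tau> m)"
      "\<forall>p\<in>overlaps. has_mat_deriv (\<lambda>s. ?\<Psi> m s p) (- (mat (z\<alpha> p) ** M m ** ?\<Psi> m (\<tau> m) p)) (\<tau> m)" for m
    by (rule ballI, rule hecke_frame_deriv[OF M raising_hecke_nil], erule overlaps_nz)+
  have inv: "\<forall>s\<in>?S m. \<forall>p\<in>overlaps. ?\<Phi> m s p ** ?\<Psi> m s p = mat 1" for m
  proof (intro ballI)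
    fix s p assume p: "p \<in> overlaps"
    have "invertible (?\<Phi> m s p)"
      by (intro invertible_mult invertible_unipotent invertible_elem_mod overlaps_nz p)
    from matrix_inv_right[OF this] show "?\<Phi> m s p ** ?\<Psi> m s p = mat 1"
      by (simp only: matrix_inv_unipotent_elem_mod[OF raising_hecke_nil overlaps_nz[OF p]])
  qed
  have hM: "holomorphic_mat C \<alpha> (disk C \<alpha>) (\<lambda>p. mat (z\<alpha> p) ** M n)"
    unfolding holomorphic_mat_def mat_mult_nth
    by (intro allI holomorphic_fun_mult holomorphic_fun_const holomorphic_fun_local_coord \<alpha>_label order_refl)
  have Y: "\<forall>s\<in>?S m. agree C (hecke_lift up (?X m s)) (act (at_label \<alpha> (?\<Phi> m s)) (?X m s))" for m
    by (simp add: hecke_lift_def hecke_frame_def agree_refl)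
  have base: "agree C (?X n (\<tau> n)) (?X m (\<tau> m))"
    by (simp add: agree_refl)
  have eq: "\<forall>p\<in>overlaps. ?\<Phi> n (\<tau> n) p = ?\<Phi> m (\<tau> m) p"
    by simp
  have "symplectic_form C (hecke_lift up (?X m (\<tau> m))) (velocity (\<lambda>t. hecke_lift up (?X m t)) (\<tau> m))
      (velocity (\<lambda>t. hecke_lift up (?X n t)) (\<tau> n)) =
    symplectic_form C (?X m (\<tau> m)) (velocity (?X m) (\<tau> m)) (velocity (?X n) (\<tau> n))"
    by (rule symplectic_form_singular_change[where \<Phi>\<^sub>1 = "?\<Phi> m" and \<Psi>\<^sub>1 = "?\<Psi> m" and \<Phi>\<^sub>2 = "?\<Phi> n" and \<Psi>\<^sub>2 = "?\<Psi> n"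
          and M = "M m", OF X X t t base Y Y inv inv D D hM eq])
  then show ?thesis
    by (simp add: pderiv_family_velocity)
qed

text \<open>The equation on the target side quantifies over all test curves \<open>c\<close> through
  the lifted point, the hypothesis over curves through \<open>x \<tau>\<close>. Each
  \<open>c\<close> is moved back to a curve \<open>c'\<close> through \<open>x \<tau>\<close>; the
  Hamiltonians agree along both, and the symplectic pairings agree by the invariance for two curves
  with different frames.\<close>

lemma hecke_lift_hamilton:
  assumes x: "family_in_level C D d T x" and \<tau>: "\<tau> \<in> T" and d': "d' = d + (if up then 1 else - 1)"
    and H: "hamilton_equation C D d \<nu> m x \<tau>"
  shows "hamilton_equation C D d' \<nu> m (\<lambda>\<tau>. hecke_lift up (x \<tau>)) \<tau>"
  unfolding hamilton_equation_def
proof (intro allI impI, elim conjE)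
  fix S :: "(unit \<Rightarrow> complex) set" and c
  assume c: "family_in_level C D d' S c" and S: "(\<lambda>_. 0) \<in> S" and c0: "agree C (c (\<lambda>_. 0)) (hecke_lift up (x \<tau>))"
  let ?y = "hecke_lift up (x \<tau>)" and ?N = "hecke_nil up (x \<tau>)" and ?N' = "\<lambda>\<sigma>. hecke_nil (\<not> up) (c \<sigma>)"
  have xl: "x \<tau> \<in> level_set C D d" by (rule family_in_levelD(3)[OF x \<tau>])
  obtain V where V: "holomorphic_mat C \<alpha> (disk C \<alpha>) V" "\<And>p. p \<in> disk C \<alpha> \<Longrightarrow> invertible (V p)"
      "agree C (hecke_lift (\<not> up) ?y) (act (at_label \<alpha> V) (x \<tau>))"
      "\<And>p. V p = (mat 1 + hecke_nil (\<not> up) ?y) ** (mat 1 + mat (z\<alpha> p) ** ?N)"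
    using hecke_lift_lift by metis
  note Vg = gauge_at_label[OF V(1,2)]
  \<comment> \<open>Lifting forth and back ends at \<open>x \<tau>\<close> only up to the gauge
    transformation \<open>V\<close>; its inverse, kept constant along the curve, restores the base
    point.\<close>
  define f where "f = (\<lambda>a p. matrix_inv (at_label \<alpha> V a p))"
  have f: "f \<in> gauge_on C D {}" unfolding f_def by (rule gauge_on_inv[OF Vg])
  have f\<alpha>: "f \<alpha> p = matrix_inv (V p)" for p by (simp add: f_def)
  have fx: "agree C (x \<tau>) (act f (hecke_lift (\<not> up) ?y))"
    unfolding f_def by (rule act_eq_imp_inv[OF gauge_on_frame_change[OF Vg] V(3)])
  have yl: "hecke_lift (\<not> up) ?y \<in> level_set C D d"
    by (rule hecke_lift_level[OF hecke_lift_level[OF xl d']]) (simp add: d')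
  have com: "commutes_residue D a (f a (mpoint C a))" if "a \<in> marked C" for a
    by (rule gauge_commutes[OF that f _ _ fx]) (use xl yl in \<open>simp_all add: level_set_def\<close>)
  define c' where "c' \<sigma> = act f (hecke_lift (\<not> up) (c \<sigma>))" for \<sigma>
  have c': "family_in_level C D d S c'"
    unfolding c'_def by (rule family_in_level_gauge[OF family_hecke_lift[OF c] f \<alpha> com]) (simp add: d')
  have c'0: "agree C (c' (\<lambda>_. 0)) (x \<tau>)"
    using agree_trans[OF act_cong[OF hecke_lift_agree[OF c0]] agree_sym[OF fx]] by (simp add: c'_def)
  have H': "symplectic_form C (x \<tau>) (pderiv_family m x \<tau>) (pderiv_family () c' (\<lambda>_. 0)) =
      deriv (\<lambda>t. hitchin_hamiltonian C \<nu> (fst m) (snd m) (c' (\<lambda>_. t))) 0"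
    using H c' S c'0 unfolding hamilton_equation_def by blast
  have ham: "hitchin_hamiltonian C \<nu> i l (c' \<sigma>) = hitchin_hamiltonian C \<nu> i l (c \<sigma>)" for i l \<sigma>
    by (simp add: c'_def hecke_lift_def hitchin_hamiltonian_act gauge_on_frame_change[OF f] frame_change_hecke_frame)
  let ?S1 = "{t. \<tau>(m := t) \<in> T}" and ?X1 = "\<lambda>t. x (\<tau>(m := t))"
    and ?S2 = "{t. (\<lambda>_. 0)(() := t) \<in> S}" and ?C = "\<lambda>t. c ((\<lambda>_. 0)(() := t))" and ?X2 = "\<lambda>t. c' ((\<lambda>_. 0)(() := t))"
  let ?\<Phi>1 = "\<lambda>t p. (mat 1 + hecke_nil up (?X1 t)) ** elem_mod up k (z\<alpha> p)"
    and ?\<Psi>1 = "\<lambda>t p. elem_mod (\<not> up) k (z\<alpha> p) ** (mat 1 - hecke_nil up (?X1 t))"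
  let ?n = "\<lambda>t. hecke_nil (\<not> up) (?C t)"
  \<comment> \<open>\<open>?\<Phi>2\<close> leads from \<open>c'\<close> back to \<open>c\<close>:
    it inverts the frame of the opposite lift followed by the inverse of \<open>V\<close>.\<close>
  let ?\<Phi>2 = "\<lambda>t p. elem_mod up k (z\<alpha> p) ** (mat 1 - ?n t) ** V p"
    and ?\<Psi>2 = "\<lambda>t p. matrix_inv (V p) ** ((mat 1 + ?n t) ** elem_mod (\<not> up) k (z\<alpha> p))"
  have L1: "level_curve C D d ?S1 ?X1" by (rule level_curve_of_family[OF x \<tau>])
  have L2: "level_curve C D d ?S2 ?X2" by (rule level_curve_of_family[OF c' S])
  have LC: "level_curve C D d' ?S2 ?C" by (rule level_curve_of_family[OF c S])
  have t: "\<tau> m \<in> ?S1" "(0::complex) \<in> ?S2" using \<tau> S by (simp_all add: fun_upd_idem)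
  obtain M where M: "raising up k M" "has_mat_deriv (\<lambda>s. hecke_nil up (?X1 s)) M (\<tau> m)"
    by (rule hecke_nil_has_mat_deriv[OF L1 t(1)]) (rule that)
  obtain M' where M': "raising (\<not> up) k M'" "has_mat_deriv ?n M' 0"
    by (rule hecke_nil_has_mat_deriv[OF LC t(2)]) (rule that)
  \<comment> \<open>The logarithmic derivative of \<open>?\<Phi>2\<close>, simplified by n M' = 0.
    It is holomorphic on the disk but shows no factor z.\<close>
  let ?\<theta>2 = "\<lambda>p. - (matrix_inv (V p) ** M' ** V p)"
  have Vd: "invertible (V p)" if "p \<in> overlaps" for p
    using that overlap_disk(1) V(2) by blast
  have Vr: "V p ** matrix_inv (V p) = mat 1" "matrix_inv (V p) ** V p = mat 1" if "p \<in> overlaps" for p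
    using Vd[OF that] by (simp_all add: matrix_inv_right matrix_inv_left)
  have n: "raising (\<not> up) k (?n t)" for t by (rule raising_hecke_nil)
  have e: "elem_mod up k (z\<alpha> p) ** elem_mod (\<not> up) k (z\<alpha> p) = mat 1" if "p \<in> overlaps" for p
    by (rule elem_mod_inverse[OF overlaps_nz[OF that]])
  have inv1: "\<forall>s\<in>?S1. \<forall>p\<in>overlaps. ?\<Phi>1 s p ** ?\<Psi>1 s p = mat 1"
  proof (intro ballI)
    fix s p assume p: "p \<in> overlaps"
    have "?\<Phi>1 s p ** ?\<Psi>1 s p = (mat 1 + hecke_nil up (?X1 s)) ** (elem_mod up k (z\<alpha> p) ** elem_mod (\<not> up) k (z\<alpha> p)) ** (mat 1 - hecke_nil up (?X1 s))"
      by (simp add: matrix_mul_assoc)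
    then show "?\<Phi>1 s p ** ?\<Psi>1 s p = mat 1"
      by (simp add: e[OF p] unipotent_inverse[OF raising_hecke_nil])
  qed
  have inv2: "?\<Phi>2 s p ** ?\<Psi>2 s p = mat 1" if p: "p \<in> overlaps" for s p
  proof -
    have "?\<Phi>2 s p ** ?\<Psi>2 s p = elem_mod up k (z\<alpha> p) ** ((mat 1 - ?n s) ** (V p ** matrix_inv (V p)) ** (mat 1 + ?n s)) ** elem_mod (\<not> up) k (z\<alpha> p)"
      by (simp add: matrix_mul_assoc)
    then show ?thesis by (simp add: Vr(1)[OF p] e[OF p] unipotent_inverse[OF n])
  qed
  have Y2: "agree C (?C s) (act (at_label \<alpha> (?\<Phi>2 s)) (?X2 s))" for s
  proof -
    let ?hf = "hecke_frame (\<not> up) (?C s)"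
    have "agree C (?X2 s) (act (\<lambda>a p. f a p ** ?hf a p) (?C s))"
      unfolding c'_def hecke_lift_def by (rule act_act[OF gauge_on_frame_change[OF f] frame_change_hecke_frame])
    from act_eq_imp_inv[OF frame_change_mult[OF gauge_on_frame_change[OF f] frame_change_hecke_frame] this]
    have "agree C (?C s) (act (\<lambda>a p. matrix_inv (f a p ** ?hf a p)) (?X2 s))" .
    moreover have "matrix_inv (f a p ** ?hf a p) = at_label \<alpha> (?\<Phi>2 s) a p"
      if "a \<in> labels C" "b \<in> labels C" "a \<noteq> b" "p \<in> overlap C a b" for a b p
    proof (cases "a = \<alpha>")
      case True
      then have p: "p \<in> overlaps" using that by blast
      have "(f \<alpha> p ** ?hf \<alpha> p) ** ?\<Phi>2 s p = ?\<Psi>2 s p ** ?\<Phi>2 s p"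
        by (simp add: f\<alpha> hecke_frame_def)
      also have "\<dots> = mat 1" by (rule matrix_left_right_inverse1[OF inv2[OF p]])
      finally show ?thesis using True by (simp add: matrix_inv_eqI)
    qed (simp add: f_def hecke_frame_def matrix_inv_mat_1)
    ultimately show ?thesis
      using agree_trans[OF _ act_frame_cong] by blast
  qed
  have D2: "has_mat_deriv (\<lambda>s. ?\<Phi>2 s p) (?\<Phi>2 0 p ** ?\<theta>2 p) 0"
    "has_mat_deriv (\<lambda>s. ?\<Psi>2 s p) (- (?\<theta>2 p ** ?\<Psi>2 0 p)) 0" if p: "p \<in> overlaps" for p
  proof -
    let ?E = "elem_mod up k (z\<alpha> p)" and ?E' = "elem_mod (\<not> up) k (z\<alpha> p)" and ?W = "matrix_inv (V p)"
    have "has_mat_deriv (\<lambda>s. ?\<Phi>2 s p) (?E ** (0 - M') ** V p) 0"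
      by (intro has_mat_deriv_mult_left has_mat_deriv_mult_right has_mat_deriv_diff has_mat_deriv_const M')
    moreover have "?\<Phi>2 0 p ** ?\<theta>2 p = ?E ** - ((mat 1 - ?n 0) ** (V p ** ?W) ** M') ** V p"
      by (simp add: matrix_mul_assoc matrix_minus_right matrix_minus_left)
    moreover have "(mat 1 - ?n 0) ** M' = M'"
      using raising_mult[OF n M'(1)] by (simp add: matrix_diff_rdistrib)
    ultimately show "has_mat_deriv (\<lambda>s. ?\<Phi>2 s p) (?\<Phi>2 0 p ** ?\<theta>2 p) 0"
      by (simp add: Vr(1)[OF p])
    have "has_mat_deriv (\<lambda>s. ?\<Psi>2 s p) (?W ** ((0 + M') ** ?E')) 0"
      by (intro has_mat_deriv_mult_left has_mat_deriv_mult_right has_mat_deriv_add has_mat_deriv_const M')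
    moreover have "- (?\<theta>2 p ** ?\<Psi>2 0 p) = ?W ** (M' ** (V p ** ?W) ** (mat 1 + ?n 0)) ** ?E'"
      by (simp add: matrix_mul_assoc matrix_minus_left)
    moreover have "M' ** (mat 1 + ?n 0) = M'"
      using raising_mult[OF M'(1) n] by (simp add: matrix_add_ldistrib)
    ultimately show "has_mat_deriv (\<lambda>s. ?\<Psi>2 s p) (- (?\<theta>2 p ** ?\<Psi>2 0 p)) 0"
      by (simp add: Vr(1)[OF p] matrix_mul_assoc)
  qed
  have \<theta>2: "holomorphic_mat C \<alpha> (disk C \<alpha>) ?\<theta>2"
  proof -
    have "holomorphic_mat C \<alpha> (disk C \<alpha>) (\<lambda>p. matrix_inv (V p))"
      by (rule holomorphic_mat_inv[OF \<alpha>_label order_refl V(1,2)])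
    then have "holomorphic_mat C \<alpha> (disk C \<alpha>) (\<lambda>p. 0 - matrix_inv (V p) ** M' ** V p)"
      by (intro holomorphic_mat_diff holomorphic_mat_mult holomorphic_mat_const V(1))
    then show ?thesis by simp
  qed
  \<comment> \<open>At the base point 1 - n cancels the first factor of \<open>V\<close>, and moving
    1 + z N through the elementary modification yields the frame of the lift.\<close>
  have eq: "?\<Phi>2 0 p = ?\<Phi>1 (\<tau> m) p" if p: "p \<in> overlaps" for p
  proof -
    have n0: "?n 0 = hecke_nil (\<not> up) ?y"
      using hecke_nil_agree[OF c0] by (simp add: fun_upd_idem)
    have "?\<Phi>2 0 p = elem_mod up k (z\<alpha> p) ** ((mat 1 - ?n 0) ** (mat 1 + ?n 0)) ** (mat 1 + mat (z\<alpha> p) ** ?N)"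
      unfolding V(4) n0 by (simp add: matrix_mul_assoc)
    also have "\<dots> = elem_mod up k (z\<alpha> p) + elem_mod up k (z\<alpha> p) ** (mat (z\<alpha> p) ** ?N)"
      unfolding unipotent_inverse[OF n] by (simp add: matrix_add_ldistrib)
    also have "\<dots> = ?\<Phi>1 (\<tau> m) p"
      by (simp add: elem_mod_shift[OF raising_hecke_nil overlaps_nz[OF p]] matrix_add_rdistrib)
    finally show ?thesis .
  qed
  have base: "agree C (?X2 0) (?X1 (\<tau> m))"
    using c'0 by (simp add: fun_upd_idem)
  have Y1: "\<forall>s\<in>?S1. agree C (hecke_lift up (?X1 s)) (act (at_label \<alpha> (?\<Phi>1 s)) (?X1 s))"
    by (simp add: hecke_lift_def hecke_frame_def agree_refl)
  have D1: "\<forall>p\<in>overlaps. has_mat_deriv (\<lambda>s. ?\<Phi>1 s p) (?\<Phi>1 (\<tau> m) p ** (mat (z\<alpha> p) ** M)) (\<tau> m)"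
      "\<forall>p\<in>overlaps. has_mat_deriv (\<lambda>s. ?\<Psi>1 s p) (- (mat (z\<alpha> p) ** M ** ?\<Psi>1 (\<tau> m) p)) (\<tau> m)"
    by (rule ballI, rule hecke_frame_deriv[OF M raising_hecke_nil], erule overlaps_nz)+
  have "symplectic_form C (hecke_lift up (?X1 (\<tau> m))) (velocity (\<lambda>t. hecke_lift up (?X1 t)) (\<tau> m)) (velocity ?C 0) =
      symplectic_form C (?X1 (\<tau> m)) (velocity ?X1 (\<tau> m)) (velocity ?X2 0)"
    by (rule symplectic_form_singular_change[where \<Phi>\<^sub>1 = ?\<Phi>1 and \<Psi>\<^sub>1 = ?\<Psi>1 and \<Phi>\<^sub>2 = ?\<Phi>2 and \<Psi>\<^sub>2 = ?\<Psi>2,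
          OF L1 L2 t base Y1 ballI[OF Y2] inv1 ballI[OF ballI[OF inv2]] D1 ballI[OF D2(1)] ballI[OF D2(2)] \<theta>2 ballI[OF eq]])
  then show "symplectic_form C ?y (pderiv_family m (\<lambda>\<tau>. hecke_lift up (x \<tau>)) \<tau>) (pderiv_family () c (\<lambda>_. 0)) =
      deriv (\<lambda>t. hitchin_hamiltonian C \<nu> (fst m) (snd m) (c (\<lambda>_. t))) 0"
    using H' by (simp add: pderiv_family_velocity ham)
qed

end

section \<open>Maps of phase spaces\<close>

text \<open>Only values on the phase space enter the notion. This is applied to
  \<open>inv_into\<close>, which is identified with an explicit inverse on that set.\<close>

lemma symplectic_map_cong:
  assumes "symplectic_map C D d d' F" "\<And>X. X \<in> phase_space C D d \<Longrightarrow> F' X = F X"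
  shows "symplectic_map C D d d' F'"
proof -
  have c: "F' (gauge_rel C D d `` {x \<tau>}) = F (gauge_rel C D d `` {x \<tau>})"
    if "family_in_level C D d T x" "\<tau> \<in> T" for T and x :: "(bool \<Rightarrow> complex) \<Rightarrow> _" and \<tau>
    using assms(2) family_in_levelD(3)[OF that] by (simp add: phase_space_def quotientI)
  show ?thesis
    unfolding symplectic_map_def
  proof (intro conjI allI impI ballI)
    show "F' \<in> phase_space C D d \<rightarrow> phase_space C D d'"
      using assms by (auto simp: symplectic_map_def)
    fix T :: "(bool \<Rightarrow> complex) set" and x \<tau>\<^sub>0
    assume x: "family_in_level C D d T x" and "\<tau>\<^sub>0 \<in> T"
    with assms(1) obtain T' y where y: "\<tau>\<^sub>0 \<in> T'" "T' \<subseteq> T" "family_in_level C D d' T' y"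
        "\<forall>\<tau>\<in>T'. gauge_rel C D d' `` {y \<tau>} = F (gauge_rel C D d `` {x \<tau>}) \<and>
          symplectic_form C (y \<tau>) (pderiv_family False y \<tau>) (pderiv_family True y \<tau>) =
          symplectic_form C (x \<tau>) (pderiv_family False x \<tau>) (pderiv_family True x \<tau>)"
      unfolding symplectic_map_def by meson
    then show "\<exists>T' y. \<tau>\<^sub>0 \<in> T' \<and> T' \<subseteq> T \<and> family_in_level C D d' T' y \<and>
        (\<forall>\<tau>\<in>T'. gauge_rel C D d' `` {y \<tau>} = F' (gauge_rel C D d `` {x \<tau>}) \<and>
          symplectic_form C (y \<tau>) (pderiv_family False y \<tau>) (pderiv_family True y \<tau>) =
          symplectic_form C (x \<tau>) (pderiv_family False x \<tau>) (pderiv_family True x \<tau>))"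
      using c[OF x] by (intro exI[of _ T'] exI[of _ y]) auto
  qed
qed

lemma symplectic_map_comp:
  assumes F: "symplectic_map C D d d' F" and G: "symplectic_map C D d' d'' G"
  shows "symplectic_map C D d d'' (G \<circ> F)"
  unfolding symplectic_map_def
proof (intro conjI allI impI ballI)
  show "G \<circ> F \<in> phase_space C D d \<rightarrow> phase_space C D d''"
    using F G by (auto simp: symplectic_map_def)
  fix T :: "(bool \<Rightarrow> complex) set" and x \<tau>\<^sub>0
  assume x: "family_in_level C D d T x" and "\<tau>\<^sub>0 \<in> T"
  with F obtain T' y where y: "\<tau>\<^sub>0 \<in> T'" "T' \<subseteq> T" "family_in_level C D d' T' y"
      "\<forall>\<tau>\<in>T'. gauge_rel C D d' `` {y \<tau>} = F (gauge_rel C D d `` {x \<tau>}) \<and>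
        symplectic_form C (y \<tau>) (pderiv_family False y \<tau>) (pderiv_family True y \<tau>) =
        symplectic_form C (x \<tau>) (pderiv_family False x \<tau>) (pderiv_family True x \<tau>)"
    unfolding symplectic_map_def by meson
  with G obtain T'' z where z: "\<tau>\<^sub>0 \<in> T''" "T'' \<subseteq> T'" "family_in_level C D d'' T'' z"
      "\<forall>\<tau>\<in>T''. gauge_rel C D d'' `` {z \<tau>} = G (gauge_rel C D d' `` {y \<tau>}) \<and>
        symplectic_form C (z \<tau>) (pderiv_family False z \<tau>) (pderiv_family True z \<tau>) =
        symplectic_form C (y \<tau>) (pderiv_family False y \<tau>) (pderiv_family True y \<tau>)"
    unfolding symplectic_map_def by meson
  show "\<exists>T' y. \<tau>\<^sub>0 \<in> T' \<and> T' \<subseteq> T \<and> family_in_level C D d'' T' y \<and>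
      (\<forall>\<tau>\<in>T'. gauge_rel C D d'' `` {y \<tau>} = (G \<circ> F) (gauge_rel C D d `` {x \<tau>}) \<and>
        symplectic_form C (y \<tau>) (pderiv_family False y \<tau>) (pderiv_family True y \<tau>) =
        symplectic_form C (x \<tau>) (pderiv_family False x \<tau>) (pderiv_family True x \<tau>))"
    using y z by (intro exI[of _ T''] exI[of _ z]) auto
qed

context hecke_point
begin

text \<open>The arguments about a correspondence use only its effect on classes of points of the
  level set. So the given maps, with their constant factors, and the inverses built with trivial
  factor are treated on the same footing.\<close>

definition lifts_to :: "bool \<Rightarrow> int \<Rightarrow> int \<Rightarrow> (('s, 'i, 'n) config set \<Rightarrow> ('s, 'i, 'n) config set) \<Rightarrow> bool" where
  "lifts_to up d d' F \<longleftrightarrow> d' = d + (if up then 1 else - 1) \<and>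
     (\<forall>x\<in>level_set C D d. F (gauge_rel C D d `` {x}) = gauge_rel C D d' `` {hecke_lift up x})"

lemma hecke_lifts_to:
  assumes "invertible P" "d' = d + (if up then 1 else - 1)"
  shows "lifts_to up d d' (hecke C D d' \<alpha> (\<lambda>z. P ** elem_mod up k z))"
  using hecke_class[OF _ assms(2,1)] assms(2) by (simp add: lifts_to_def)

lemma lifts_to_maps:
  assumes "lifts_to up d d' F" "X \<in> phase_space C D d"
  shows "F X \<in> phase_space C D d'"
  using assms(2)
proof (rule phase_spaceE)
  fix x assume x: "x \<in> level_set C D d" "X = gauge_rel C D d `` {x}"
  then show ?thesis
    using assms(1) hecke_lift_level[OF x(1)] by (simp add: lifts_to_def phase_space_class)
qed

lemma lifts_to_inverse:
  assumes F: "lifts_to up d d' F" and G: "lifts_to (\<not> up) d' d G" and X: "X \<in> phase_space C D d"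
  shows "G (F X) = X"
  using X
proof (rule phase_spaceE)
  fix x assume x: "x \<in> level_set C D d" "X = gauge_rel C D d `` {x}"
  have "hecke_lift up x \<in> level_set C D d'"
    using F x(1) by (intro hecke_lift_level) (simp_all add: lifts_to_def)
  then have "G (F X) = gauge_rel C D d `` {hecke_lift (\<not> up) (hecke_lift up x)}"
    using F G x by (simp add: lifts_to_def)
  also have "\<dots> = gauge_rel C D d `` {x}"
    by (rule equiv_class_eq[OF equiv_gauge_rel[OF D] hecke_lift_lift_rel[OF x(1)], symmetric])
  finally show ?thesis using x(2) by simp
qed

lemma lifts_to_symplectic:
  assumes F: "lifts_to up d d' F"
  shows "symplectic_map C D d d' F"
  unfolding symplectic_map_def
proof (intro conjI allI impI ballI)
  show "F \<in> phase_space C D d \<rightarrow> phase_space C D d'"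
    using lifts_to_maps[OF F] by blast
  fix T :: "(bool \<Rightarrow> complex) set" and x \<tau>\<^sub>0
  assume x: "family_in_level C D d T x" and \<tau>0: "\<tau>\<^sub>0 \<in> T"
  let ?y = "\<lambda>\<tau>. hecke_lift up (x \<tau>)"
  have "family_in_level C D d' T ?y"
    using F by (intro family_hecke_lift[OF x]) (simp add: lifts_to_def)
  moreover have "gauge_rel C D d' `` {?y \<tau>} = F (gauge_rel C D d `` {x \<tau>})" if "\<tau> \<in> T" for \<tau>
    using F family_in_levelD(3)[OF x that] by (simp add: lifts_to_def)
  ultimately show "\<exists>T' y. \<tau>\<^sub>0 \<in> T' \<and> T' \<subseteq> T \<and> family_in_level C D d' T' y \<and>
      (\<forall>\<tau>\<in>T'. gauge_rel C D d' `` {y \<tau>} = F (gauge_rel C D d `` {x \<tau>}) \<and>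
        symplectic_form C (y \<tau>) (pderiv_family False y \<tau>) (pderiv_family True y \<tau>) =
        symplectic_form C (x \<tau>) (pderiv_family False x \<tau>) (pderiv_family True x \<tau>))"
    using \<tau>0 hecke_lift_symplectic[OF x] by (intro exI[of _ T] exI[of _ ?y]) simp
qed

text \<open>A local lift of the solution is lifted once more; Hamilton's equation is transported for
  each time separately.\<close>

lemma lifts_to_solution:
  assumes F: "lifts_to up d d' F" and u: "hierarchy_solution C D d \<nu> J T u"
  shows "hierarchy_solution C D d' \<nu> J T (F \<circ> u)"
  unfolding hierarchy_solution_def
proof (intro conjI ballI impI)
  note U = u[unfolded hierarchy_solution_def]
  note u' = U[THEN conjunct1] U[THEN conjunct2, THEN conjunct1] U[THEN conjunct2, THEN conjunct2, THEN conjunct1]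
  show "open T" by (rule u')
  show "F \<circ> u \<in> T \<rightarrow> phase_space C D d'"
    by (intro Pi_I) (simp add: lifts_to_maps[OF F] funcset_mem[OF u'(2)])
  show "(F \<circ> u) \<tau> = (F \<circ> u) \<sigma>" if "\<tau> \<in> T" "\<sigma> \<in> T" "\<forall>m\<in>J. \<tau> m = \<sigma> m" for \<tau> \<sigma>
  proof -
    have "u \<tau> = u \<sigma>" using u'(3) that by blast
    then show ?thesis by simp
  qed
  fix \<tau>\<^sub>0 assume "\<tau>\<^sub>0 \<in> T"
  with u have "\<exists>T' x. \<tau>\<^sub>0 \<in> T' \<and> T' \<subseteq> T \<and> family_in_level C D d T' x \<and>
      (\<forall>\<tau>\<in>T'. u \<tau> = gauge_rel C D d `` {x \<tau>} \<and> (\<forall>m\<in>J. hamilton_equation C D d \<nu> m x \<tau>))"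
    unfolding hierarchy_solution_def by blast
  then obtain T' x where x: "\<tau>\<^sub>0 \<in> T'" "T' \<subseteq> T" "family_in_level C D d T' x"
      "\<forall>\<tau>\<in>T'. u \<tau> = gauge_rel C D d `` {x \<tau>} \<and> (\<forall>m\<in>J. hamilton_equation C D d \<nu> m x \<tau>)"
    by (elim exE conjE) (rule that)
  have d': "d' = d + (if up then 1 else - 1)" using F by (simp add: lifts_to_def)
  show "\<exists>T' x. \<tau>\<^sub>0 \<in> T' \<and> T' \<subseteq> T \<and> family_in_level C D d' T' x \<and>
      (\<forall>\<tau>\<in>T'. (F \<circ> u) \<tau> = gauge_rel C D d' `` {x \<tau>} \<and> (\<forall>m\<in>J. hamilton_equation C D d' \<nu> m x \<tau>))"
  proof (rule exI[of _ T'], rule exI[of _ "\<lambda>\<tau>. hecke_lift up (x \<tau>)"], intro conjI ballI)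
    show "family_in_level C D d' T' (\<lambda>\<tau>. hecke_lift up (x \<tau>))"
      by (rule family_hecke_lift[OF x(3) d'])
    fix \<tau> assume \<tau>: "\<tau> \<in> T'"
    show "(F \<circ> u) \<tau> = gauge_rel C D d' `` {hecke_lift up (x \<tau>)}"
      using F x(4) \<tau> family_in_levelD(3)[OF x(3) \<tau>] by (simp add: lifts_to_def)
    show "hamilton_equation C D d' \<nu> m (\<lambda>\<tau>. hecke_lift up (x \<tau>)) \<tau>" if "m \<in> J" for m
      using x(4) \<tau> that by (intro hecke_lift_hamilton[OF x(3) \<tau> d']) blast
  qed (use x in auto)
qed

end

section \<open>The matrices of the upper and lower correspondence\<close>

lemma position_less: "position (i :: 'n::{finite,linorder}) < CARD('n)"
  unfolding position_def by (intro psubset_card_mono) auto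

lemma position_strict_mono: "i < j \<Longrightarrow> position i < position j"
  unfolding position_def by (intro psubset_card_mono) (auto intro: less_trans)

lemma position_inject: "position i = position j \<longleftrightarrow> i = j"
  using position_strict_mono by (metis less_irrefl neqE)

lemma position_surj:
  assumes "m < CARD('n::{finite,linorder})"
  obtains i :: "'n::{finite,linorder}" where "position i = m"
proof -
  have "inj (position :: 'n \<Rightarrow> nat)" by (simp add: inj_def position_inject)
  then have "card (range (position :: 'n \<Rightarrow> nat)) = CARD('n)" by (rule card_image)
  moreover have "range (position :: 'n \<Rightarrow> nat) \<subseteq> {..<CARD('n)}" using position_less by auto
  ultimately have "range (position :: 'n \<Rightarrow> nat) = {..<CARD('n)}"
    by (intro card_subset_eq) auto
  then show thesis using assms that by (metis imageE lessThan_iff)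
qed

lemma position_Min: "position i = 0 \<longleftrightarrow> i = Min UNIV"
proof -
  have "{j :: 'a. j < Min UNIV} = {}"
    using leD[OF Min_le[OF finite UNIV_I]] by blast
  then have "position (Min UNIV :: 'a) = 0" by (simp only: position_def card.empty)
  then show ?thesis by (metis position_inject)
qed

lemma position_Max: "Suc (position i) = CARD('n) \<longleftrightarrow> i = Max UNIV" for i :: "'n::{finite,linorder}"
proof -
  have "{j. j < Max (UNIV :: 'n set)} = UNIV - {Max UNIV}"
    by (auto simp: less_le)
  then have "position (Max UNIV :: 'n) = CARD('n) - 1"
    by (simp add: position_def card_Diff_singleton)
  then have "Suc (position (Max UNIV :: 'n)) = CARD('n)" by simp
  then show ?thesis by (metis Suc_inject position_inject)
qed

text \<open>\<open>Xi_plus z\<close> carries z only in the column of the first basis vector, so it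
  is a cyclic permutation matrix times a diagonal one.\<close>

lemma Xi_plus_elem_mod: "Xi_plus z = Xi_plus 1 ** elem_mod True (Min UNIV) z"
  unfolding vec_eq_iff mult_elem_mod
proof (intro allI)
  fix i j :: 'a
  show "Xi_plus z $ i $ j = Xi_plus 1 $ i $ j * elem_weight True (Min UNIV) z j"
  proof (cases "j = Min UNIV")
    case True
    then have "position j = 0" by (simp add: position_Min)
    then show ?thesis using True by (simp add: Xi_plus_def elem_weight_def)
  next
    case False
    then have "position j \<noteq> 0" by (simp add: position_Min)
    then show ?thesis using False by (simp add: Xi_plus_def elem_weight_def)
  qed
qed

lemma Xi_minus_elem_mod: "Xi_minus z = Xi_minus 1 ** elem_mod False (Max UNIV) z"
  unfolding vec_eq_iff mult_elem_mod
proof (intro allI)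
  fix i j :: 'a
  \<comment> \<open>The last column contains no entry of the shift, since \<open>position i\<close>
    stays below \<open>CARD('n)\<close>; only the entry \<open>inverse z\<close> remains
    there.\<close>
  have "position i \<noteq> Suc (position j)" if "j = Max UNIV"
    using that position_Max[of j] position_less[of i] by simp
  then show "Xi_minus z $ i $ j = Xi_minus 1 $ i $ j * elem_weight False (Max UNIV) z j"
    by (auto simp: Xi_minus_def elem_weight_def position_Max)
qed

text \<open>At z = 1 the two matrices are the cyclic shift of the basis and the shift back.\<close>

lemma Xi_minus_plus: "Xi_minus 1 ** Xi_plus 1 = (mat 1 :: 'n::{finite,linorder} cmat)"
  unfolding vec_eq_iff matrix_mul_nth
proof (intro allI)
  fix i j :: 'n
  let ?c = "CARD('n)"
  \<comment> \<open>The cyclic predecessor of \<open>i\<close>: position 0 wraps around to the last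
    one.\<close>
  define m where "m = (if position i = 0 then ?c - 1 else position i - 1)"
  have "m < ?c" using position_less[of i] by (auto simp: m_def less_imp_diff_less)
  then obtain l :: 'n where l: "position l = m" by (rule position_surj) (rule that)
  have minus: "Xi_minus 1 $ i $ l' = (if l' = l then 1 else 0 :: complex)" for l'
  proof -
    have "position i = Suc (position l') \<or> position i = 0 \<and> Suc (position l') = ?c \<longleftrightarrow> position l' = m"
      using position_less[of l'] by (auto simp: m_def)
    then show ?thesis by (auto simp: Xi_minus_def l[symmetric] position_inject)
  qed
  have plus: "Xi_plus 1 $ l $ j = (if i = j then 1 else 0 :: complex)"
  proof -
    have "position j = Suc m \<or> Suc m = ?c \<and> position j = 0 \<longleftrightarrow> position i = position j"
      using position_less[of i] position_less[of j] by (auto simp: m_def split: if_splits)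
    then show ?thesis by (auto simp: Xi_plus_def l position_inject)
  qed
  have "(\<Sum>l'\<in>UNIV. Xi_minus 1 $ i $ l' * Xi_plus 1 $ l' $ j) = (Xi_plus 1 $ l $ j :: complex)"
    by (simp add: minus if_distrib[of "\<lambda>x. x * _"] cong: if_cong)
  then show "(\<Sum>l'\<in>UNIV. Xi_minus 1 $ i $ l' * Xi_plus 1 $ l' $ j) = (mat 1 :: 'n cmat) $ i $ j"
    by (simp add: plus mat_nth)
qed

lemma invertible_Xi: "invertible (Xi_plus 1)" "invertible (Xi_minus 1)"
  using Xi_minus_plus invertible_left_inverse invertible_right_inverse by blast+

lemma mult_reorder_frame:
  assumes "bij s"
  shows "(A ** reorder_frame s) $ i $ s j = A $ i $ j"
proof -
  have "(A ** reorder_frame s) $ i $ s j = (\<Sum>l\<in>UNIV. if l = j then A $ i $ j else 0)"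
    unfolding matrix_mul_nth
    by (rule sum.cong) (use bij_is_inj[OF assms] in \<open>auto simp: reorder_frame_def inj_eq\<close>)
  then show ?thesis by simp
qed

text \<open>Moving the diagonal matrix through the permutation relabels its distinguished place; for
  \<open>k = Max UNIV\<close> the new place is the one that \<open>lower_frame\<close> requires to
  form a block of its own.\<close>

lemma elem_mod_reorder_frame:
  assumes "bij s"
  shows "elem_mod up k z ** reorder_frame s = reorder_frame s ** elem_mod up (s k) z"
  unfolding vec_eq_iff
proof (intro allI)
  fix i j
  have "reorder_frame s $ i $ j = (0::complex)" if "elem_weight up k z i \<noteq> elem_weight up (s k) z j"
    using that assms by (auto simp: reorder_frame_def elem_weight_def bij_def inj_eq split: if_splits)
  then show "(elem_mod up k z ** reorder_frame s) $ i $ j = (reorder_frame s ** elem_mod up (s k) z) $ i $ j"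
    unfolding elem_mod_mult mult_elem_mod by (cases "elem_weight up k z i = elem_weight up (s k) z j") simp_all
qed

lemma invertible_reorder_frame:
  assumes "bij s"
  shows "invertible (reorder_frame s)"
proof (rule invertibleI)
  show "reorder_frame s ** reorder_frame (inv s) = mat 1"
    unfolding vec_eq_iff
  proof (intro allI)
    fix i j
    obtain l where j: "j = inv s l" using assms by (metis bij_inv_eq_iff)
    show "(reorder_frame s ** reorder_frame (inv s)) $ i $ j = mat 1 $ i $ j"
      unfolding j mult_reorder_frame[OF bij_imp_bij_inv[OF assms]]
      using assms by (auto simp: reorder_frame_def mat_nth bij_inv_eq_iff)
  qed
qed

section \<open>The composition of the two correspondences and its inverse\<close>

theorem corollary3p1:
  fixes C :: "('s::t2_space, 'i) curve"
    and D :: "('i, 'n::{finite,linorder}) parabolic"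
    and \<nu> :: "('s, 'i) differentials"
    and K :: "nat \<Rightarrow> nat set"
    and \<alpha>\<^sub>1 \<alpha>\<^sub>2 :: 'i
    and s :: "'n \<Rightarrow> 'n"
    and d :: int
  assumes "marked_curve C"
    and "parabolic_data C D"
    and "holomorphic_differentials C (hierarchy_indices TYPE('n) K) \<nu>"
    and "\<alpha>\<^sub>1 \<in> marked C" and "smallest_subspace_is_line D \<alpha>\<^sub>1"
    and "\<alpha>\<^sub>2 \<in> marked C" and "smallest_subspace_is_line D \<alpha>\<^sub>2"
    and "lower_frame D \<alpha>\<^sub>2 s"
  shows "baecklund_transformation C D d \<nu> (hierarchy_indices TYPE('n) K)
           (hecke_upper C D \<alpha>\<^sub>1 (d - 1) \<circ> hecke_lower C D \<alpha>\<^sub>2 s d)"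
proof -
  let ?k = "Min UNIV :: 'n" and ?l = "s (Max UNIV)"
  \<comment> \<open>The block number is monotone in the index, so the first basis vector lies in the
    lowest block, which is one-dimensional by assumption.\<close>
  have single1: "i = ?k" if "flag D \<alpha>\<^sub>1 i = flag D \<alpha>\<^sub>1 ?k" for i
  proof -
    have "mono (flag D \<alpha>\<^sub>1)" using assms(2,4) by (simp add: parabolic_data_def)
    then have "flag D \<alpha>\<^sub>1 ?k = Min (range (flag D \<alpha>\<^sub>1))"
      by (intro Min_eqI[symmetric]) (auto intro!: monoD[of "flag D \<alpha>\<^sub>1"])
    then have "card {i. flag D \<alpha>\<^sub>1 i = flag D \<alpha>\<^sub>1 ?k} = 1"
      using assms(5) by (simp add: smallest_subspace_is_line_def)
    then show ?thesis using that by (auto simp: card_1_singleton_iff set_eq_iff)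
  qed
  have s: "bij s" using assms(8) by (simp add: lower_frame_def)
  have single2: "i = ?l" if "flag D \<alpha>\<^sub>2 i = flag D \<alpha>\<^sub>2 ?l" for i
    using assms(8) that by (auto simp: lower_frame_def card_1_singleton_iff set_eq_iff)
  interpret A: hecke_point C D \<alpha>\<^sub>1 ?k
    by unfold_locales (use assms single1 in auto)
  interpret B: hecke_point C D \<alpha>\<^sub>2 ?l
    by unfold_locales (use assms single2 in auto)
  let ?J = "hierarchy_indices TYPE('n) K"
  let ?F = "hecke_upper C D \<alpha>\<^sub>1 (d - 1)" and ?G = "hecke_lower C D \<alpha>\<^sub>2 s d"
  let ?P = "phase_space C D d" and ?P' = "phase_space C D (d - 1)"
  have F: "A.lifts_to True (d - 1) d ?F"
    using A.hecke_lifts_to[OF invertible_Xi(1), of d "d - 1" True]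
    by (simp add: hecke_upper_def flip: Xi_plus_elem_mod)
  \<comment> \<open>The constant invertible factor is \<open>Xi_minus 1 ** reorder_frame s\<close>,
    and the elementary modification sits at \<open>s (Max UNIV)\<close>.\<close>
  have "(\<lambda>z. Xi_minus 1 ** reorder_frame s ** elem_mod False ?l z) = (\<lambda>z. Xi_minus z ** reorder_frame s)"
  proof
    fix z
    show "Xi_minus 1 ** reorder_frame s ** elem_mod False ?l z = Xi_minus z ** reorder_frame s"
      by (subst (2) Xi_minus_elem_mod) (simp add: elem_mod_reorder_frame[OF s] flip: matrix_mul_assoc)
  qed
  then have G: "B.lifts_to False d (d - 1) ?G"
    using B.hecke_lifts_to[OF invertible_mult[OF invertible_Xi(2) invertible_reorder_frame[OF s]], of "d - 1" d False]
    by (simp add: hecke_lower_def)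
  \<comment> \<open>The inverse is built from elementary modifications of the opposite sign with
    trivial constant factor: downwards at \<open>\<alpha>\<^sub>1\<close>, then upwards at
    \<open>\<alpha>\<^sub>2\<close>.\<close>
  obtain F' where F': "A.lifts_to (\<not> True) d (d - 1) F'"
    using A.hecke_lifts_to[OF invertible_mat_1, of "d - 1" d False] by auto
  obtain G' where G': "B.lifts_to (\<not> False) (d - 1) d G'"
    using B.hecke_lifts_to[OF invertible_mat_1, of d "d - 1" True] by auto
  note maps = A.lifts_to_maps[OF F] A.lifts_to_maps[OF F'] B.lifts_to_maps[OF G] B.lifts_to_maps[OF G']
  have inv: "(G' \<circ> F') ((?F \<circ> ?G) X) = X" "(?F \<circ> ?G) ((G' \<circ> F') X) = X" if X: "X \<in> ?P" for X
    using A.lifts_to_inverse[OF F F' maps(3)[OF X]] B.lifts_to_inverse[OF G G' X]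
      B.lifts_to_inverse[OF G', simplified, OF G maps(2)[OF X]] A.lifts_to_inverse[OF F', simplified, OF F X] by simp_all
  have bij: "bij_betw (?F \<circ> ?G) ?P ?P"
    by (rule bij_betw_byWitness[where f' = "G' \<circ> F'"]) (use inv maps in auto)
  \<comment> \<open>Agreement with the explicit composite on the phase space makes the abstract
    inverse symplectic as well.\<close>
  have "inv_into ?P (?F \<circ> ?G) X = (G' \<circ> F') X" if "X \<in> ?P" for X
    using that inv(2)[OF that] maps(2,4) bij_betw_imp_inj_on[OF bij]
    by (intro inv_into_f_eq) auto
  then have "symplectic_map C D d d (inv_into ?P (?F \<circ> ?G))"
    using symplectic_map_comp[OF A.lifts_to_symplectic[OF F'] B.lifts_to_symplectic[OF G']]
    by (rule symplectic_map_cong[rotated])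
  then have "symplectic_transformation C D d (?F \<circ> ?G)"
    using bij symplectic_map_comp[OF B.lifts_to_symplectic[OF G] A.lifts_to_symplectic[OF F]]
    by (simp add: symplectic_transformation_def)
  moreover have "hierarchy_solution C D d \<nu> ?J T (?F \<circ> ?G \<circ> u)" if "hierarchy_solution C D d \<nu> ?J T u" for T u
    using A.lifts_to_solution[OF F B.lifts_to_solution[OF G that]] by (simp add: o_assoc)
  ultimately show ?thesis
    by (simp add: baecklund_transformation_def)
qed

end
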